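(* Let $\mathscr{T}=(V,E)$ be a countably infinite rooted and leafless directed tree, and $\boldsymbol\lambda=\{\lambda_v\}_{v\in V^\circ}\subseteq(0,\infty)$. Assume that $S_{\boldsymbol\lambda}\in\mathbf{B}(\ell^2(V))$ is balanced and left-invertible. Assume also that $\dim\ker S_{\boldsymbol\lambda}^*<\infty$ and $\{e'_j\}_{j\in J}$ is a separated basis of $\ker S_{\boldsymbol\lambda}^*$. Then the commutant $\{S_{\boldsymbol\lambda}\}'$ of $S_{\boldsymbol\lambda}$ can be expressed as $$U\{S_{\boldsymbol\lambda}\}'U^*=\Big\{M_{\hat\varphi}\ \Big|\ \hat\varphi\colon\mathbb{N}_0\to\mathbf{B}(\ker S_{\boldsymbol\lambda}^* ),\ \big\{\langle\hat\varphi(n)e'_j,e'_i\rangle\big\}_{n=0}^\infty\in H^\infty\big(\{\|S_{\boldsymbol\lambda}^ne_{\mathsf{root}}\|^2\}_{n=0}^\infty\big)\text{ for all } i,j\in J\Big\}.$$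
   Context: $\mathbb{N}_0=\{0,1,2,\dots\}$. A rooted directed tree $\mathscr{T}=(V,E)$ has a unique vertex $\mathsf{root}$ without parent; every other vertex $v$ has a unique parent $\mathsf{par}(v)$; $V^\circ=V\setminus\{\mathsf{root}\}$; $|v|$ is the unique $k\in\mathbb{N}_0$ with $\mathsf{par}^k(v)=\mathsf{root}$; $V_k=\{v\in V:|v|=k\}$. The tree is leafless if every vertex has at least one child. $\ell^2(V)$ is the space of square-summable functions $V\to\mathbb{C}$, $e_u$ is the characteristic function of $\{u\}$, and $\ell^2(V_k)$ is the subspace of functions vanishing off $V_k$. The weighted shift $S_{\boldsymbol\lambda}$ with weights $\boldsymbol\lambda$ is the operator in $\ell^2(V)$ given by $(S_{\boldsymbol\lambda}f)(v)=\lambda_vf(\mathsf{par}(v))$ for $v\in V^\circ$ and $(S_{\boldsymbol\lambda}f)(\mathsf{root})=0$, on its maximal domain; $\mathbf{B}(\cdot)$ denotes bounded everywhere defined operators. Bounded weighted shifts on rooted directed trees are analytic ($\bigcap_n S_{\boldsymbol\lambda}^n(\ell^2(V))=\{0\}$). Left-invertible means having a bounded left inverse. $S_{\boldsymbol\lambda}$ is balanced if $\|S_{\boldsymbol\lambda}e_u\|=\|S_{\boldsymbol\lambda}e_v\|$ whenever $u,v\in V$ and $|u|=|v|$. A separated basis of $\ker S_{\boldsymbol\lambda}^*$ is an orthonormal basis $\{e'_j\}_{j\in J}$ such that for every $j\in J$ there is $k_j\in\mathbb{N}_0$ with $e'_j\in\ell^2(V_{k_j})$. The commutant is $\{S_{\boldsymbol\lambda}\}'=\{A\in\mathbf{B}(\ell^2(V)):AS_{\boldsymbol\lambda}=S_{\boldsymbol\lambda}A\}$.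 Put $T=S_{\boldsymbol\lambda}$, $H=\ell^2(V)$, $\mathcal{E}=\ker T^*$, $P_{\mathcal{E}}$ the orthogonal projection onto $\mathcal{E}$, $L=(T^*T)^{-1}T^*$, $r=1/r(L)$ ($r(L)$ the spectral radius), $\mathbb{D}_r=\{|z|<r\}$. For $f\in H$ let $(Uf)(z)=\sum_{n=0}^\infty(P_{\mathcal{E}}L^nf)z^n$, $z\in\mathbb{D}_r$; $U$ is injective, and $\mathcal{H}:=U(H)$ is a space of $\mathcal{E}$-valued analytic functions on $\mathbb{D}_r$ with the inner product making $U\colon H\to\mathcal{H}$ unitary. For $\boldsymbol f\in\mathcal{H}$, $\hat{\boldsymbol f}(n)=P_{\mathcal{E}}L^nU^*\boldsymbol f$ are its Taylor coefficients. For $\hat\varphi\colon\mathbb{N}_0\to\mathbf{B}(\mathcal{E})$, $M_{\hat\varphi}$ is the operator in $\mathcal{H}$ with domain consisting of $\boldsymbol f\in\mathcal{H}$ for which there is $\boldsymbol g\in\mathcal{H}$ with $\hat{\boldsymbol g}(n)=\sum_{k=0}^n\hat\varphi(k)\hat{\boldsymbol f}(n-k)$ for all $n\in\mathbb{N}_0$, and $M_{\hat\varphi}\boldsymbol f=\boldsymbol g$. For complex sequences $a,b$, $(a*b)(n)=\sum_{k=0}^na_kb_{n-k}$. For $\beta=\{\beta_n\}_{n=0}^\infty\subset(0,\infty)$, $\ell^2(\beta)=\{a\in\mathbb{C}^{\mathbb{N}_0}:\sum_{n=0}^\infty|a_n|^2\beta_n<\infty\}$ and $H^\infty(\beta)=\{a\in\mathbb{C}^{\mathbb{N}_0}: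 a*b\in\ell^2(\beta)\text{ for every }b\in\ell^2(\beta)\}$. *)

theory Defs
  imports "HOL-Analysis.Analysis"
begin

section \<open>Rooted directed trees\<close>

definition rooted_directed_tree :: "'v set \<Rightarrow> ('v \<times> 'v) set \<Rightarrow> bool" where
  "rooted_directed_tree V E \<longleftrightarrow>
     E \<subseteq> V \<times> V \<and>
     (\<forall>u\<in>V. \<forall>v\<in>V. (u, v) \<in> (E \<union> E\<inverse>)\<^sup>*) \<and>
     acyclic E \<and>
     (\<exists>!r. r \<in> V \<and> (\<forall>u. (u, r) \<notin> E)) \<and>
     (\<forall>v\<in>V. \<forall>u w. (u, v) \<in> E \<and> (w, v) \<in> E \<longrightarrow> u = w)"

definition tree_root :: "'v set \<Rightarrow> ('v \<times> 'v) set \<Rightarrow> 'v" where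
  "tree_root V E = (THE r. r \<in> V \<and> (\<forall>u. (u, r) \<notin> E))"

definition par :: "('v \<times> 'v) set \<Rightarrow> 'v \<Rightarrow> 'v" where
  "par E v = (THE u. (u, v) \<in> E)"

(* The value of par at the root is arbitrary (possibly the root again), so the unique k with
   par^k(v) = root has to be selected as the least one. *)
definition depth :: "'v set \<Rightarrow> ('v \<times> 'v) set \<Rightarrow> 'v \<Rightarrow> nat" where
  "depth V E v = (LEAST k. (par E ^^ k) v = tree_root V E)"

definition leafless :: "'v set \<Rightarrow> ('v \<times> 'v) set \<Rightarrow> bool" where
  "leafless V E \<longleftrightarrow> (\<forall>u\<in>V. \<exists>v\<in>V. (u, v) \<in> E)"


section \<open>The Hilbert space of square-summable functions and its operators\<close>

(* A function on V is represented by a total function that vanishes off V. *)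
definition ell2 :: "'v set \<Rightarrow> ('v \<Rightarrow> complex) set" where
  "ell2 V = {f. (\<forall>v. v \<notin> V \<longrightarrow> f v = 0) \<and> (\<lambda>v. (cmod (f v))\<^sup>2) summable_on V}"

definition ell2_inner :: "'v set \<Rightarrow> ('v \<Rightarrow> complex) \<Rightarrow> ('v \<Rightarrow> complex) \<Rightarrow> complex" where
  "ell2_inner V f g = (\<Sum>\<^sub>\<infinity>v\<in>V. f v * cnj (g v))"

definition ell2_norm :: "'v set \<Rightarrow> ('v \<Rightarrow> complex) \<Rightarrow> real" where
  "ell2_norm V f = sqrt (\<Sum>\<^sub>\<infinity>v\<in>V. (cmod (f v))\<^sup>2)"

definition ell2_level :: "'v set \<Rightarrow> ('v \<times> 'v) set \<Rightarrow> nat \<Rightarrow> ('v \<Rightarrow> complex) set" where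
  "ell2_level V E k = {f \<in> ell2 V. \<forall>v\<in>V. depth V E v \<noteq> k \<longrightarrow> f v = 0}"

(* B(H) for a linear subspace H of ell2 V. Only the values on H are relevant: two members
   agreeing on H stand for the same operator. *)
definition bounded_ops ::
    "'v set \<Rightarrow> ('v \<Rightarrow> complex) set \<Rightarrow> (('v \<Rightarrow> complex) \<Rightarrow> ('v \<Rightarrow> complex)) set" where
  "bounded_ops V H = {A.
     (\<forall>f\<in>H. A f \<in> H) \<and>
     (\<forall>f\<in>H. \<forall>g\<in>H. A (\<lambda>v. f v + g v) = (\<lambda>v. A f v + A g v)) \<and>
     (\<forall>c. \<forall>f\<in>H. A (\<lambda>v. c * f v) = (\<lambda>v. c * A f v)) \<and>
     (\<exists>C. \<forall>f\<in>H. ell2_norm V (A f) \<le> C * ell2_norm V f)}"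

definition adjoint_op ::
    "'v set \<Rightarrow> (('v \<Rightarrow> complex) \<Rightarrow> ('v \<Rightarrow> complex)) \<Rightarrow> ('v \<Rightarrow> complex) \<Rightarrow> ('v \<Rightarrow> complex)" where
  "adjoint_op V A g =
     (THE h. h \<in> ell2 V \<and> (\<forall>f\<in>ell2 V. ell2_inner V (A f) g = ell2_inner V f h))"

definition ker_adjoint ::
    "'v set \<Rightarrow> (('v \<Rightarrow> complex) \<Rightarrow> ('v \<Rightarrow> complex)) \<Rightarrow> ('v \<Rightarrow> complex) set" where
  "ker_adjoint V A = {f \<in> ell2 V. adjoint_op V A f = (\<lambda>_. 0)}"

definition orth_proj ::
    "'v set \<Rightarrow> ('v \<Rightarrow> complex) set \<Rightarrow> ('v \<Rightarrow> complex) \<Rightarrow> ('v \<Rightarrow> complex)" where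
  "orth_proj V H f = (THE p. p \<in> H \<and> (\<forall>h\<in>H. ell2_inner V (\<lambda>v. f v - p v) h = 0))"

definition left_invertible ::
    "'v set \<Rightarrow> (('v \<Rightarrow> complex) \<Rightarrow> ('v \<Rightarrow> complex)) \<Rightarrow> bool" where
  "left_invertible V A \<longleftrightarrow> (\<exists>B\<in>bounded_ops V (ell2 V). \<forall>f\<in>ell2 V. B (A f) = f)"

definition op_spectrum ::
    "'v set \<Rightarrow> (('v \<Rightarrow> complex) \<Rightarrow> ('v \<Rightarrow> complex)) \<Rightarrow> complex set" where
  "op_spectrum V A = {z. \<not> (\<exists>B\<in>bounded_ops V (ell2 V). \<forall>f\<in>ell2 V.
     B (\<lambda>v. A f v - z * f v) = f \<and> (\<lambda>v. A (B f) v - z * B f v) = f)}"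

definition op_spectral_radius ::
    "'v set \<Rightarrow> (('v \<Rightarrow> complex) \<Rightarrow> ('v \<Rightarrow> complex)) \<Rightarrow> real" where
  "op_spectral_radius V A = (SUP z\<in>op_spectrum V A. cmod z)"

definition commutant ::
    "'v set \<Rightarrow> (('v \<Rightarrow> complex) \<Rightarrow> ('v \<Rightarrow> complex)) \<Rightarrow> (('v \<Rightarrow> complex) \<Rightarrow> ('v \<Rightarrow> complex)) set" where
  "commutant V T = {A \<in> bounded_ops V (ell2 V). \<forall>f\<in>ell2 V. A (T f) = T (A f)}"

definition finite_dimensional :: "('v \<Rightarrow> complex) set \<Rightarrow> bool" where
  "finite_dimensional H \<longleftrightarrow>
     (\<exists>B. finite B \<and> B \<subseteq> H \<and> (\<forall>f\<in>H. \<exists>c. f = (\<lambda>v. \<Sum>b\<in>B. c b * b v)))"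

definition orthonormal_basis ::
    "'v set \<Rightarrow> ('v \<Rightarrow> complex) set \<Rightarrow> 'j set \<Rightarrow> ('j \<Rightarrow> 'v \<Rightarrow> complex) \<Rightarrow> bool" where
  "orthonormal_basis V H J e \<longleftrightarrow>
     (\<forall>j\<in>J. e j \<in> H) \<and>
     (\<forall>i\<in>J. \<forall>j\<in>J. ell2_inner V (e i) (e j) = (if i = j then 1 else 0)) \<and>
     (\<forall>f\<in>H. (\<forall>j\<in>J. ell2_inner V f (e j) = 0) \<longrightarrow> f = (\<lambda>_. 0))"


section \<open>Weighted shifts\<close>

(* For a shift that is not everywhere defined this is the formula of the operator; its maximal
   domain consists of the f in ell2 V whose image is in ell2 V, so membership in
   bounded_ops V (ell2 V) says that the operator is everywhere defined and bounded. *)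
definition weighted_shift ::
    "'v set \<Rightarrow> ('v \<times> 'v) set \<Rightarrow> ('v \<Rightarrow> real) \<Rightarrow> ('v \<Rightarrow> complex) \<Rightarrow> ('v \<Rightarrow> complex)" where
  "weighted_shift V E lam f =
     (\<lambda>v. if v \<in> V - {tree_root V E} then complex_of_real (lam v) * f (par E v) else 0)"

definition balanced ::
    "'v set \<Rightarrow> ('v \<times> 'v) set \<Rightarrow> (('v \<Rightarrow> complex) \<Rightarrow> ('v \<Rightarrow> complex)) \<Rightarrow> bool" where
  "balanced V E T \<longleftrightarrow>
     (\<forall>u\<in>V. \<forall>v\<in>V. depth V E u = depth V E v \<longrightarrow>
        ell2_norm V (T (indicator {u})) = ell2_norm V (T (indicator {v})))"

definition separated_basis ::
    "'v set \<Rightarrow> ('v \<times> 'v) set \<Rightarrow> ('v \<Rightarrow> complex) set \<Rightarrow> 'j set \<Rightarrow> ('j \<Rightarrow> 'v \<Rightarrow> complex) \<Rightarrow> bool" where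
  "separated_basis V E H J e \<longleftrightarrow>
     orthonormal_basis V H J e \<and> (\<forall>j\<in>J. \<exists>k. e j \<in> ell2_level V E k)"


section \<open>The analytic model of a left-invertible operator\<close>

(* (T* T)^{-1} T* *)
definition model_L ::
    "'v set \<Rightarrow> (('v \<Rightarrow> complex) \<Rightarrow> ('v \<Rightarrow> complex)) \<Rightarrow> ('v \<Rightarrow> complex) \<Rightarrow> ('v \<Rightarrow> complex)" where
  "model_L V T f = inv_into (ell2 V) (\<lambda>h. adjoint_op V T (T h)) (adjoint_op V T f)"

definition model_disc ::
    "'v set \<Rightarrow> (('v \<Rightarrow> complex) \<Rightarrow> ('v \<Rightarrow> complex)) \<Rightarrow> complex set" where
  "model_disc V T = {z. cmod z < 1 / op_spectral_radius V (model_L V T)}"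

(* The power series is summed in the norm of ell2 V. Functions on the disc are extensional, i.e.
   undefined outside of it, so that they are equal iff they agree on the disc. *)
definition model_U ::
    "'v set \<Rightarrow> (('v \<Rightarrow> complex) \<Rightarrow> ('v \<Rightarrow> complex)) \<Rightarrow> ('v \<Rightarrow> complex) \<Rightarrow> (complex \<Rightarrow> 'v \<Rightarrow> complex)" where
  "model_U V T f = (\<lambda>z\<in>model_disc V T.
     (THE h. h \<in> ker_adjoint V T \<and>
        (\<lambda>N. ell2_norm V (\<lambda>v. h v -
              (\<Sum>n<N. orth_proj V (ker_adjoint V T) ((model_L V T ^^ n) f) v * z ^ n)))
          \<longlonglongrightarrow> 0))"

definition model_space ::
    "'v set \<Rightarrow> (('v \<Rightarrow> complex) \<Rightarrow> ('v \<Rightarrow> complex)) \<Rightarrow> (complex \<Rightarrow> 'v \<Rightarrow> complex) set" where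
  "model_space V T = model_U V T ` ell2 V"

(* The inner product of the model space is transported along U, so U* is the inverse of U. *)
definition model_U_adj ::
    "'v set \<Rightarrow> (('v \<Rightarrow> complex) \<Rightarrow> ('v \<Rightarrow> complex)) \<Rightarrow> (complex \<Rightarrow> 'v \<Rightarrow> complex) \<Rightarrow> ('v \<Rightarrow> complex)" where
  "model_U_adj V T = inv_into (ell2 V) (model_U V T)"

definition taylor_coeff ::
    "'v set \<Rightarrow> (('v \<Rightarrow> complex) \<Rightarrow> ('v \<Rightarrow> complex)) \<Rightarrow> (complex \<Rightarrow> 'v \<Rightarrow> complex) \<Rightarrow> nat \<Rightarrow> ('v \<Rightarrow> complex)" where
  "taylor_coeff V T F n = orth_proj V (ker_adjoint V T) ((model_L V T ^^ n) (model_U_adj V T F))"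

(* Operators in the model space are given by their graphs, so that equality of operators includes
   equality of their domains. *)
type_synonym 'v model_op = "((complex \<Rightarrow> 'v \<Rightarrow> complex) \<times> (complex \<Rightarrow> 'v \<Rightarrow> complex)) set"

definition transport ::
    "'v set \<Rightarrow> (('v \<Rightarrow> complex) \<Rightarrow> ('v \<Rightarrow> complex)) \<Rightarrow> (('v \<Rightarrow> complex) \<Rightarrow> ('v \<Rightarrow> complex)) \<Rightarrow> 'v model_op" where
  "transport V T A = {(F, model_U V T (A (model_U_adj V T F))) | F. F \<in> model_space V T}"

definition mult_op ::
    "'v set \<Rightarrow> (('v \<Rightarrow> complex) \<Rightarrow> ('v \<Rightarrow> complex)) \<Rightarrow>
     (nat \<Rightarrow> ('v \<Rightarrow> complex) \<Rightarrow> ('v \<Rightarrow> complex)) \<Rightarrow> 'v model_op" where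
  "mult_op V T \<phi> = {(F, G). F \<in> model_space V T \<and> G \<in> model_space V T \<and>
     (\<forall>n. taylor_coeff V T G n = (\<lambda>v. \<Sum>k\<le>n. \<phi> k (taylor_coeff V T F (n - k)) v))}"


section \<open>Weighted sequence spaces\<close>

definition seq_conv :: "(nat \<Rightarrow> complex) \<Rightarrow> (nat \<Rightarrow> complex) \<Rightarrow> (nat \<Rightarrow> complex)" where
  "seq_conv a b = (\<lambda>n. \<Sum>k\<le>n. a k * b (n - k))"

definition ell2_weighted :: "(nat \<Rightarrow> real) \<Rightarrow> (nat \<Rightarrow> complex) set" where
  "ell2_weighted \<beta> = {a. summable (\<lambda>n. (cmod (a n))\<^sup>2 * \<beta> n)}"

definition H_infinity :: "(nat \<Rightarrow> real) \<Rightarrow> (nat \<Rightarrow> complex) set" where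
  "H_infinity \<beta> = {a. \<forall>b\<in>ell2_weighted \<beta>. seq_conv a b \<in> ell2_weighted \<beta>}"

end

theory Submission
  imports Defs "HOL-Library.Function_Algebras"
begin

text \<open>
  Since \<open>S\<close> is balanced, \<open>S\<^sup>*S\<close> is a diagonal operator depending only on the level, say
  \<open>S\<^sup>*S e\<^sub>u = \<tau>\<^bsub>|u|\<^esub> e\<^sub>u\<close>. With \<open>P = I - S L\<close> this makes the expansion \<open>f = \<Sum>\<^sub>n S\<^sup>n P L\<^sup>n f\<close> orthogonal, where
  the norm of \<open>S\<^sup>n e\<close>, for \<open>e\<close> in the kernel of \<open>S\<^sup>*\<close>, comes from the weights \<open>\<tau>\<^sub>m \<cdots> \<tau>\<^bsub>m+n-1\<^esub>\<close> on level \<open>m\<close>.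
  The kernel is finite-dimensional, hence lives on finitely many levels, and there these weights
  are comparable to \<open>\<beta>\<^sub>n = \<parallel>S\<^sup>n e\<^bsub>root\<^esub>\<parallel>\<^sup>2\<close>. So the coordinates of the Taylor coefficients identify
  \<open>\<ell>\<^sup>2(V)\<close> with a finite direct sum of copies of \<open>\<ell>\<^sup>2(\<beta>)\<close>. An operator commuting with \<open>S\<close> acts on
  Taylor coefficients by convolution with \<open>n \<mapsto> P L\<^sup>n A\<close>; conversely, a matrix of multipliers of
  \<open>\<ell>\<^sup>2(\<beta>)\<close> acts boundedly by a uniform boundedness argument.

  On the model side only the injectivity of \<open>U\<close> matters. For this it suffices to sum the power series
  near 0, because the spectrum of \<open>L\<close> is bounded and contains a nonzero eigenvalue, so that the disc
  is a neighbourhood of 0.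
\<close>

section \<open>The space of square-summable functions\<close>

text \<open>The orthogonality rests on one commutation rule: a multiplication by a function of the
  level, moved past \<open>S\<close>, is again such a multiplication, with the function shifted by
  one (\<open>diag_S\<close>). These self-adjoint operators therefore preserve the range of
  \<open>S\<close> and its orthogonal complement, the kernel of the adjoint. Splitting
  \<open>f\<close> into \<open>P f\<close> and \<open>S (L f)\<close> leaves no cross term in any
  quadratic form weighted by level, and iterating the split gives an exact finite identity with a
  nonnegative remainder (\<open>energy_identity\<close>).

  Infinite sums are controlled by the grading: \<open>S ^^ k\<close> produces functions vanishing on
  all levels below \<open>k\<close>, so at each vertex only finitely many terms of an expansion
  count. An element with prescribed coefficients is defined vertex by vertex, and its norm is
  estimated on finite sets of vertices.

  The weights on level \<open>m\<close> and those at the root are products of the same numbers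
  \<open>tau i\<close> over windows of length \<open>n\<close> shifted by \<open>m\<close>. They
  differ by at most \<open>m\<close> factors at either end, whatever \<open>n\<close> is, which
  gives a comparison constant uniform in \<open>n\<close> once the levels are bounded.\<close>

lemma L2_set_le_ell2_norm:
  assumes "f \<in> ell2 V" "finite F" "F \<subseteq> V"
  shows "L2_set (\<lambda>v. cmod (f v)) F \<le> ell2_norm V f"
proof -
  have "(\<Sum>v\<in>F. (cmod (f v))\<^sup>2) \<le> (\<Sum>\<^sub>\<infinity>v\<in>V. (cmod (f v))\<^sup>2)"
    using assms by (intro finite_sum_le_infsum) (auto simp: ell2_def)
  then show ?thesis
    unfolding L2_set_def ell2_norm_def by simp
qed

lemma ell2_norm_nonneg [simp]: "0 \<le> ell2_norm V f"
  by (simp add: ell2_norm_def infsum_nonneg)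

text \<open>Norm estimates are checked on finite sets of vertices, where \<open>L2_set\<close>
  supplies the Minkowski and Cauchy-Schwarz inequalities. This is also how functions defined as
  pointwise limits enter the space.\<close>

lemma ell2_if_L2_set_le:
  assumes "\<And>v. v \<notin> V \<Longrightarrow> f v = 0"
    and "\<And>F. finite F \<Longrightarrow> F \<subseteq> V \<Longrightarrow> L2_set (\<lambda>v. cmod (f v)) F \<le> C"
  shows "f \<in> ell2 V" "ell2_norm V f \<le> C"
proof -
  have C: "0 \<le> C" using assms(2)[of "{}"] by simp
  have le: "(\<Sum>v\<in>F. (cmod (f v))\<^sup>2) \<le> C\<^sup>2" if "finite F" "F \<subseteq> V" for F
    using assms(2)[OF that] unfolding L2_set_def
    by (metis real_sqrt_le_iff real_sqrt_unique C abs_of_nonneg real_sqrt_abs)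
  have s: "(\<lambda>v. (cmod (f v))\<^sup>2) summable_on V"
    by (rule nonneg_bdd_above_summable_on) (auto intro!: bdd_aboveI2 le)
  then show "f \<in> ell2 V" using assms(1) by (simp add: ell2_def)
  have "(\<Sum>\<^sub>\<infinity>v\<in>V. (cmod (f v))\<^sup>2) \<le> C\<^sup>2"
    by (rule infsum_le_finite_sums[OF s]) (use le in auto)
  then show "ell2_norm V f \<le> C"
    unfolding ell2_norm_def by (rule real_le_lsqrt[OF C])
qed

lemma ell2_off: "f \<in> ell2 V \<Longrightarrow> v \<notin> V \<Longrightarrow> f v = 0"
  by (simp add: ell2_def)

lemma ell2_point_le: "f \<in> ell2 V \<Longrightarrow> cmod (f v) \<le> ell2_norm V f"
  using L2_set_le_ell2_norm[of f V "{v}"] ell2_off[of f V v] by (cases "v \<in> V") auto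

lemma
  assumes "f \<in> ell2 V" "g \<in> ell2 V"
  shows ell2_add: "(\<lambda>v. f v + g v) \<in> ell2 V"
    and ell2_norm_triangle: "ell2_norm V (\<lambda>v. f v + g v) \<le> ell2_norm V f + ell2_norm V g"
proof -
  have *: "L2_set (\<lambda>v. cmod (f v + g v)) F \<le> ell2_norm V f + ell2_norm V g"
    if "finite F" "F \<subseteq> V" for F
  proof -
    have "L2_set (\<lambda>v. cmod (f v + g v)) F \<le> L2_set (\<lambda>v. cmod (f v) + cmod (g v)) F"
      by (rule L2_set_mono) (auto intro: norm_triangle_ineq)
    also have "\<dots> \<le> L2_set (\<lambda>v. cmod (f v)) F + L2_set (\<lambda>v. cmod (g v)) F"
      by (rule L2_set_triangle_ineq)
    also have "\<dots> \<le> ell2_norm V f + ell2_norm V g"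
      using assms that by (intro add_mono L2_set_le_ell2_norm) auto
    finally show ?thesis .
  qed
  show "(\<lambda>v. f v + g v) \<in> ell2 V" "ell2_norm V (\<lambda>v. f v + g v) \<le> ell2_norm V f + ell2_norm V g"
    using ell2_if_L2_set_le[OF _ *] assms by (auto simp: ell2_off)
qed

lemma
  assumes "f \<in> ell2 V" "\<And>v. v \<in> V \<Longrightarrow> cmod (w v) \<le> C"
  shows ell2_mult_bounded: "(\<lambda>v. w v * f v) \<in> ell2 V"
    and ell2_norm_mult_bounded: "0 \<le> C \<Longrightarrow> ell2_norm V (\<lambda>v. w v * f v) \<le> C * ell2_norm V f"
proof -
  \<comment> \<open>The absolute value covers an empty \<open>V\<close>, for which the hypothesis
    admits a negative \<open>C\<close>.\<close>
  have *: "L2_set (\<lambda>v. cmod (w v * f v)) F \<le> \<bar>C\<bar> * ell2_norm V f"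
    if "finite F" "F \<subseteq> V" for F
  proof -
    have "L2_set (\<lambda>v. cmod (w v * f v)) F \<le> L2_set (\<lambda>v. \<bar>C\<bar> * cmod (f v)) F"
    proof (rule L2_set_mono)
      fix v assume "v \<in> F"
      then have "cmod (w v) \<le> \<bar>C\<bar>" using assms(2)[of v] that by auto
      then show "cmod (w v * f v) \<le> \<bar>C\<bar> * cmod (f v)" by (simp add: norm_mult mult_right_mono)
    qed auto
    also have "\<dots> = \<bar>C\<bar> * L2_set (\<lambda>v. cmod (f v)) F"
      by (simp add: L2_set_right_distrib)
    also have "\<dots> \<le> \<bar>C\<bar> * ell2_norm V f"
      using assms that by (intro mult_left_mono L2_set_le_ell2_norm) auto
    finally show ?thesis .
  qed
  show "(\<lambda>v. w v * f v) \<in> ell2 V"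
    using ell2_if_L2_set_le(1)[OF _ *] assms(1) by (auto simp: ell2_off)
  show "ell2_norm V (\<lambda>v. w v * f v) \<le> C * ell2_norm V f" if "0 \<le> C"
    using ell2_if_L2_set_le(2)[OF _ *] assms(1) that by (auto simp: ell2_off)
qed

lemma ell2_norm_mono:
  assumes "f \<in> ell2 V" "g \<in> ell2 V" "\<And>v. v \<in> V \<Longrightarrow> cmod (f v) \<le> cmod (g v)"
  shows "ell2_norm V f \<le> ell2_norm V g"
proof (rule ell2_if_L2_set_le(2))
  fix F assume F: "finite F" "F \<subseteq> V"
  have "L2_set (\<lambda>v. cmod (f v)) F \<le> L2_set (\<lambda>v. cmod (g v)) F"
    using assms F by (intro L2_set_mono) auto
  also have "\<dots> \<le> ell2_norm V g" by (rule L2_set_le_ell2_norm[OF assms(2) F])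
  finally show "L2_set (\<lambda>v. cmod (f v)) F \<le> ell2_norm V g" .
qed (use assms in \<open>auto simp: ell2_off\<close>)

lemma ell2_scale: "f \<in> ell2 V \<Longrightarrow> (\<lambda>v. c * f v) \<in> ell2 V"
  by (rule ell2_mult_bounded[where C = "cmod c"]) auto

lemma ell2_norm_scale: "ell2_norm V (\<lambda>v. c * f v) = cmod c * ell2_norm V f"
  by (simp add: ell2_norm_def norm_mult power_mult_distrib infsum_cmult_right' real_sqrt_mult)

lemma ell2_diff: "f \<in> ell2 V \<Longrightarrow> g \<in> ell2 V \<Longrightarrow> (\<lambda>v. f v - g v) \<in> ell2 V"
  using ell2_add[of f V "\<lambda>v. (-1) * g v"] ell2_scale[of g V "-1"] by simp

lemma ell2_zero [simp]: "(\<lambda>_. 0) \<in> ell2 V"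
  by (simp add: ell2_def)

lemma ell2_norm_zero [simp]: "ell2_norm V (\<lambda>_. 0) = 0"
  by (simp add: ell2_norm_def)

lemma ell2_sum: "(\<And>i. i \<in> I \<Longrightarrow> f i \<in> ell2 V) \<Longrightarrow> (\<lambda>v. \<Sum>i\<in>I. f i v) \<in> ell2 V"
  by (induction I rule: infinite_finite_induct) (auto intro: ell2_add)

lemma ell2_norm_sum:
  "(\<And>i. i \<in> I \<Longrightarrow> f i \<in> ell2 V) \<Longrightarrow> ell2_norm V (\<lambda>v. \<Sum>i\<in>I. f i v) \<le> (\<Sum>i\<in>I. ell2_norm V (f i))"
proof (induction I rule: infinite_finite_induct)
  case (insert i I)
  have "ell2_norm V (\<lambda>v. f i v + (\<Sum>i\<in>I. f i v)) \<le> ell2_norm V (f i) + ell2_norm V (\<lambda>v. \<Sum>i\<in>I. f i v)"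
    by (rule ell2_norm_triangle) (auto intro: insert ell2_sum)
  then show ?case using insert by force
qed auto

lemma ell2_eq_zero_if_norm: "f \<in> ell2 V \<Longrightarrow> ell2_norm V f = 0 \<Longrightarrow> f = (\<lambda>_. 0)"
  using ell2_point_le[of f V] by (auto intro!: ext)

lemma
  assumes "finite F" "F \<subseteq> V" "\<And>v. v \<notin> F \<Longrightarrow> f v = 0"
  shows ell2_finite_support: "f \<in> ell2 V"
    and ell2_norm_finite_support: "(ell2_norm V f)\<^sup>2 = (\<Sum>v\<in>F. (cmod (f v))\<^sup>2)"
proof -
  have *: "((\<lambda>v. (cmod (f v))\<^sup>2) has_sum (\<Sum>v\<in>F. (cmod (f v))\<^sup>2)) V"
    using assms by (intro has_sum_finite_neutralI) auto
  then show "f \<in> ell2 V" using assms by (auto simp: ell2_def summable_on_def)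
  show "(ell2_norm V f)\<^sup>2 = (\<Sum>v\<in>F. (cmod (f v))\<^sup>2)"
    using infsumI[OF *] by (simp add: ell2_norm_def sum_nonneg)
qed

lemma ell2_indicator: "u \<in> V \<Longrightarrow> indicator {u} \<in> ell2 V"
  by (rule ell2_finite_support[of "{u}"]) auto

lemma ell2_norm_indicator: "u \<in> V \<Longrightarrow> ell2_norm V (indicator {u}) = 1"
  using ell2_norm_finite_support[of "{u}" V "indicator {u}"] by (auto simp: power2_eq_1_iff) (metis ell2_norm_nonneg neg_0_le_iff_le not_one_le_zero)

lemma
  assumes "f \<in> ell2 V" "g \<in> ell2 V"
  shows ell2_inner_abs_summable: "(\<lambda>v. norm (f v * cnj (g v))) summable_on V"
    and ell2_cauchy_schwarz: "cmod (ell2_inner V f g) \<le> ell2_norm V f * ell2_norm V g"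
proof -
  have le: "(\<Sum>v\<in>F. norm (f v * cnj (g v))) \<le> ell2_norm V f * ell2_norm V g"
    if "finite F" "F \<subseteq> V" for F
  proof -
    have "(\<Sum>v\<in>F. norm (f v * cnj (g v))) = (\<Sum>v\<in>F. \<bar>cmod (f v)\<bar> * \<bar>cmod (g v)\<bar>)"
      by (simp add: norm_mult)
    also have "\<dots> \<le> L2_set (\<lambda>v. cmod (f v)) F * L2_set (\<lambda>v. cmod (g v)) F"
      by (rule L2_set_mult_ineq)
    also have "\<dots> \<le> ell2_norm V f * ell2_norm V g"
      using assms that by (intro mult_mono L2_set_le_ell2_norm) auto
    finally show ?thesis .
  qed
  show s: "(\<lambda>v. norm (f v * cnj (g v))) summable_on V"
    by (rule nonneg_bdd_above_summable_on) (auto intro!: bdd_aboveI2 le)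
  have "cmod (ell2_inner V f g) \<le> (\<Sum>\<^sub>\<infinity>v\<in>V. norm (f v * cnj (g v)))"
    unfolding ell2_inner_def by (rule norm_infsum_bound) (rule s)
  also have "\<dots> \<le> ell2_norm V f * ell2_norm V g"
    by (rule infsum_le_finite_sums[OF s]) (use le in auto)
  finally show "cmod (ell2_inner V f g) \<le> ell2_norm V f * ell2_norm V g" .
qed

lemma ell2_inner_summable:
  "f \<in> ell2 V \<Longrightarrow> g \<in> ell2 V \<Longrightarrow> (\<lambda>v. f v * cnj (g v)) summable_on V"
  by (rule abs_summable_summable) (rule ell2_inner_abs_summable)

lemma ell2_inner_add_left:
  assumes "f \<in> ell2 V" "g \<in> ell2 V" "h \<in> ell2 V"
  shows "ell2_inner V (\<lambda>v. f v + g v) h = ell2_inner V f h + ell2_inner V g h"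
  unfolding ell2_inner_def distrib_right
  using assms by (intro infsum_add ell2_inner_summable)

lemma ell2_inner_scale_left: "ell2_inner V (\<lambda>v. c * f v) h = c * ell2_inner V f h"
  unfolding ell2_inner_def by (simp add: mult.assoc infsum_cmult_right')

lemma ell2_inner_commute: "ell2_inner V f g = cnj (ell2_inner V g f)"
  unfolding ell2_inner_def by (simp flip: infsum_cnj add: mult.commute)

lemma ell2_inner_add_right:
  assumes "f \<in> ell2 V" "g \<in> ell2 V" "h \<in> ell2 V"
  shows "ell2_inner V h (\<lambda>v. f v + g v) = ell2_inner V h f + ell2_inner V h g"
  using ell2_inner_add_left[OF assms] by (metis ell2_inner_commute complex_cnj_add)

lemma ell2_inner_diff_left:
  assumes "f \<in> ell2 V" "g \<in> ell2 V" "h \<in> ell2 V"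
  shows "ell2_inner V (\<lambda>v. f v - g v) h = ell2_inner V f h - ell2_inner V g h"
  using ell2_inner_add_left[OF assms(1) ell2_scale[OF assms(2), of "-1"] assms(3)]
    ell2_inner_scale_left[of V "-1" g h] by simp

lemma ell2_inner_zero_left [simp]: "ell2_inner V (\<lambda>_. 0) g = 0"
  by (simp add: ell2_inner_def)

lemma ell2_inner_sum_left:
  assumes "\<And>i. i \<in> I \<Longrightarrow> f i \<in> ell2 V" "h \<in> ell2 V"
  shows "ell2_inner V (\<lambda>v. \<Sum>i\<in>I. f i v) h = (\<Sum>i\<in>I. ell2_inner V (f i) h)"
  using assms
  by (induction I rule: infinite_finite_induct)
    (auto simp: ell2_inner_add_left ell2_sum)

lemma ell2_inner_self:
  assumes "f \<in> ell2 V"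
  shows "ell2_inner V f f = of_real ((ell2_norm V f)\<^sup>2)"
proof -
  have s: "(\<lambda>v. (cmod (f v))\<^sup>2) summable_on V" using assms by (simp add: ell2_def)
  have "ell2_inner V f f = (\<Sum>\<^sub>\<infinity>v\<in>V. of_real ((cmod (f v))\<^sup>2))"
    unfolding ell2_inner_def by (simp only: complex_norm_square)
  also have "\<dots> = of_real (\<Sum>\<^sub>\<infinity>v\<in>V. (cmod (f v))\<^sup>2)"
    by (rule infsumI) (rule has_sum_of_real_iff[THEN iffD2, OF has_sum_infsum[OF s]])
  finally show ?thesis by (simp add: ell2_norm_def infsum_nonneg)
qed

lemma ell2_inner_indicator_right:
  assumes "u \<in> V"
  shows "ell2_inner V f (indicator {u}) = f u"
proof -
  have "((\<lambda>v. f v * cnj (indicator {u} v)) has_sum (\<Sum>v\<in>{u}. f v * cnj (indicator {u} v))) V"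
    using assms by (intro has_sum_finite_neutralI[of "{u}"]) (auto simp: indicator_def)
  from infsumI[OF this] show ?thesis by (simp add: ell2_inner_def)
qed

section \<open>Bounded operators\<close>

lemma bounded_opsD:
  assumes "A \<in> bounded_ops V H"
  shows "f \<in> H \<Longrightarrow> A f \<in> H"
    and "f \<in> H \<Longrightarrow> g \<in> H \<Longrightarrow> A (\<lambda>v. f v + g v) = (\<lambda>v. A f v + A g v)"
    and "f \<in> H \<Longrightarrow> A (\<lambda>v. c * f v) = (\<lambda>v. c * A f v)"
    and "\<exists>C\<ge>0. \<forall>f\<in>H. ell2_norm V (A f) \<le> C * ell2_norm V f"
proof -
  obtain C where C: "\<forall>f\<in>H. ell2_norm V (A f) \<le> C * ell2_norm V f"
    using assms by (auto simp: bounded_ops_def)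
  have "ell2_norm V (A f) \<le> \<bar>C\<bar> * ell2_norm V f" if "f \<in> H" for f
    using C[rule_format, OF that] by (rule order_trans) (simp add: mult_right_mono)
  then show "\<exists>C\<ge>0. \<forall>f\<in>H. ell2_norm V (A f) \<le> C * ell2_norm V f"
    by (intro exI[of _ "\<bar>C\<bar>"]) auto
qed (use assms in \<open>auto simp: bounded_ops_def\<close>)

lemma bounded_ops_diff:
  assumes "A \<in> bounded_ops V (ell2 V)" "f \<in> ell2 V" "g \<in> ell2 V"
  shows "A (\<lambda>v. f v - g v) = (\<lambda>v. A f v - A g v)"
  using bounded_opsD(2)[OF assms(1) assms(2) ell2_scale[OF assms(3), of "-1"]]
    bounded_opsD(3)[OF assms(1) assms(3), of "-1"] by simp

lemma bounded_ops_zero: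
  assumes "A \<in> bounded_ops V (ell2 V)"
  shows "A (\<lambda>_. 0) = (\<lambda>_. 0)"
  using bounded_opsD(3)[OF assms ell2_zero, of 0] by simp

text \<open>\<open>H\<close> is general because the symbols \<open>\<phi> k\<close> are operators on
  the kernel, not on all of \<open>ell2 V\<close>.\<close>

lemma bounded_ops_sum_on:
  assumes A: "A \<in> bounded_ops V H" and H: "(\<lambda>_. 0) \<in> H" "\<And>f g. f \<in> H \<Longrightarrow> g \<in> H \<Longrightarrow> (\<lambda>v. f v + g v) \<in> H"
    and f: "\<And>i. i \<in> I \<Longrightarrow> f i \<in> H"
  shows "A (\<lambda>v. \<Sum>i\<in>I. f i v) = (\<lambda>v. \<Sum>i\<in>I. A (f i) v)"
proof -
  have 0: "A (\<lambda>_. 0) = (\<lambda>_. 0)" using bounded_opsD(3)[OF A H(1), of 0] by simp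
  have "(\<lambda>v. \<Sum>i\<in>I. f i v) \<in> H \<and> A (\<lambda>v. \<Sum>i\<in>I. f i v) = (\<lambda>v. \<Sum>i\<in>I. A (f i) v)"
    using f by (induction I rule: infinite_finite_induct) (auto simp: 0 H bounded_opsD(2)[OF A])
  then show ?thesis ..
qed

lemma bounded_ops_sum:
  assumes "A \<in> bounded_ops V (ell2 V)" "\<And>i. i \<in> I \<Longrightarrow> f i \<in> ell2 V"
  shows "A (\<lambda>v. \<Sum>i\<in>I. f i v) = (\<lambda>v. \<Sum>i\<in>I. A (f i) v)"
  using assms by (intro bounded_ops_sum_on) (auto intro: ell2_add)

lemma bounded_ops_comp:
  assumes "A \<in> bounded_ops V (ell2 V)" "B \<in> bounded_ops V (ell2 V)"
  shows "(\<lambda>f. A (B f)) \<in> bounded_ops V (ell2 V)"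
proof -
  obtain C D where "C \<ge> 0" "\<forall>f\<in>ell2 V. ell2_norm V (A f) \<le> C * ell2_norm V f"
      "D \<ge> 0" "\<forall>f\<in>ell2 V. ell2_norm V (B f) \<le> D * ell2_norm V f"
    using assms[THEN bounded_opsD(4)] by blast
  note CD = this
  have "ell2_norm V (A (B f)) \<le> C * D * ell2_norm V f" if f: "f \<in> ell2 V" for f
  proof -
    have "ell2_norm V (A (B f)) \<le> C * ell2_norm V (B f)"
      using CD bounded_opsD(1)[OF assms(2) f] by blast
    also have "\<dots> \<le> C * (D * ell2_norm V f)" using CD f by (intro mult_left_mono) auto
    finally show ?thesis by (simp add: mult.assoc)
  qed
  then show ?thesis
    unfolding bounded_ops_def
    using bounded_opsD[OF assms(1)] bounded_opsD[OF assms(2)] by auto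
qed

lemma bounded_ops_funpow:
  assumes "A \<in> bounded_ops V (ell2 V)"
  shows "A ^^ n \<in> bounded_ops V (ell2 V)"
proof (induction n)
  case 0
  show ?case by (auto simp: bounded_ops_def intro!: exI[of _ 1])
next
  case (Suc n)
  from bounded_ops_comp[OF assms Suc] show ?case by (simp add: o_def)
qed

lemma bounded_ops_funpow_norm:
  assumes A: "A \<in> bounded_ops V (ell2 V)"
    and C: "C \<ge> 0" "\<And>f. f \<in> ell2 V \<Longrightarrow> ell2_norm V (A f) \<le> C * ell2_norm V f"
    and g: "g \<in> ell2 V"
  shows "ell2_norm V ((A ^^ n) g) \<le> C ^ n * ell2_norm V g"
proof (induction n)
  case (Suc n)
  have "ell2_norm V ((A ^^ Suc n) g) \<le> C * ell2_norm V ((A ^^ n) g)"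
    using C(2)[OF bounded_opsD(1)[OF bounded_ops_funpow[OF A] g]] by simp
  also have "\<dots> \<le> C * (C ^ n * ell2_norm V g)" by (rule mult_left_mono[OF Suc C(1)])
  finally show ?case by (simp add: mult.assoc)
qed simp

text \<open>The series is summed vertex by vertex. On a finite set of vertices, pointwise
  convergence carries the norm bound of the partial sums over to the limit.\<close>

lemma ell2_abs_convergent_series:
  assumes f: "\<And>n. f n \<in> ell2 V" and s: "summable (\<lambda>n. ell2_norm V (f n))"
  defines "h \<equiv> (\<lambda>v. \<Sum>n. f n v)"
  shows "h \<in> ell2 V" "ell2_norm V h \<le> (\<Sum>n. ell2_norm V (f n))"
    "\<And>v. summable (\<lambda>n. f n v)"
proof -
  show sv: "summable (\<lambda>n. f n v)" for v
    by (rule summable_comparison_test'[OF s, of 0]) (simp add: ell2_point_le f)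
  have *: "L2_set (\<lambda>v. cmod (h v)) F \<le> (\<Sum>n. ell2_norm V (f n))"
    if F: "finite F" "F \<subseteq> V" for F
  proof (rule LIMSEQ_le_const2)
    show "(\<lambda>N. L2_set (\<lambda>v. cmod (\<Sum>n<N. f n v)) F) \<longlonglongrightarrow> L2_set (\<lambda>v. cmod (h v)) F"
      unfolding L2_set_def h_def
      by (intro tendsto_intros summable_LIMSEQ sv)
    have "L2_set (\<lambda>v. cmod (\<Sum>n<N. f n v)) F \<le> (\<Sum>n. ell2_norm V (f n))" for N
    proof -
      have "L2_set (\<lambda>v. cmod (\<Sum>n<N. f n v)) F \<le> ell2_norm V (\<lambda>v. \<Sum>n<N. f n v)"
        using F by (intro L2_set_le_ell2_norm ell2_sum f)
      also have "\<dots> \<le> (\<Sum>n<N. ell2_norm V (f n))" by (rule ell2_norm_sum) (rule f)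
      also have "\<dots> \<le> (\<Sum>n. ell2_norm V (f n))" by (rule sum_le_suminf[OF s]) auto
      finally show ?thesis .
    qed
    then show "\<exists>N. \<forall>n\<ge>N. L2_set (\<lambda>v. cmod (\<Sum>n<n. f n v)) F \<le> (\<Sum>n. ell2_norm V (f n))" by blast
  qed
  show "h \<in> ell2 V" "ell2_norm V h \<le> (\<Sum>n. ell2_norm V (f n))"
    using ell2_if_L2_set_le[OF _ *] by (auto simp: h_def ell2_off[OF f])
qed

lemma bounded_ops_suminf:
  assumes A: "A \<in> bounded_ops V (ell2 V)"
    and f: "\<And>n. f n \<in> ell2 V" and s: "summable (\<lambda>n. ell2_norm V (f n))"
  shows "A (\<lambda>v. \<Sum>n. f n v) v = (\<Sum>n. A (f n) v)"
proof -
  obtain C where C: "C \<ge> 0" "\<And>f. f \<in> ell2 V \<Longrightarrow> ell2_norm V (A f) \<le> C * ell2_norm V f"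
    using bounded_opsD(4)[OF A] by blast
  note h = ell2_abs_convergent_series[OF f s]
  \<comment> \<open>The tail after \<open>N\<close> terms. Its norm is at most a tail of a
    convergent real series, so its image under \<open>A\<close> tends to 0.\<close>
  define R where "R N = (\<lambda>v. \<Sum>n. f (n + N) v)" for N
  have sN: "summable (\<lambda>n. ell2_norm V (f (n + N)))" for N
    using s by (rule summable_ignore_initial_segment)
  have R: "R N \<in> ell2 V" "ell2_norm V (R N) \<le> (\<Sum>n. ell2_norm V (f (n + N)))" for N
    using ell2_abs_convergent_series[of "\<lambda>n. f (n + N)", OF f sN] by (simp_all add: R_def)
  have split: "(\<lambda>v. \<Sum>n. f n v) = (\<lambda>v. R N v + (\<Sum>n<N. f n v))" for N
    unfolding R_def using suminf_split_initial_segment[OF h(3), of _ N] by auto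
  have "cmod (A (\<lambda>v. \<Sum>n. f n v) v - (\<Sum>n<N. A (f n) v)) \<le> C * (\<Sum>n. ell2_norm V (f (n + N)))" for N
  proof -
    have "A (\<lambda>v. \<Sum>n. f n v) v - (\<Sum>n<N. A (f n) v) = A (R N) v"
      unfolding split[of N] using bounded_opsD(2)[OF A R(1) ell2_sum, of "{..<N}" f N] f
      by (simp add: bounded_ops_sum[OF A])
    then have "cmod (A (\<lambda>v. \<Sum>n. f n v) v - (\<Sum>n<N. A (f n) v)) \<le> ell2_norm V (A (R N))"
      by (simp add: ell2_point_le bounded_opsD(1)[OF A] R)
    also have "\<dots> \<le> C * ell2_norm V (R N)" by (rule C) (rule R)
    also have "\<dots> \<le> C * (\<Sum>n. ell2_norm V (f (n + N)))"
      by (rule mult_left_mono[OF R(2) C(1)])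
    finally show ?thesis .
  qed
  moreover have "(\<lambda>N. C * (\<Sum>n. ell2_norm V (f (n + N)))) \<longlonglongrightarrow> 0"
    using tendsto_mult_right_zero[OF suminf_exist_split2[OF s], of C] by simp
  ultimately have "(\<lambda>N. A (\<lambda>v. \<Sum>n. f n v) v - (\<Sum>n<N. A (f n) v)) \<longlonglongrightarrow> 0"
    by (rule Lim_null_comparison[OF always_eventually[OF allI]])
  then have "(\<lambda>N. (\<Sum>n<N. A (f n) v)) \<longlonglongrightarrow> A (\<lambda>v. \<Sum>n. f n v) v"
    using LIM_zero_iff[of "\<lambda>N. \<Sum>n<N. A (f n) v"] tendsto_minus by (fastforce simp: algebra_simps)
  then show ?thesis by (simp add: sums_def sums_unique)
qed

text \<open>Beyond any norm bound \<open>C\<close> of \<open>A\<close>, a Neumann series inverts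
  \<open>A - z\<close>. Boundedness is what lets the real supremum \<open>op_spectral_radius\<close>
  dominate each point of the spectrum.\<close>

lemma bounded_above_op_spectrum:
  assumes A: "A \<in> bounded_ops V (ell2 V)"
  shows "bdd_above (cmod ` op_spectrum V A)"
proof -
  obtain C where C: "C \<ge> 0" "\<And>f. f \<in> ell2 V \<Longrightarrow> ell2_norm V (A f) \<le> C * ell2_norm V f"
    using bounded_opsD(4)[OF A] by blast
  have "z \<notin> op_spectrum V A" if z: "cmod z > C" for z
  proof -
    have z0: "z \<noteq> 0" using z C by auto
    have ex: "\<exists>h\<in>ell2 V. (\<lambda>v. A h v - z * h v) = g" if g: "g \<in> ell2 V" for g
    proof -
      \<comment> \<open>The terms of the formal inverse of \<open>A - z\<close> applied to
        \<open>g\<close>. Since \<open>A\<close> turns \<open>f n\<close> into \<open>z\<close>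
        times \<open>f (Suc n)\<close>, all but the first term cancel in
        \<open>A h - z h\<close>.\<close>
      define f where "f n = (\<lambda>v. - (1 / z ^ Suc n) * (A ^^ n) g v)" for n
      have An: "(A ^^ n) g \<in> ell2 V" for n
        using bounded_opsD(1)[OF bounded_ops_funpow[OF A] g] .
      have f: "f n \<in> ell2 V" for n unfolding f_def by (rule ell2_scale[OF An])
      have nA: "ell2_norm V ((A ^^ n) g) \<le> C ^ n * ell2_norm V g" for n
        by (rule bounded_ops_funpow_norm[OF A C g])
      have s: "summable (\<lambda>n. ell2_norm V (f n))"
      proof (rule summable_comparison_test')
        show "summable (\<lambda>n. ell2_norm V g / cmod z * (C / cmod z) ^ n)"
          using z C(1) by (intro summable_mult summable_geometric) (simp add: divide_less_eq)
        show "norm (ell2_norm V (f n)) \<le> ell2_norm V g / cmod z * (C / cmod z) ^ n" for n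
        proof -
          have "ell2_norm V (f n) = 1 / cmod z ^ Suc n * ell2_norm V ((A ^^ n) g)"
            unfolding f_def ell2_norm_scale by (simp add: norm_divide norm_mult norm_power)
          also have "\<dots> \<le> 1 / cmod z ^ Suc n * (C ^ n * ell2_norm V g)"
            by (rule mult_left_mono[OF nA]) simp
          finally show ?thesis by (simp add: power_divide mult.commute)
        qed
      qed
      note h = ell2_abs_convergent_series[OF f s]
      define h where "h = (\<lambda>v. \<Sum>n. f n v)"
      have "A h v - z * h v = g v" for v
      proof -
        have "A (f n) = (\<lambda>v. z * f (Suc n) v)" for n
          unfolding f_def bounded_opsD(3)[OF A An] using z0 by auto
        then have "A h v = (\<Sum>n. z * f (Suc n) v)"
          unfolding h_def using bounded_ops_suminf[OF A f s] by simp
        also have "\<dots> = z * (\<Sum>n. f (Suc n) v)"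
          by (rule suminf_mult) (use h(3)[of v] summable_Suc_iff[of "\<lambda>n. f n v"] in simp)
        also have "(\<Sum>n. f (Suc n) v) = h v - f 0 v"
          unfolding h_def by (rule suminf_split_head[OF h(3)])
        finally show ?thesis using z0 by (simp add: f_def algebra_simps)
      qed
      then show ?thesis using h(1) unfolding h_def by blast
    qed
    \<comment> \<open>This lower bound serves twice: it makes \<open>A - z\<close> injective, and it
      bounds the norm of the inverse.\<close>
    have bd: "(cmod z - C) * ell2_norm V h \<le> ell2_norm V (\<lambda>v. A h v - z * h v)" if h: "h \<in> ell2 V" for h
    proof -
      have "(\<lambda>v. z * h v) = (\<lambda>v. A h v + (-1) * (A h v - z * h v))" by auto
      then have "cmod z * ell2_norm V h = ell2_norm V (\<lambda>v. A h v + (-1) * (A h v - z * h v))"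
        by (metis ell2_norm_scale)
      also have "\<dots> \<le> ell2_norm V (A h) + ell2_norm V (\<lambda>v. (-1) * (A h v - z * h v))"
        by (intro ell2_norm_triangle ell2_diff ell2_scale bounded_opsD(1)[OF A] h)
      also have "ell2_norm V (\<lambda>v. (-1) * (A h v - z * h v)) = ell2_norm V (\<lambda>v. A h v - z * h v)"
        unfolding ell2_norm_scale by simp
      finally show ?thesis using C(2)[OF h] by (simp add: algebra_simps)
    qed
    define D where "D h = (\<lambda>v. A h v - z * h v)" for h
    have Dadd: "D (\<lambda>v. f v + g v) = (\<lambda>v. D f v + D g v)" if "f \<in> ell2 V" "g \<in> ell2 V" for f g
      unfolding D_def using bounded_opsD(2)[OF A that] by (auto simp: algebra_simps)
    have Dscale: "D (\<lambda>v. c * f v) = (\<lambda>v. c * D f v)" if "f \<in> ell2 V" for c f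
      unfolding D_def using bounded_opsD(3)[OF A that] by (auto simp: algebra_simps)
    have Dinj: "f = g" if fg: "f \<in> ell2 V" "g \<in> ell2 V" "D f = D g" for f g
    proof -
      define k where "k = (\<lambda>v. f v + (-1) * g v)"
      have k: "k \<in> ell2 V" unfolding k_def using fg by (intro ell2_add ell2_scale)
      have "D k = (\<lambda>v. D f v + (-1) * D g v)"
        unfolding k_def Dadd[OF fg(1) ell2_scale[OF fg(2)]] Dscale[OF fg(2)] ..
      then have "D k = (\<lambda>_. 0)" using fg(3) by simp
      then have "(cmod z - C) * ell2_norm V k \<le> 0" using bd[OF k] by (simp add: D_def)
      then have "ell2_norm V k = 0" using z ell2_norm_nonneg[of V k]
        by (simp add: mult_le_0_iff)
      then have "k = (\<lambda>_. 0)" by (rule ell2_eq_zero_if_norm[OF k])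
      then show ?thesis by (auto simp: k_def fun_eq_iff)
    qed
    \<comment> \<open>The choice is harmless: by \<open>Dinj\<close> the solution is unique, and
      uniqueness also makes \<open>B\<close> linear.\<close>
    define B where "B g = (SOME h. h \<in> ell2 V \<and> D h = g)" for g
    have B: "B g \<in> ell2 V" "D (B g) = g" if "g \<in> ell2 V" for g
      using someI_ex[of "\<lambda>h. h \<in> ell2 V \<and> D h = g"] ex[OF that] unfolding B_def D_def by blast+
    have "B \<in> bounded_ops V (ell2 V)"
      unfolding bounded_ops_def
    proof (intro CollectI conjI ballI allI exI)
      fix f g assume fg: "f \<in> ell2 V" "g \<in> ell2 V"
      show "B (\<lambda>v. f v + g v) = (\<lambda>v. B f v + B g v)"
        by (rule Dinj) (use fg in \<open>simp_all add: B ell2_add Dadd\<close>)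
    next
      fix c f assume f: "f \<in> ell2 V"
      show "B (\<lambda>v. c * f v) = (\<lambda>v. c * B f v)"
        by (rule Dinj) (use f in \<open>simp_all add: B ell2_scale Dscale\<close>)
    next
      fix f assume f: "f \<in> ell2 V"
      show "ell2_norm V (B f) \<le> (1 / (cmod z - C)) * ell2_norm V f"
        using bd[OF B(1)[OF f]] B(2)[OF f] z by (simp add: D_def field_simps)
    qed (rule B(1))
    moreover have "B (D f) = f" "D (B f) = f" if "f \<in> ell2 V" for f
    proof -
      have "D f \<in> ell2 V" unfolding D_def using that by (intro ell2_diff ell2_scale bounded_opsD(1)[OF A])
      then show "B (D f) = f" using Dinj[OF B(1) that B(2)] by simp
      show "D (B f) = f" by (rule B(2)[OF that])
    qed
    ultimately show ?thesis unfolding op_spectrum_def D_def by auto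
  qed
  then show ?thesis by (intro bdd_aboveI2[of _ _ C]) (meson not_le)
qed

section \<open>Adjoints\<close>

lemma adjoint_op_eqI:
  assumes "h \<in> ell2 V" "\<And>f. f \<in> ell2 V \<Longrightarrow> ell2_inner V (A f) g = ell2_inner V f h"
  shows "adjoint_op V A g = h"
  unfolding adjoint_op_def
proof (rule the_equality)
  fix k assume k: "k \<in> ell2 V \<and> (\<forall>f\<in>ell2 V. ell2_inner V (A f) g = ell2_inner V f k)"
  have "k u = h u" for u
  proof (cases "u \<in> V")
    case True
    then have "ell2_inner V (indicator {u}) k = ell2_inner V (indicator {u}) h"
      using k assms(2) ell2_indicator by metis
    then have "ell2_inner V k (indicator {u}) = ell2_inner V h (indicator {u})"
      by (metis ell2_inner_commute)
    then show ?thesis using True by (simp add: ell2_inner_indicator_right)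
  next
    case False
    then show ?thesis using ell2_off[of k V u] ell2_off[OF assms(1), of u] k by simp
  qed
  then show "k = h" by auto
qed (use assms in auto)

text \<open>The value at \<open>u\<close> is forced by pairing with the indicator of
  \<open>u\<close>. This turns the definite description \<open>adjoint_op\<close> into a formula
  that can be evaluated for a weighted shift.\<close>

definition adj :: "'v set \<Rightarrow> (('v \<Rightarrow> complex) \<Rightarrow> ('v \<Rightarrow> complex)) \<Rightarrow> ('v \<Rightarrow> complex) \<Rightarrow> ('v \<Rightarrow> complex)" where
  "adj V A g = (\<lambda>u. if u \<in> V then ell2_inner V g (A (indicator {u})) else 0)"

text \<open>Density of the finitely supported functions, in the form that \<open>adj_inner\<close>
  uses to extend an identity from them to the whole space.\<close>

lemma ell2_tail:
  assumes f: "f \<in> ell2 V" and e: "e > 0"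
  obtains F where "finite F" "F \<subseteq> V" "ell2_norm V (\<lambda>v. if v \<in> F then 0 else f v) < e"
proof -
  define g where "g v = (cmod (f v))\<^sup>2" for v
  have s: "g summable_on V" using f by (simp add: ell2_def g_def[abs_def])
  have "((\<lambda>F. sum g F) \<longlongrightarrow> infsum g V) (finite_subsets_at_top V)"
    using s by (rule infsum_tendsto)
  then have "\<forall>\<^sub>F F in finite_subsets_at_top V. dist (sum g F) (infsum g V) < e\<^sup>2"
    using e by (intro tendstoD) auto
  then obtain F where F: "finite F" "F \<subseteq> V" "dist (sum g F) (infsum g V) < e\<^sup>2"
    unfolding eventually_finite_subsets_at_top by blast
  have "(\<Sum>\<^sub>\<infinity>v\<in>V. (cmod (if v \<in> F then 0 else f v))\<^sup>2) = infsum g (V - F)"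
    by (rule infsum_cong_neutral) (auto simp: g_def)
  also have "\<dots> = infsum g V - sum g F"
    using F s by (subst infsum_Diff) auto
  also have "\<dots> < e\<^sup>2" using F(3) by (simp add: dist_real_def)
  finally have "ell2_norm V (\<lambda>v. if v \<in> F then 0 else f v) < e"
    unfolding ell2_norm_def using e by (intro real_less_lsqrt) auto
  then show ?thesis using F that by blast
qed

lemma
  assumes A: "A \<in> bounded_ops V (ell2 V)" and g: "g \<in> ell2 V"
  shows adj_in_ell2: "adj V A g \<in> ell2 V"
    and adj_bound: "(\<And>f. f \<in> ell2 V \<Longrightarrow> ell2_norm V (A f) \<le> C * ell2_norm V f) \<Longrightarrow>
      ell2_norm V (adj V A g) \<le> C * ell2_norm V g"
    and adj_inner: "f \<in> ell2 V \<Longrightarrow> ell2_inner V (A f) g = ell2_inner V f (adj V A g)"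
proof -
  define h where "h = adj V A g"
  have fin: "ell2_inner V (A f) g = (\<Sum>u\<in>F. f u * cnj (h u))"
    if F: "finite F" "F \<subseteq> V" "\<And>v. v \<notin> F \<Longrightarrow> f v = 0" for f F
  proof -
    have feq: "f = (\<lambda>v. \<Sum>u\<in>F. f u * indicator {u} v)"
      proof
      fix x
      have "(\<Sum>u\<in>F. f u * indicator {u} x) = (\<Sum>u\<in>F. if u = x then f x else 0)"
        by (intro sum.cong) (auto simp: indicator_def)
      then show "f x = (\<Sum>u\<in>F. f u * indicator {u} x)"
        using F by (simp add: sum.delta)
    qed
    have iu: "(\<lambda>v. f u * indicator {u} v) \<in> ell2 V" if "u \<in> F" for u
      using that F by (intro ell2_scale ell2_indicator) auto
    have Au: "A (\<lambda>v. f u * indicator {u} v) = (\<lambda>v. f u * A (indicator {u}) v)" if "u \<in> F" for u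
      using that F by (intro bounded_opsD(3)[OF A] ell2_indicator) auto
    have "A f = (\<lambda>v. \<Sum>u\<in>F. A (\<lambda>v. f u * indicator {u} v) v)"
      by (subst feq) (rule bounded_ops_sum[OF A iu])
    also have "\<dots> = (\<lambda>v. \<Sum>u\<in>F. f u * A (indicator {u}) v)" using Au by simp
    finally have "ell2_inner V (A f) g = (\<Sum>u\<in>F. ell2_inner V (\<lambda>v. f u * A (indicator {u}) v) g)"
      using F g by (simp add: ell2_inner_sum_left ell2_scale bounded_opsD(1)[OF A] ell2_indicator subset_iff)
    also have "\<dots> = (\<Sum>u\<in>F. f u * cnj (h u))"
      using F by (intro sum.cong) (auto simp: ell2_inner_scale_left h_def adj_def intro: ell2_inner_commute)
    finally show ?thesis .
  qed
  have hbound: "L2_set (\<lambda>v. cmod (h v)) F \<le> C * ell2_norm V g"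
    if F: "finite F" "F \<subseteq> V" and C: "\<And>f. f \<in> ell2 V \<Longrightarrow> ell2_norm V (A f) \<le> C * ell2_norm V f" for C F
  proof -
    \<comment> \<open>Testing with the restriction of \<open>h\<close> itself turns the finite
      identity into \<open>s\<^sup>2\<close> on the one side and at most \<open>C * s\<close> times
      the norm of \<open>g\<close> on the other; dividing by \<open>s\<close> gives the
      bound.\<close>
    define f where "f = (\<lambda>v. if v \<in> F then h v else 0)"
    define s where "s = L2_set (\<lambda>v. cmod (h v)) F"
    have f: "f \<in> ell2 V" using F by (intro ell2_finite_support[of F]) (auto simp: f_def)
    have nf: "(ell2_norm V f)\<^sup>2 = s\<^sup>2"
      using F by (subst ell2_norm_finite_support[of F]) (auto simp: f_def s_def L2_set_def sum_nonneg)
    then have nf': "ell2_norm V f = s" by (simp add: s_def L2_set_nonneg)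
    have "ell2_inner V (A f) g = (\<Sum>u\<in>F. f u * cnj (h u))" by (rule fin[OF F]) (simp add: f_def)
    also have "\<dots> = of_real (s\<^sup>2)"
      by (simp add: f_def s_def L2_set_def sum_nonneg flip: complex_norm_square)
    finally have "s\<^sup>2 = cmod (ell2_inner V (A f) g)" by (simp add: norm_power)
    also have "\<dots> \<le> ell2_norm V (A f) * ell2_norm V g"
      by (rule ell2_cauchy_schwarz[OF bounded_opsD(1)[OF A f] g])
    also have "\<dots> \<le> C * s * ell2_norm V g"
      using C[OF f] nf' by (simp add: mult_right_mono)
    finally have *: "s * s \<le> s * (C * ell2_norm V g)" by (simp add: power2_eq_square mult_ac)
    show ?thesis
    proof (cases "s = 0")
      case True
      have "0 \<le> C * ell2_norm V g"
        using C[OF g] ell2_norm_nonneg[of V "A g"] by linarith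
      then show ?thesis using True by (simp add: s_def)
    next
      case False
      then have "s > 0" using L2_set_nonneg[of "\<lambda>v. cmod (h v)" F] unfolding s_def by linarith
      then show ?thesis using * by (simp add: s_def)
    qed
  qed
  obtain C where C: "C \<ge> 0" "\<And>f. f \<in> ell2 V \<Longrightarrow> ell2_norm V (A f) \<le> C * ell2_norm V f"
    using bounded_opsD(4)[OF A] by blast
  have off: "v \<notin> V \<Longrightarrow> h v = 0" for v by (simp add: h_def adj_def)
  show "adj V A g \<in> ell2 V"
    using ell2_if_L2_set_le(1)[OF off hbound[OF _ _ C(2)]] by (simp add: h_def)
  then have h: "h \<in> ell2 V" by (simp add: h_def)
  show "ell2_norm V (adj V A g) \<le> C * ell2_norm V g"
    if "\<And>f. f \<in> ell2 V \<Longrightarrow> ell2_norm V (A f) \<le> C * ell2_norm V f" for C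
    using ell2_if_L2_set_le(2)[OF off hbound[OF _ _ that]] by (simp add: h_def)
  assume f: "f \<in> ell2 V"
  have "cmod (ell2_inner V (A f) g - ell2_inner V f h) \<le> e" if e: "e > 0" for e
  proof -
    \<comment> \<open>The error is at most \<open>K\<close> times the norm of the tail
      \<open>f2\<close>; the summand 1 only keeps \<open>K\<close> positive.\<close>
    define K where "K = C * ell2_norm V g + ell2_norm V h + 1"
    have K: "K > 0" unfolding K_def using C by (simp add: add_nonneg_pos)
    obtain F where F: "finite F" "F \<subseteq> V" "ell2_norm V (\<lambda>v. if v \<in> F then 0 else f v) < e / K"
      using ell2_tail[OF f, of "e / K"] e K by auto
    define f1 f2 where "f1 = (\<lambda>v. if v \<in> F then f v else 0)" and "f2 = (\<lambda>v. if v \<in> F then 0 else f v)"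
    have f1: "f1 \<in> ell2 V" using F by (intro ell2_finite_support[of F]) (auto simp: f1_def)
    have f2eq: "f2 = (\<lambda>v. f v - f1 v)" by (auto simp: f1_def f2_def)
    have f2: "f2 \<in> ell2 V" unfolding f2eq by (rule ell2_diff[OF f f1])
    have fsum: "f = (\<lambda>v. f1 v + f2 v)" by (auto simp: f1_def f2_def)
    have "ell2_inner V f1 h = (\<Sum>u\<in>F. f1 u * cnj (h u))"
    proof -
      have "((\<lambda>u. f1 u * cnj (h u)) has_sum (\<Sum>u\<in>F. f1 u * cnj (h u))) V"
        using F by (intro has_sum_finite_neutralI) (auto simp: f1_def)
      then show ?thesis by (simp add: ell2_inner_def infsumI)
    qed
    also have "\<dots> = ell2_inner V (A f1) g" using fin[OF F(1,2), of f1] by (simp add: f1_def)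
    finally have eq1: "ell2_inner V f1 h = ell2_inner V (A f1) g" .
    have "ell2_inner V (A f) g - ell2_inner V f h = ell2_inner V (A f2) g - ell2_inner V f2 h"
      unfolding fsum bounded_opsD(2)[OF A f1 f2]
      using f1 f2 g h by (simp add: ell2_inner_add_left bounded_opsD(1)[OF A] eq1)
    also have "cmod \<dots> \<le> cmod (ell2_inner V (A f2) g) + cmod (ell2_inner V f2 h)"
      by (rule norm_triangle_ineq4)
    also have "\<dots> \<le> ell2_norm V (A f2) * ell2_norm V g + ell2_norm V f2 * ell2_norm V h"
      by (intro add_mono ell2_cauchy_schwarz f2 g h bounded_opsD(1)[OF A])
    also have "\<dots> \<le> C * ell2_norm V f2 * ell2_norm V g + ell2_norm V f2 * ell2_norm V h"
      by (intro add_mono mult_right_mono C f2) auto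
    also have "\<dots> \<le> ell2_norm V f2 * K"
      by (simp add: K_def algebra_simps)
    also have "\<dots> \<le> e" using F(3) K by (simp add: f2_def field_simps)
    finally show ?thesis .
  qed
  then have "cmod (ell2_inner V (A f) g - ell2_inner V f h) \<le> 0"
    using field_le_epsilon[of "cmod (ell2_inner V (A f) g - ell2_inner V f h)" 0] by simp
  then show "ell2_inner V (A f) g = ell2_inner V f (adj V A g)" by (simp add: h_def)
qed

lemma adjoint_op_eq_adj:
  assumes "A \<in> bounded_ops V (ell2 V)" "g \<in> ell2 V"
  shows "adjoint_op V A g = adj V A g"
  by (rule adjoint_op_eqI) (use assms in \<open>auto intro: adj_in_ell2 adj_inner\<close>)

section \<open>Finite orthonormal bases\<close>

lemma sum_fun_eq: "(\<Sum>i\<in>I. f i) = (\<lambda>v. \<Sum>i\<in>I. (f i v :: 'b :: comm_monoid_add))"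
  by (induction I rule: infinite_finite_induct) (auto simp: fun_eq_iff)

text \<open>Orthonormal vectors are linearly independent, and here they lie in the span of a finite
  set. The comparison takes place in the complex vector space of all functions on the vertex
  type.\<close>

lemma finite_orthonormal_basis:
  fixes H :: "('v \<Rightarrow> complex) set"
  assumes H: "H \<subseteq> ell2 V" and fd: "finite_dimensional H" and b: "orthonormal_basis V H J e"
  shows "finite J"
proof -
  interpret fun_space: vector_space "\<lambda>(c::complex) (f::'v \<Rightarrow> complex) v. c * f v"
    by unfold_locales (auto simp: fun_eq_iff algebra_simps)
  obtain B where B: "finite B" "B \<subseteq> H" "\<forall>f\<in>H. \<exists>c. f = (\<lambda>v. \<Sum>b\<in>B. c b * b v)"
    using fd by (auto simp: finite_dimensional_def)
  have e: "e j \<in> ell2 V" "e j \<in> H" if "j \<in> J" for j using b H that by (auto simp: orthonormal_basis_def)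
  have on: "ell2_inner V (e i) (e j) = (if i = j then 1 else 0)" if "i \<in> J" "j \<in> J" for i j
    using b that by (auto simp: orthonormal_basis_def)
  have inj: "inj_on e J"
    by (rule inj_onI) (metis on zero_neq_one)
  have "e ` J \<subseteq> fun_space.span B"
  proof
    fix f assume "f \<in> e ` J"
    then have "f \<in> H" using e by auto
    then obtain c where f: "f = (\<lambda>v. \<Sum>b\<in>B. c b * b v)" using B by blast
    have "(\<Sum>b\<in>B. (\<lambda>v. c b * b v)) \<in> fun_space.span B"
      by (intro fun_space.span_sum fun_space.span_scale fun_space.span_base)
    then show "f \<in> fun_space.span B" by (simp add: f sum_fun_eq)
  qed
  moreover have "fun_space.independent (e ` J)"
    unfolding fun_space.independent_explicit_module
  proof (intro allI impI)
    fix t and u :: "('v \<Rightarrow> complex) \<Rightarrow> complex" and x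
    assume t: "finite t" "t \<subseteq> e ` J" and 0: "(\<Sum>v\<in>t. (\<lambda>w. u v * v w)) = 0" and x: "x \<in> t"
    have t2: "f \<in> ell2 V" if "f \<in> t" for f using t that e by auto
    have tx: "ell2_inner V f x = (if f = x then 1 else 0)" if f: "f \<in> t" for f
    proof -
      obtain i j where "f = e i" "x = e j" "i \<in> J" "j \<in> J" using t x f by blast
      then show ?thesis using on[of i j] inj by (auto simp: inj_on_eq_iff)
    qed
    have "(\<lambda>w. \<Sum>v\<in>t. u v * v w) = (\<lambda>_. 0)" using 0 by (simp add: sum_fun_eq zero_fun_def)
    then have "0 = ell2_inner V (\<lambda>w. \<Sum>v\<in>t. u v * v w) x" by simp
    also have "\<dots> = (\<Sum>v\<in>t. u v * ell2_inner V v x)"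
      using t2 x by (simp add: ell2_inner_sum_left ell2_scale ell2_inner_scale_left)
    also have "\<dots> = (\<Sum>v\<in>t. if v = x then u x else 0)"
      by (intro sum.cong) (auto simp: tx)
    also have "\<dots> = u x" using t x by simp
    finally show "u x = 0" by simp
  qed
  ultimately have "finite (e ` J)"
    using fun_space.independent_span_bound[OF B(1)] by blast
  then show ?thesis using inj by (simp add: finite_image_iff)
qed

lemma orthonormal_inner_sum:
  assumes J: "finite J" and e: "\<And>j. j \<in> J \<Longrightarrow> e j \<in> ell2 V"
    and on: "\<And>i j. i \<in> J \<Longrightarrow> j \<in> J \<Longrightarrow> ell2_inner V (e i) (e j) = (if i = j then 1 else 0)"
    and i: "i \<in> J"
  shows "ell2_inner V (\<lambda>v. \<Sum>j\<in>J. c j * e j v) (e i) = c i"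
proof -
  have "ell2_inner V (\<lambda>v. \<Sum>j\<in>J. c j * e j v) (e i) = (\<Sum>j\<in>J. c j * ell2_inner V (e j) (e i))"
    using e i by (simp add: ell2_inner_sum_left ell2_scale ell2_inner_scale_left)
  also have "\<dots> = (\<Sum>j\<in>J. if j = i then c i else 0)"
    by (intro sum.cong) (auto simp: on i)
  also have "\<dots> = c i" using J i by simp
  finally show ?thesis .
qed

text \<open>An \<open>orthonormal_basis\<close> is given by maximality: nothing nonzero in
  \<open>H\<close> is orthogonal to all of it. Subtracting the finite sum from \<open>f\<close>
  leaves exactly such an orthogonal vector, provided that it stays in \<open>H\<close>, whence the
  closure assumptions.\<close>

lemma orthonormal_expansion:
  assumes H: "H \<subseteq> ell2 V" and J: "finite J" and b: "orthonormal_basis V H J e"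
    and sub: "\<And>c. (\<lambda>v. \<Sum>j\<in>J. c j * e j v) \<in> H" "\<And>f g. f \<in> H \<Longrightarrow> g \<in> H \<Longrightarrow> (\<lambda>v. f v - g v) \<in> H"
    and f: "f \<in> H"
  shows "f = (\<lambda>v. \<Sum>j\<in>J. ell2_inner V f (e j) * e j v)"
proof -
  have e: "e j \<in> ell2 V" if "j \<in> J" for j using b H that by (auto simp: orthonormal_basis_def)
  have on: "ell2_inner V (e i) (e j) = (if i = j then 1 else 0)" if "i \<in> J" "j \<in> J" for i j
    using b that by (auto simp: orthonormal_basis_def)
  define g where "g = (\<lambda>v. \<Sum>j\<in>J. ell2_inner V f (e j) * e j v)"
  have g: "g \<in> H" unfolding g_def by (rule sub)
  have "ell2_inner V (\<lambda>v. f v - g v) (e j) = 0" if "j \<in> J" for j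
    using ell2_inner_diff_left[of f V g "e j"] orthonormal_inner_sum[OF J e on that, of "\<lambda>j. ell2_inner V f (e j)"]
      f g H e[OF that] by (auto simp: g_def)
  then have "(\<lambda>v. f v - g v) = (\<lambda>_. 0)"
    using b sub(2)[OF f g] by (simp add: orthonormal_basis_def)
  then show ?thesis by (auto simp: g_def fun_eq_iff)
qed

lemma orthonormal_norm_sum:
  assumes J: "finite J" and e: "\<And>j. j \<in> J \<Longrightarrow> e j \<in> ell2 V"
    and on: "\<And>i j. i \<in> J \<Longrightarrow> j \<in> J \<Longrightarrow> ell2_inner V (e i) (e j) = (if i = j then 1 else 0)"
  shows "(ell2_norm V (\<lambda>v. \<Sum>j\<in>J. c j * e j v))\<^sup>2 = (\<Sum>j\<in>J. (cmod (c j))\<^sup>2)"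
proof -
  define f where "f = (\<lambda>v. \<Sum>j\<in>J. c j * e j v)"
  have f: "f \<in> ell2 V" unfolding f_def using e by (intro ell2_sum ell2_scale)
  have fe: "ell2_inner V f (e i) = c i" if "i \<in> J" for i
    unfolding f_def by (rule orthonormal_inner_sum[OF J e on that])
  have "of_real ((ell2_norm V f)\<^sup>2) = ell2_inner V f f" by (simp add: ell2_inner_self f)
  also have "\<dots> = (\<Sum>j\<in>J. c j * ell2_inner V (e j) f)"
    by (subst (1) f_def) (use e f in \<open>simp add: ell2_inner_sum_left ell2_scale ell2_inner_scale_left\<close>)
  also have "\<dots> = (\<Sum>j\<in>J. c j * cnj (c j))"
    by (intro sum.cong) (auto simp: ell2_inner_commute[of V "e _" f] fe)
  also have "\<dots> = of_real (\<Sum>j\<in>J. (cmod (c j))\<^sup>2)"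
    by (simp only: of_real_sum complex_norm_square)
  finally show ?thesis by (simp only: of_real_eq_iff f_def)
qed

section \<open>Multipliers of weighted sequence spaces\<close>

lemma seq_conv_add: "seq_conv a (\<lambda>n. b n + c n) n = seq_conv a b n + seq_conv a c n"
  by (simp add: seq_conv_def algebra_simps sum.distrib)

lemma seq_conv_scale: "seq_conv a (\<lambda>n. x * b n) n = x * seq_conv a b n"
  by (simp add: seq_conv_def sum_distrib_left mult_ac)

lemma seq_conv_cong: "(\<And>k. k \<le> n \<Longrightarrow> b k = c k) \<Longrightarrow> seq_conv a b n = seq_conv a c n"
  by (simp add: seq_conv_def)

text \<open>The weighted norm of the first \<open>N\<close> entries only. It is finite for every
  sequence, and it suits convolution, whose first \<open>N\<close> entries depend on no later ones.
  Belonging to \<open>ell2_weighted \<beta>\<close> means boundedness in \<open>N\<close>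
  (\<open>ell2_weighted_iff\<close>).\<close>

definition wnorm :: "(nat \<Rightarrow> real) \<Rightarrow> (nat \<Rightarrow> complex) \<Rightarrow> nat \<Rightarrow> real" where
  "wnorm \<beta> b N = L2_set (\<lambda>n. cmod (b n) * sqrt (\<beta> n)) {..<N}"

lemma wnorm_nonneg: "0 \<le> wnorm \<beta> b N"
  by (simp add: wnorm_def L2_set_nonneg)

lemma wnorm_sq: "(\<And>n. 0 \<le> \<beta> n) \<Longrightarrow> (wnorm \<beta> b N)\<^sup>2 = (\<Sum>n<N. (cmod (b n))\<^sup>2 * \<beta> n)"
  by (simp add: wnorm_def L2_set_def sum_nonneg power_mult_distrib)

lemma wnorm_triangle:
  assumes "\<And>n. 0 \<le> \<beta> n"
  shows "wnorm \<beta> (\<lambda>n. b n + c n) N \<le> wnorm \<beta> b N + wnorm \<beta> c N"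
proof -
  have "wnorm \<beta> (\<lambda>n. b n + c n) N \<le> L2_set (\<lambda>n. cmod (b n) * sqrt (\<beta> n) + cmod (c n) * sqrt (\<beta> n)) {..<N}"
    unfolding wnorm_def
  proof (rule L2_set_mono)
    show "cmod (b i + c i) * sqrt (\<beta> i) \<le> cmod (b i) * sqrt (\<beta> i) + cmod (c i) * sqrt (\<beta> i)" for i
      using mult_right_mono[OF norm_triangle_ineq[of "b i" "c i"], of "sqrt (\<beta> i)"] assms[of i]
      by (simp add: distrib_right)
  qed (auto simp: assms)
  then show ?thesis unfolding wnorm_def by (rule order_trans[OF _ L2_set_triangle_ineq])
qed

lemma wnorm_scale:
  "wnorm \<beta> (\<lambda>n. x * b n) N = cmod x * wnorm \<beta> b N"
  unfolding wnorm_def by (simp add: L2_set_right_distrib norm_mult mult.assoc)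

lemma wnorm_cong: "(\<And>n. n < N \<Longrightarrow> b n = c n) \<Longrightarrow> wnorm \<beta> b N = wnorm \<beta> c N"
  unfolding wnorm_def by (rule L2_set_cong) auto

lemma wnorm_mono: "N \<le> M \<Longrightarrow> wnorm \<beta> b N \<le> wnorm \<beta> b M"
  unfolding wnorm_def L2_set_def by (intro real_sqrt_le_mono sum_mono2) auto

lemma ell2_weighted_iff:
  assumes "\<And>n. 0 \<le> \<beta> n"
  shows "b \<in> ell2_weighted \<beta> \<longleftrightarrow> (\<exists>C. \<forall>N. wnorm \<beta> b N \<le> C)"
proof
  assume "b \<in> ell2_weighted \<beta>"
  then have s: "summable (\<lambda>n. (cmod (b n))\<^sup>2 * \<beta> n)" by (simp add: ell2_weighted_def)
  have "wnorm \<beta> b N \<le> sqrt (\<Sum>n. (cmod (b n))\<^sup>2 * \<beta> n)" for N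
    using sum_le_suminf[OF s, of "{..<N}"] assms
    by (intro real_le_rsqrt) (simp add: wnorm_sq)
  then show "\<exists>C. \<forall>N. wnorm \<beta> b N \<le> C" by blast
next
  assume "\<exists>C. \<forall>N. wnorm \<beta> b N \<le> C"
  then obtain C where C: "\<And>N. wnorm \<beta> b N \<le> C" by blast
  have "(\<Sum>n<N. (cmod (b n))\<^sup>2 * \<beta> n) \<le> C\<^sup>2" for N
    using power_mono[OF C wnorm_nonneg, of N 2] assms by (simp add: wnorm_sq)
  then show "b \<in> ell2_weighted \<beta>"
    unfolding ell2_weighted_def
    using assms by (auto intro!: summableI_nonneg_bounded)
qed

text \<open>A gliding hump: convolution is lower triangular, so the first \<open>N\<close> entries of the product only
  depend on the first \<open>N\<close> entries of the factor, and a multiplier of infinite norm would allow us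
  to build a bad factor block by block.\<close>

lemma H_infinity_bounded:
  assumes \<beta>: "\<And>n. 0 < \<beta> n" and a: "a \<in> H_infinity \<beta>"
  shows "\<exists>C\<ge>0. \<forall>b N. wnorm \<beta> (seq_conv a b) N \<le> C * wnorm \<beta> b N"
proof (rule ccontr)
  assume unb: "\<not> ?thesis"
  note \<beta>0 = less_imp_le[OF \<beta>]
  note conv_add = seq_conv_add[abs_def] and conv_scale = seq_conv_scale[abs_def]
  define cut where "cut b N = (\<lambda>n. if n < N then b n else (0::complex))" for b :: "nat \<Rightarrow> complex" and N :: nat
  define tl where "tl b N = (\<lambda>n. if n < N then 0 else b n :: complex)" for b and N :: nat
  have cut_tl: "(\<lambda>n. cut b N n + tl b N n) = b" for b N by (auto simp: cut_def tl_def)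
  have bdd: "\<exists>K. \<forall>M. wnorm \<beta> (seq_conv a c) M \<le> K" if "c \<in> ell2_weighted \<beta>" for c
    using a that ell2_weighted_iff[OF \<beta>0, where b = "seq_conv a c"] by (auto simp: H_infinity_def)
  have extend: "wnorm \<beta> c M = wnorm \<beta> c N" if "\<forall>n\<ge>N. c n = 0" "N \<le> M" for c N M
    unfolding wnorm_def L2_set_def using that
    by (intro arg_cong[of _ _ sqrt] sum.mono_neutral_right) auto
  have fin: "c \<in> ell2_weighted \<beta>" if c: "\<forall>n\<ge>N. c n = 0" for c N
    unfolding ell2_weighted_def
  proof (intro CollectI summable_finite[of "{..<N}"])
    show "(cmod (c n))\<^sup>2 * \<beta> n = 0" if "n \<notin> {..<N}" for n using c that by simp
  qed simp
  \<comment> \<open>On sequences supported in the first \<open>N\<close> places the multiplier is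
    bounded, with a constant depending on \<open>N\<close>: one unit sequence is added at a time,
    and its image has finite norm. This later pays for removing the first \<open>N\<close> entries
    of a hump.\<close>
  have cut_bound: "\<exists>K\<ge>0. \<forall>b M. wnorm \<beta> (seq_conv a (cut b N)) M \<le> K * wnorm \<beta> b N" for N
  proof (induction N)
    case 0
    have "seq_conv a (cut b 0) = (\<lambda>_. 0)" for b by (auto simp: seq_conv_def cut_def)
    then show ?case by (auto simp: wnorm_def L2_set_def)
  next
    case (Suc N)
    then obtain K where K: "K \<ge> 0" "\<And>b M. wnorm \<beta> (seq_conv a (cut b N)) M \<le> K * wnorm \<beta> b N" by blast
    define d where "d = (\<lambda>n. if n = N then 1 else (0::complex))"
    obtain K' where K': "\<And>M. wnorm \<beta> (seq_conv a d) M \<le> K'"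
      using bdd[OF fin[of "Suc N" d]] by (auto simp: d_def)
    have K'0: "0 \<le> K'" using K'[of 0] wnorm_nonneg[of \<beta> "seq_conv a d" 0] by linarith
    have "wnorm \<beta> (seq_conv a (cut b (Suc N))) M \<le> (K + K' / sqrt (\<beta> N)) * wnorm \<beta> b (Suc N)" for b M
    proof -
      have "cut b (Suc N) = (\<lambda>n. cut b N n + b N * d n)"
        by (auto simp: cut_def d_def fun_eq_iff less_Suc_eq)
      then have "wnorm \<beta> (seq_conv a (cut b (Suc N))) M
          = wnorm \<beta> (\<lambda>n. seq_conv a (cut b N) n + b N * seq_conv a d n) M"
        by (intro wnorm_cong) (simp add: seq_conv_add seq_conv_scale)
      also have "\<dots> \<le> wnorm \<beta> (seq_conv a (cut b N)) M + cmod (b N) * wnorm \<beta> (seq_conv a d) M"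
        using wnorm_triangle[of \<beta> "seq_conv a (cut b N)" "\<lambda>n. b N * seq_conv a d n" M] \<beta>0
        by (simp add: wnorm_scale)
      also have "\<dots> \<le> K * wnorm \<beta> b N + cmod (b N) * K'"
        by (intro add_mono K mult_left_mono K') auto
      also have "K * wnorm \<beta> b N \<le> K * wnorm \<beta> b (Suc N)"
        by (intro mult_left_mono K wnorm_mono) auto
      also have "cmod (b N) * K' \<le> wnorm \<beta> b (Suc N) / sqrt (\<beta> N) * K'"
      proof (rule mult_right_mono[OF _ K'0])
        have "cmod (b N) * sqrt (\<beta> N) \<le> wnorm \<beta> b (Suc N)"
          unfolding wnorm_def by (rule member_le_L2_set) auto
        then show "cmod (b N) \<le> wnorm \<beta> b (Suc N) / sqrt (\<beta> N)"
          using \<beta>[of N] by (simp add: field_simps)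
      qed
      finally show ?thesis by (simp add: algebra_simps)
    qed
    then show ?case using K K'0 \<beta>0[of N] by (intro exI[of _ "K + K' / sqrt (\<beta> N)"]) auto
  qed
  \<comment> \<open>One hump: \<open>c\<close> is kept on its first \<open>N\<close> entries and
    prolonged at cost at most \<open>(1/2)^k\<close>, so that the image acquires norm at least
    \<open>k\<close>.\<close>
  have step: "\<exists>c' N'. N < N' \<and> (\<forall>n<N. c' n = c n) \<and> (\<forall>n\<ge>N'. c' n = 0) \<and>
      wnorm \<beta> c' N' \<le> wnorm \<beta> c N + (1/2)^k \<and> real k \<le> wnorm \<beta> (seq_conv a c') N'"
    if c: "\<forall>n\<ge>N. c n = 0" for c N k
  proof -
    obtain K1 where K1: "\<And>M. wnorm \<beta> (seq_conv a c) M \<le> K1" using bdd[OF fin[OF c]] by blast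
    have K10: "0 \<le> K1" using K1[of 0] wnorm_nonneg[of \<beta> "seq_conv a c" 0] by linarith
    obtain K2 where K2: "K2 \<ge> 0" "\<And>b M. wnorm \<beta> (seq_conv a (cut b N)) M \<le> K2 * wnorm \<beta> b N"
      using cut_bound by blast
    \<comment> \<open>\<open>K1\<close> bounds the image of the old part \<open>c\<close>,
      \<open>K2\<close> the image of the first \<open>N\<close> entries of the normalized
      \<open>b1\<close>, and \<open>2 ^ k\<close> compensates the damping of the hump. After these
      losses at least \<open>k\<close> remains.\<close>
    define C where "C = 2 ^ k * (real k + K1) + K2"
    have C0: "C \<ge> 0" unfolding C_def using K10 K2 by simp
    obtain b N' where b: "wnorm \<beta> (seq_conv a b) N' > C * wnorm \<beta> b N'"
      using unb C0 by (meson not_le)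
    define s where "s = wnorm \<beta> b N'"
    have "s \<noteq> 0"
    proof
      assume "s = 0"
      then have "b n = 0" if "n < N'" for n
        using that \<beta>[of n] unfolding s_def wnorm_def by (auto simp: L2_set_eq_0_iff)
      then have "seq_conv a b n = 0" if "n < N'" for n using that by (simp add: seq_conv_def)
      then have "wnorm \<beta> (seq_conv a b) N' = 0" by (simp add: wnorm_def L2_set_def)
      then show False using b \<open>s = 0\<close> by (simp add: s_def)
    qed
    then have s: "s > 0" using wnorm_nonneg[of \<beta> b N'] by (simp add: s_def)
    define b1 where "b1 = (\<lambda>n. of_real (1 / s) * cut b N' n)"
    \<comment> \<open>The maximum makes the new support bound exceed \<open>N\<close> even if the
      bad block \<open>b\<close> is short.\<close>
    define M where "M = max N' (Suc N)"
    have M: "N' \<le> M" "N < M" by (auto simp: M_def)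
    have b1_0: "\<forall>n\<ge>N'. b1 n = 0" by (simp add: b1_def cut_def)
    have cutn: "wnorm \<beta> (cut b N') N' = s" unfolding s_def by (rule wnorm_cong) (simp add: cut_def)
    have nb1: "wnorm \<beta> b1 M = 1"
      unfolding extend[OF b1_0 M(1)] unfolding b1_def wnorm_scale cutn using s by (simp add: norm_divide)
    have "C < 1 / s * wnorm \<beta> (seq_conv a b) N'"
      using b s by (simp add: field_simps flip: s_def)
    also have "wnorm \<beta> (seq_conv a b) N' = wnorm \<beta> (seq_conv a (cut b N')) N'"
      by (intro wnorm_cong seq_conv_cong) (simp add: cut_def)
    also have "1 / s * wnorm \<beta> (seq_conv a (cut b N')) N' = wnorm \<beta> (seq_conv a b1) N'"
      unfolding b1_def conv_scale wnorm_scale using s by (simp add: norm_divide)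
    also have "\<dots> \<le> wnorm \<beta> (seq_conv a b1) M" by (rule wnorm_mono[OF M(1)])
    finally have Cb1: "C < wnorm \<beta> (seq_conv a b1) M" .
    have "wnorm \<beta> (seq_conv a b1) M = wnorm \<beta> (\<lambda>n. seq_conv a (cut b1 N) n + seq_conv a (tl b1 N) n) M"
      by (simp add: conv_add[symmetric] cut_tl)
    also have "\<dots> \<le> wnorm \<beta> (seq_conv a (cut b1 N)) M + wnorm \<beta> (seq_conv a (tl b1 N)) M"
      by (rule wnorm_triangle[OF \<beta>0])
    also have "wnorm \<beta> (seq_conv a (cut b1 N)) M \<le> K2 * wnorm \<beta> b1 N" by (rule K2)
    also have "\<dots> \<le> K2 * 1"
      unfolding nb1[symmetric] using M K2 by (intro mult_left_mono wnorm_mono) auto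
    finally have tl_big: "2 ^ k * (real k + K1) < wnorm \<beta> (seq_conv a (tl b1 N)) M"
      using Cb1 by (simp add: C_def)
    define c' where "c' = (\<lambda>n. c n + (1/2)^k * tl b1 N n)"
    have "wnorm \<beta> c' M \<le> wnorm \<beta> c M + wnorm \<beta> (\<lambda>n. (1/2)^k * tl b1 N n) M"
      unfolding c'_def by (rule wnorm_triangle[OF \<beta>0])
    also have "wnorm \<beta> c M = wnorm \<beta> c N" by (rule extend[OF c less_imp_le[OF M(2)]])
    also have "wnorm \<beta> (\<lambda>n. (1/2)^k * tl b1 N n) M = (1/2)^k * wnorm \<beta> (tl b1 N) M"
      unfolding wnorm_scale by (simp add: norm_power norm_divide)
    also have "wnorm \<beta> (tl b1 N) M \<le> wnorm \<beta> b1 M"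
      unfolding wnorm_def by (rule L2_set_mono) (auto simp: tl_def \<beta>0)
    finally have n1: "wnorm \<beta> c' M \<le> wnorm \<beta> c N + (1/2)^k" by (simp add: nb1)
    have "real k + K1 \<le> (1/2)^k * wnorm \<beta> (seq_conv a (tl b1 N)) M"
      using tl_big by (simp add: field_simps)
    also have "\<dots> = wnorm \<beta> (seq_conv a (\<lambda>n. (1/2)^k * tl b1 N n)) M"
      unfolding conv_scale wnorm_scale by (simp add: norm_power norm_divide)
    also have "\<dots> = wnorm \<beta> (\<lambda>n. seq_conv a c' n + (-1) * seq_conv a c n) M"
      unfolding c'_def conv_add by simp
    also have "\<dots> \<le> wnorm \<beta> (seq_conv a c') M + wnorm \<beta> (\<lambda>n. (-1) * seq_conv a c n) M"
      by (rule wnorm_triangle[OF \<beta>0])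
    also have "wnorm \<beta> (\<lambda>n. (-1) * seq_conv a c n) M = wnorm \<beta> (seq_conv a c) M"
      unfolding wnorm_scale by simp
    also have "\<dots> \<le> K1" by (rule K1)
    finally have n2: "real k \<le> wnorm \<beta> (seq_conv a c') M" by simp
    have "\<forall>n<N. c' n = c n" "\<forall>n\<ge>M. c' n = 0"
      using c b1_0 M by (auto simp: c'_def tl_def)
    then show ?thesis using M n1 n2 by blast
  qed
  \<comment> \<open>The state of the recursion is a sequence together with a bound beyond which it
    vanishes.\<close>
  define Q where "Q k x y \<longleftrightarrow> snd x < snd y \<and> (\<forall>n<snd x. fst y n = fst x n) \<and>
      wnorm \<beta> (fst y) (snd y) \<le> wnorm \<beta> (fst x) (snd x) + (1/2)^k \<and>
      real k \<le> wnorm \<beta> (seq_conv a (fst y)) (snd y)" for k :: nat and x y :: "(nat \<Rightarrow> complex) \<times> nat"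
  have "\<exists>F. \<forall>k. (\<forall>n\<ge>snd (F k). fst (F k) n = 0) \<and> Q k (F k) (F (Suc k))"
  proof (rule dependent_nat_choice)
    show "\<exists>x :: (nat \<Rightarrow> complex) \<times> nat. \<forall>n\<ge>snd x. fst x n = 0" by (intro exI[of _ "((\<lambda>_. 0), 0)"]) simp
  next
    fix x :: "(nat \<Rightarrow> complex) \<times> nat" and k
    assume "\<forall>n\<ge>snd x. fst x n = 0"
    from step[OF this, of k] show "\<exists>y. (\<forall>n\<ge>snd y. fst y n = 0) \<and> Q k x y"
      unfolding Q_def by auto
  qed
  then obtain F where F: "\<And>k. Q k (F k) (F (Suc k))" by blast
  define c N where "c k = fst (F k)" and "N k = snd (F k)" for k
  have c: "N k < N (Suc k)" "\<And>n. n < N k \<Longrightarrow> c (Suc k) n = c k n"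
      "wnorm \<beta> (c (Suc k)) (N (Suc k)) \<le> wnorm \<beta> (c k) (N k) + (1/2)^k"
      "real k \<le> wnorm \<beta> (seq_conv a (c (Suc k))) (N (Suc k))" for k
    using F[of k] by (auto simp: Q_def c_def N_def)
  have mono: "strict_mono N" using c(1) by (simp add: strict_mono_Suc_iff)
  have Nk: "k \<le> N k" for k by (rule strict_mono_imp_increasing[OF mono])
  have agree: "c (k + i) n = c k n" if "n < N k" for k i n
  proof (induction i)
    case (Suc i)
    have "N k \<le> N (k + i)" using mono by (simp add: strict_mono_less_eq)
    then show ?case using c(2)[of n "k + i"] that Suc by simp
  qed simp
  \<comment> \<open>Entry \<open>n\<close> is already final at stage \<open>Suc n\<close>, because
    \<open>n < Suc n \<le> N (Suc n)\<close>.\<close>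
  define x where "x n = c (Suc n) n" for n
  have x: "x n = c k n" if "n < N k" for n k
  proof (cases "Suc n \<le> k")
    case True
    then obtain i where "k = Suc n + i" using le_Suc_ex by blast
    moreover have "n < N (Suc n)" using Nk[of "Suc n"] by simp
    ultimately show ?thesis unfolding x_def using agree[of n "Suc n" i] by simp
  next
    case False
    then obtain i where "Suc n = k + i" by (metis le_Suc_ex nat_le_linear)
    then show ?thesis unfolding x_def using agree[OF that, of i] by simp
  qed
  \<comment> \<open>The costs of the humps form a geometric series with sum 2, so the limit sequence
    \<open>x\<close> stays in the space.\<close>
  have cb: "wnorm \<beta> (c k) (N k) \<le> wnorm \<beta> (c 0) (N 0) + (2 - 2 * (1/2)^k)" for k
  proof (induction k)
    case (Suc k)
    then show ?case using c(3)[of k] by (simp add: field_simps)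
  qed simp
  have "wnorm \<beta> x M \<le> wnorm \<beta> (c 0) (N 0) + 2" for M
  proof -
    have "wnorm \<beta> x M \<le> wnorm \<beta> x (N M)" by (rule wnorm_mono[OF Nk])
    also have "\<dots> = wnorm \<beta> (c M) (N M)" by (rule wnorm_cong) (rule x)
    also have "\<dots> \<le> wnorm \<beta> (c 0) (N 0) + (2 - 2 * (1/2)^M)" by (rule cb)
    finally show ?thesis by (smt (verit) zero_le_power divide_nonneg_nonneg)
  qed
  then have "x \<in> ell2_weighted \<beta>" using ell2_weighted_iff[of \<beta> x] \<beta>0 by blast
  then obtain K where K: "\<And>M. wnorm \<beta> (seq_conv a x) M \<le> K" using bdd by blast
  obtain k where k: "real k > K" using reals_Archimedean2 by blast
  \<comment> \<open>Triangularity again: up to \<open>N (Suc k)\<close> the product only sees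
    entries on which \<open>x\<close> and \<open>c (Suc k)\<close> agree, so the image of
    \<open>x\<close> inherits every lower bound \<open>k\<close>.\<close>
  have "wnorm \<beta> (seq_conv a (c (Suc k))) (N (Suc k)) = wnorm \<beta> (seq_conv a x) (N (Suc k))"
    using x[of _ "Suc k"] by (intro wnorm_cong seq_conv_cong) (metis le_less_trans)
  then show False using c(4)[of k] K[of "N (Suc k)"] k by linarith
qed

section \<open>Balanced weighted shifts\<close>

locale rooted_tree =
  fixes V :: "'v set" and E :: "('v \<times> 'v) set"
  assumes tree: "rooted_directed_tree V E"
begin

abbreviation "rt \<equiv> tree_root V E"
abbreviation "parent \<equiv> par E"
abbreviation "lvl \<equiv> depth V E"

lemma rt_in: "rt \<in> V" "(u, rt) \<notin> E"
proof -
  have "\<exists>!r. r \<in> V \<and> (\<forall>u. (u, r) \<notin> E)" using tree by (simp add: rooted_directed_tree_def)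
  from theI'[OF this] show "rt \<in> V" "(u, rt) \<notin> E" by (auto simp: tree_root_def)
qed

lemma parent_eq: "(u, v) \<in> E \<Longrightarrow> parent v = u"
  unfolding par_def using tree by (intro the_equality) (auto simp: rooted_directed_tree_def)

lemma parent_edge:
  assumes "v \<in> V - {rt}"
  shows "(parent v, v) \<in> E" "parent v \<in> V"
proof -
  have "\<exists>!r. r \<in> V \<and> (\<forall>u. (u, r) \<notin> E)" using tree by (simp add: rooted_directed_tree_def)
  then obtain u where u: "(u, v) \<in> E" using assms rt_in by blast
  then show "(parent v, v) \<in> E" by (simp add: parent_eq)
  then show "parent v \<in> V" using tree by (auto simp: rooted_directed_tree_def)
qed

text \<open>Connectedness provides an undirected path from the root. A step to a child adds one
  application of \<open>parent\<close>, a step to a parent removes one.\<close>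

lemma reachable:
  assumes "v \<in> V"
  shows "\<exists>k. (parent ^^ k) v = rt"
proof -
  have "(rt, v) \<in> (E \<union> E\<inverse>)\<^sup>*" using tree assms rt_in by (auto simp: rooted_directed_tree_def)
  then show ?thesis
  proof (induction rule: rtrancl_induct)
    case base
    show ?case by (rule exI[of _ 0]) simp
  next
    case (step u v)
    then obtain k where k: "(parent ^^ k) u = rt" by blast
    show ?case
    proof (cases "(u, v) \<in> E")
      case True
      then have "(parent ^^ Suc k) v = rt" using k by (simp only: funpow_Suc_right o_def parent_eq)
      then show ?thesis by blast
    next
      case False
      then have vu: "(v, u) \<in> E" using step by auto
      \<comment> \<open>A vertex with a parent is not the root, so \<open>k\<close> is positive and
        one application can be removed.\<close>
      then have "u \<noteq> rt" using rt_in by auto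
      then obtain k' where "k = Suc k'" using k by (cases k) auto
      then have "(parent ^^ k') v = rt"
        using k parent_eq[OF vu] by (simp add: funpow_Suc_right del: funpow.simps)
      then show ?thesis by blast
    qed
  qed
qed

lemma lvl_root [simp]: "lvl rt = 0"
  unfolding depth_def by (rule Least_eq_0) simp

lemma lvl_parent:
  assumes "v \<in> V - {rt}"
  shows "lvl v = Suc (lvl (parent v))"
proof -
  obtain k where "(parent ^^ k) v = rt" using reachable assms by blast
  then have "lvl v = Suc (LEAST m. (parent ^^ Suc m) v = rt)"
    unfolding depth_def using assms by (intro Least_Suc) auto
  then show ?thesis by (simp add: depth_def funpow_Suc_right del: funpow.simps)
qed

end

locale balanced_shift = rooted_tree V E
  for V :: "'v set" and E :: "('v \<times> 'v) set" +
  fixes lam :: "'v \<Rightarrow> real"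
  assumes S_bounded: "weighted_shift V E lam \<in> bounded_ops V (ell2 V)"
    and S_balanced: "balanced V E (weighted_shift V E lam)"
    and S_left_invertible: "left_invertible V (weighted_shift V E lam)"
begin

abbreviation "S \<equiv> weighted_shift V E lam"

abbreviation unit_vec :: "'v \<Rightarrow> 'v \<Rightarrow> complex" where "unit_vec u \<equiv> indicator {u}"

abbreviation inner :: "('v \<Rightarrow> complex) \<Rightarrow> ('v \<Rightarrow> complex) \<Rightarrow> complex" where "inner \<equiv> ell2_inner V"

lemmas S_in = bounded_opsD(1)[OF S_bounded]

text \<open>The value 1 on levels without vertices is arbitrary; it keeps \<open>tau\<close> bounded and bounded below.\<close>

definition tau :: "nat \<Rightarrow> real" where
  "tau m = (if \<exists>u\<in>V. lvl u = m then (ell2_norm V (S (unit_vec (SOME u. u \<in> V \<and> lvl u = m))))\<^sup>2 else 1)"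

lemma tau_lvl:
  assumes "u \<in> V"
  shows "(ell2_norm V (S (unit_vec u)))\<^sup>2 = tau (lvl u)"
proof -
  have "\<exists>u'. u' \<in> V \<and> lvl u' = lvl u" using assms by blast
  from someI_ex[OF this] have "(SOME u'. u' \<in> V \<and> lvl u' = lvl u) \<in> V"
      "lvl (SOME u'. u' \<in> V \<and> lvl u' = lvl u) = lvl u" by blast+
  then have "ell2_norm V (S (unit_vec u)) = ell2_norm V (S (unit_vec (SOME u'. u' \<in> V \<and> lvl u' = lvl u)))"
    using S_balanced assms unfolding balanced_def by (metis (no_types, lifting))
  then show ?thesis using assms by (auto simp: tau_def)
qed

text \<open>The lower bound comes from the left inverse, the upper one from boundedness of
  \<open>S\<close>. That 1 lies between \<open>a\<close> and \<open>b\<close> makes their powers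
  monotone, as \<open>ex_kappa\<close> requires.\<close>

lemma tau_bounds:
  obtains a b where "0 < a" "a \<le> 1" "1 \<le> b" "\<And>m. a \<le> tau m" "\<And>m. tau m \<le> b"
proof -
  obtain B where B: "B \<in> bounded_ops V (ell2 V)" "\<And>f. f \<in> ell2 V \<Longrightarrow> B (S f) = f"
    using S_left_invertible by (auto simp: left_invertible_def)
  obtain C where C: "C \<ge> 0" "\<And>f. f \<in> ell2 V \<Longrightarrow> ell2_norm V (B f) \<le> C * ell2_norm V f"
    using bounded_opsD(4)[OF B(1)] by blast
  obtain D where D: "D \<ge> 0" "\<And>f. f \<in> ell2 V \<Longrightarrow> ell2_norm V (S f) \<le> D * ell2_norm V f"
    using bounded_opsD(4)[OF S_bounded] by blast
  \<comment> \<open>Enlarging both constants by 1 lets the bounds cover the default value 1 of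
    \<open>tau\<close> and keeps the later divisor positive.\<close>
  have *: "1 \<le> (C + 1)\<^sup>2 * tau m \<and> tau m \<le> (D + 1)\<^sup>2" for m
  proof (cases "\<exists>u\<in>V. lvl u = m")
    case True
    then obtain u where u: "u \<in> V" "lvl u = m" by blast
    define s where "s = ell2_norm V (S (unit_vec u))"
    have s: "s \<ge> 0" by (simp add: s_def)
    have "1 \<le> C * s"
      using C(2)[OF S_in[OF ell2_indicator]] u by (simp add: B(2) ell2_indicator ell2_norm_indicator s_def)
    also have "\<dots> \<le> (C + 1) * s" using s by (simp add: mult_right_mono)
    finally have "1 \<le> ((C + 1) * s)\<^sup>2" by (rule one_le_power)
    moreover have "s \<le> D + 1"
      using D(2)[OF ell2_indicator[OF u(1)]] u by (simp add: ell2_norm_indicator s_def)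
    then have "s\<^sup>2 \<le> (D + 1)\<^sup>2" using s by (rule power_mono)
    ultimately show ?thesis using tau_lvl[OF u(1)] u by (simp add: power_mult_distrib s_def)
  next
    case False
    then show ?thesis using C D by (simp add: tau_def one_le_power)
  qed
  show ?thesis
  proof (rule that[of "1 / (C + 1)\<^sup>2" "(D + 1)\<^sup>2"])
    show "1 / (C + 1)\<^sup>2 \<le> tau m" for m using *[of m] C by (simp add: field_simps)
  qed (use * C D in \<open>auto simp: one_le_power\<close>)
qed

lemma tau_pos: "0 < tau m"
  by (rule tau_bounds) (meson less_le_trans)

section \<open>Multiplication by functions of the level\<close>

definition diag :: "(nat \<Rightarrow> real) \<Rightarrow> ('v \<Rightarrow> complex) \<Rightarrow> ('v \<Rightarrow> complex)" where
  "diag w f = (\<lambda>v. of_real (w (lvl v)) * f v)"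

definition bounded_seq :: "(nat \<Rightarrow> real) \<Rightarrow> bool" where
  "bounded_seq w \<longleftrightarrow> (\<exists>C. \<forall>m. \<bar>w m\<bar> \<le> C)"

lemma bounded_seq_tau: "bounded_seq tau"
proof -
  obtain a b where "\<And>m. tau m \<le> b" using tau_bounds by metis
  then show ?thesis using tau_pos unfolding bounded_seq_def by (intro exI[of _ b]) (auto simp: abs_of_pos)
qed

lemma bounded_seq_inverse_tau: "bounded_seq (\<lambda>m. 1 / tau m)"
proof -
  obtain a b where a: "0 < a" "\<And>m. a \<le> tau m" using tau_bounds by metis
  have "\<bar>1 / tau m\<bar> \<le> 1 / a" for m
    using a(1) a(2)[of m] tau_pos[of m] by (simp add: frac_le)
  then show ?thesis unfolding bounded_seq_def by blast
qed

lemma bounded_seq_mult: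
  assumes "bounded_seq w" "bounded_seq w'"
  shows "bounded_seq (\<lambda>m. w m * w' m)"
proof -
  obtain C D where "\<And>m. \<bar>w m\<bar> \<le> C" "\<And>m. \<bar>w' m\<bar> \<le> D" using assms by (auto simp: bounded_seq_def)
  then have "\<bar>w m * w' m\<bar> \<le> C * D" for m
    unfolding abs_mult by (intro mult_mono) (auto intro: order_trans[OF abs_ge_zero])
  then show ?thesis by (auto simp: bounded_seq_def)
qed

lemma bounded_seq_Suc: "bounded_seq w \<Longrightarrow> bounded_seq (\<lambda>m. w (Suc m))"
  by (auto simp: bounded_seq_def)

lemma bounded_seq_const: "bounded_seq (\<lambda>_. c)"
  by (auto simp: bounded_seq_def)

lemma diag_in: "bounded_seq w \<Longrightarrow> f \<in> ell2 V \<Longrightarrow> diag w f \<in> ell2 V"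
  unfolding diag_def bounded_seq_def by (auto intro!: ell2_mult_bounded)

lemma diag_bounded_ops:
  assumes "bounded_seq w"
  shows "diag w \<in> bounded_ops V (ell2 V)"
proof -
  obtain C where C: "\<And>m. \<bar>w m\<bar> \<le> C" using assms by (auto simp: bounded_seq_def)
  then have C0: "C \<ge> 0" using abs_ge_zero order_trans by blast
  have "ell2_norm V (diag w f) \<le> C * ell2_norm V f" if "f \<in> ell2 V" for f
    unfolding diag_def using that C C0 by (intro ell2_norm_mult_bounded) auto
  then show ?thesis using diag_in[OF assms]
    by (auto simp: bounded_ops_def diag_def algebra_simps)
qed

lemma diag_one [simp]: "diag (\<lambda>_. 1) f = f"
  by (simp add: diag_def)

lemma inner_diag: "inner (diag w f) g = inner f (diag w g)"
  by (simp add: ell2_inner_def diag_def mult_ac)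

lemma diag_diag: "diag w (diag w' f) = diag (\<lambda>m. w m * w' m) f"
  by (simp add: diag_def mult_ac)

text \<open>\<open>S\<close> moves values to the next level. As a consequence the range of
  \<open>S\<close> is invariant under every bounded \<open>diag w\<close>, and by self-adjointness
  so is the kernel of the adjoint.\<close>

lemma diag_S: "diag w (S f) = S (diag (\<lambda>m. w (Suc m)) f)"
  by (auto simp: diag_def weighted_shift_def lvl_parent fun_eq_iff)

text \<open>\<open>S (unit_vec u)\<close> lives on the children of \<open>u\<close>, and there
  \<open>S f\<close> is \<open>f u\<close> times it. Balance then replaces its squared norm by a
  function of the level, which makes \<open>S_adj\<close> after \<open>S\<close> diagonal.\<close>

lemma inner_S_S_unit:
  assumes u: "u \<in> V"
  shows "inner (S f) (S (unit_vec u)) = f u * tau (lvl u)"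
proof -
  have "S f v * cnj (S (unit_vec u) v) = f u * (S (unit_vec u) v) * cnj (S (unit_vec u) v)" for v
    by (auto simp: weighted_shift_def indicator_def)
  then have "inner (S f) (S (unit_vec u)) = inner (\<lambda>v. f u * S (unit_vec u) v) (S (unit_vec u))"
    unfolding ell2_inner_def by (simp only:)
  then show ?thesis
    using u by (simp add: ell2_inner_scale_left ell2_inner_self S_in ell2_indicator tau_lvl)
qed

abbreviation "S_adj \<equiv> adj V S"

lemma S_adj_S: "f \<in> ell2 V \<Longrightarrow> S_adj (S f) = diag tau f"
  by (auto simp: adj_def diag_def inner_S_S_unit ell2_off fun_eq_iff)

lemmas S_adj_in = adj_in_ell2[OF S_bounded]
lemmas S_adj_inner = adj_inner[OF S_bounded]

lemma S_adj_bounded_ops: "S_adj \<in> bounded_ops V (ell2 V)"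
proof -
  obtain D where D: "D \<ge> 0" "\<And>f. f \<in> ell2 V \<Longrightarrow> ell2_norm V (S f) \<le> D * ell2_norm V f"
    using bounded_opsD(4)[OF S_bounded] by blast
  have "ell2_norm V (S_adj f) \<le> D * ell2_norm V f" if "f \<in> ell2 V" for f
    by (rule adj_bound[OF S_bounded that D(2)])
  then show ?thesis
    unfolding bounded_ops_def
    using S_adj_in by (auto simp: adj_def ell2_inner_add_left ell2_inner_scale_left S_in ell2_indicator fun_eq_iff)
qed

text \<open>The operator \<open>model_L\<close> in closed form: inverting a diagonal operator is
  dividing by \<open>tau\<close>.\<close>

definition L :: "('v \<Rightarrow> complex) \<Rightarrow> ('v \<Rightarrow> complex)" where
  "L f = diag (\<lambda>m. 1 / tau m) (S_adj f)"

lemma L_bounded_ops: "L \<in> bounded_ops V (ell2 V)"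
  using bounded_ops_comp[OF diag_bounded_ops[OF bounded_seq_inverse_tau] S_adj_bounded_ops]
  by (simp add: L_def[abs_def])

lemmas L_in = bounded_opsD(1)[OF L_bounded_ops]

lemma diag_tau_L: "diag tau (L f) = S_adj f"
  using tau_pos by (simp add: L_def diag_diag less_imp_neq[symmetric])

lemma L_S [simp]: "f \<in> ell2 V \<Longrightarrow> L (S f) = f"
  using tau_pos by (simp add: L_def diag_diag S_adj_S less_imp_neq[symmetric])

lemma model_L_eq:
  assumes f: "f \<in> ell2 V"
  shows "model_L V S f = L f"
  unfolding model_L_def
proof (rule inv_into_f_eq)
  have eq: "adjoint_op V S (S h) = diag tau h" if "h \<in> ell2 V" for h
    using that by (simp add: adjoint_op_eq_adj[OF S_bounded] S_in S_adj_S)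
  have "h = diag (\<lambda>m. 1 / tau m) (diag tau h)" for h
    using tau_pos by (simp add: diag_diag less_imp_neq[symmetric])
  then show "inj_on (\<lambda>h. adjoint_op V S (S h)) (ell2 V)"
    by (intro inj_onI) (metis eq)
  show "adjoint_op V S (S (L f)) = adjoint_op V S f"
    using f by (simp add: eq L_in diag_tau_L adjoint_op_eq_adj[OF S_bounded])
qed (rule L_in[OF f])

lemma L_pow_in: "f \<in> ell2 V \<Longrightarrow> (L ^^ n) f \<in> ell2 V"
  by (rule bounded_opsD(1)[OF bounded_ops_funpow[OF L_bounded_ops]])

lemma S_pow_in: "f \<in> ell2 V \<Longrightarrow> (S ^^ n) f \<in> ell2 V"
  by (rule bounded_opsD(1)[OF bounded_ops_funpow[OF S_bounded]])

lemma model_L_pow_eq: "f \<in> ell2 V \<Longrightarrow> (model_L V S ^^ n) f = (L ^^ n) f"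
  by (induction n) (auto simp: model_L_eq L_pow_in)

section \<open>The kernel of the adjoint and its projection\<close>

abbreviation "KE \<equiv> ker_adjoint V S"

text \<open>Division by the positive numbers \<open>tau m\<close> does not change the kernel.
  Closure properties of \<open>KE\<close> then follow from linearity of \<open>L\<close>.\<close>

lemma KE_iff: "e \<in> KE \<longleftrightarrow> e \<in> ell2 V \<and> L e = (\<lambda>_. 0)"
proof -
  have "S_adj e = (\<lambda>_. 0) \<longleftrightarrow> L e = (\<lambda>_. 0)"
  proof
    show "S_adj e = (\<lambda>_. 0)" if "L e = (\<lambda>_. 0)" using diag_tau_L[of e] that by (simp add: diag_def)
  qed (simp add: L_def diag_def)
  then show ?thesis by (auto simp: ker_adjoint_def adjoint_op_eq_adj[OF S_bounded])
qed

lemma KE_in: "e \<in> KE \<Longrightarrow> e \<in> ell2 V" and L_KE: "e \<in> KE \<Longrightarrow> L e = (\<lambda>_. 0)"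
  by (auto simp: KE_iff)

lemma KE_add: "e \<in> KE \<Longrightarrow> e' \<in> KE \<Longrightarrow> (\<lambda>v. e v + e' v) \<in> KE"
  by (simp add: KE_iff ell2_add bounded_opsD(2)[OF L_bounded_ops])

lemma KE_scale: "e \<in> KE \<Longrightarrow> (\<lambda>v. c * e v) \<in> KE"
  by (simp add: KE_iff ell2_scale bounded_opsD(3)[OF L_bounded_ops])

lemma KE_diff: "e \<in> KE \<Longrightarrow> e' \<in> KE \<Longrightarrow> (\<lambda>v. e v - e' v) \<in> KE"
  by (simp add: KE_iff ell2_diff bounded_ops_diff[OF L_bounded_ops])

lemma KE_zero: "(\<lambda>_. 0) \<in> KE"
  by (simp add: KE_iff bounded_ops_zero[OF L_bounded_ops])

lemma KE_sum: "(\<And>i. i \<in> I \<Longrightarrow> f i \<in> KE) \<Longrightarrow> (\<lambda>v. \<Sum>i\<in>I. f i v) \<in> KE"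
  by (induction I rule: infinite_finite_induct) (auto simp: KE_zero KE_add)

lemma inner_S_KE:
  assumes "e \<in> KE" "f \<in> ell2 V"
  shows "inner (S f) e = 0" "inner e (S f) = 0"
proof -
  have "S_adj e = (\<lambda>_. 0)" using assms diag_tau_L[of e] by (simp add: KE_iff diag_def)
  then show "inner (S f) e = 0" using assms S_adj_inner[of e f] ell2_inner_commute[of V f]
    by (simp add: KE_iff)
  then show "inner e (S f) = 0" by (subst ell2_inner_commute) simp
qed

definition P :: "('v \<Rightarrow> complex) \<Rightarrow> ('v \<Rightarrow> complex)" where
  "P f = (\<lambda>v. f v - S (L f) v)"

lemma P_in_KE: "f \<in> ell2 V \<Longrightarrow> P f \<in> KE"
  by (simp add: P_def KE_iff ell2_diff S_in L_in bounded_ops_diff[OF L_bounded_ops])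

lemma P_KE: "e \<in> KE \<Longrightarrow> P e = e"
  by (simp add: P_def KE_iff bounded_ops_zero[OF S_bounded])

lemma P_S: "f \<in> ell2 V \<Longrightarrow> P (S f) = (\<lambda>_. 0)"
  by (simp add: P_def)

text \<open>\<open>P f\<close> lies in the kernel because \<open>L\<close> is a left inverse of
  \<open>S\<close>, and \<open>f - P f\<close> lies in the range of \<open>S\<close>, which is
  orthogonal to the kernel. Two candidates differ by a kernel element orthogonal to itself.\<close>

lemma orth_proj_eq:
  assumes f: "f \<in> ell2 V"
  shows "orth_proj V KE f = P f"
  unfolding orth_proj_def
proof (rule the_equality)
  show "P f \<in> KE \<and> (\<forall>h\<in>KE. inner (\<lambda>v. f v - P f v) h = 0)"
    using f by (simp add: P_in_KE) (simp add: P_def inner_S_KE L_in)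
  fix p assume p: "p \<in> KE \<and> (\<forall>h\<in>KE. inner (\<lambda>v. f v - p v) h = 0)"
  define k where "k = (\<lambda>v. p v - P f v)"
  have k: "k \<in> KE" unfolding k_def using p f by (intro KE_diff P_in_KE) auto
  have fp: "(\<lambda>v. f v - P f v) \<in> ell2 V" "(\<lambda>v. f v - p v) \<in> ell2 V"
    using p f by (auto intro!: ell2_diff intro: KE_in P_in_KE)
  have "inner k k = inner (\<lambda>v. (f v - P f v) - (f v - p v)) k" by (simp add: k_def)
  also have "\<dots> = inner (\<lambda>v. f v - P f v) k - inner (\<lambda>v. f v - p v) k"
    by (rule ell2_inner_diff_left[OF fp KE_in[OF k]])
  also have "\<dots> = 0" using p k f by (simp add: P_def inner_S_KE L_in)
  finally have "ell2_norm V k = 0" using k by (simp add: ell2_inner_self KE_in)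
  then have "k = (\<lambda>_. 0)" by (rule ell2_eq_zero_if_norm[OF KE_in[OF k]])
  then show "p = P f" by (auto simp: k_def fun_eq_iff)
qed

lemma P_bounded_ops: "P \<in> bounded_ops V (ell2 V)"
proof -
  have SL: "(\<lambda>f. S (L f)) \<in> bounded_ops V (ell2 V)"
    by (rule bounded_ops_comp[OF S_bounded L_bounded_ops])
  obtain C where C: "C \<ge> 0" "\<And>f. f \<in> ell2 V \<Longrightarrow> ell2_norm V (S (L f)) \<le> C * ell2_norm V f"
    using bounded_opsD(4)[OF SL] by blast
  have "ell2_norm V (P f) \<le> (C + 1) * ell2_norm V f" if f: "f \<in> ell2 V" for f
  proof -
    have "P f = (\<lambda>v. f v + (-1) * S (L f) v)" by (simp add: P_def)
    then have "ell2_norm V (P f) \<le> ell2_norm V f + ell2_norm V (\<lambda>v. (-1) * S (L f) v)"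
      using ell2_norm_triangle[OF f ell2_scale[OF S_in[OF L_in[OF f]], of "-1"]] by simp
    also have "ell2_norm V (\<lambda>v. (-1) * S (L f) v) = ell2_norm V (S (L f))"
      unfolding ell2_norm_scale by simp
    finally show ?thesis using C(2)[OF f] by (simp add: algebra_simps)
  qed
  moreover have "P f \<in> ell2 V" if "f \<in> ell2 V" for f using P_in_KE[OF that] by (rule KE_in)
  moreover have "P (\<lambda>v. f v + g v) = (\<lambda>v. P f v + P g v)" if "f \<in> ell2 V" "g \<in> ell2 V" for f g
    by (simp add: P_def bounded_opsD(2)[OF SL that] algebra_simps)
  moreover have "P (\<lambda>v. c * f v) = (\<lambda>v. c * P f v)" if "f \<in> ell2 V" for c f
    by (simp add: P_def bounded_opsD(3)[OF SL that] algebra_simps)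
  ultimately show ?thesis unfolding bounded_ops_def by blast
qed

section \<open>The energy identity\<close>

lemma inner_S_S: "f \<in> ell2 V \<Longrightarrow> g \<in> ell2 V \<Longrightarrow> inner (S f) (S g) = inner (diag tau f) g"
  by (simp add: S_adj_inner S_in S_adj_S inner_diag)

text \<open>With \<open>f = P f + S (L f)\<close> both cross terms pair the kernel with the range of
  \<open>S\<close>. On the range part the weight shifts by one and acquires the factor
  \<open>tau\<close>; a general \<open>w\<close> allows the split to be repeated.\<close>

lemma inner_diag_split:
  assumes w: "bounded_seq w" and f: "f \<in> ell2 V"
  shows "inner (diag w f) f = inner (diag w (P f)) (P f) +
    inner (diag (\<lambda>m. w (Suc m) * tau m) (L f)) (L f)"
proof -
  define e g where "e = P f" and "g = L f"
  have e: "e \<in> KE" "e \<in> ell2 V" and g: "g \<in> ell2 V" "S g \<in> ell2 V"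
    using f by (auto simp: e_def g_def P_in_KE KE_in L_in S_in)
  have feq: "f = (\<lambda>v. e v + S g v)" by (simp add: e_def g_def P_def)
  note w' = bounded_seq_Suc[OF w]
  have "inner (diag w f) f = inner (\<lambda>v. diag w e v + diag w (S g) v) (\<lambda>v. e v + S g v)"
    by (simp add: feq bounded_opsD(2)[OF diag_bounded_ops[OF w] e(2) g(2)])
  also have "\<dots> = inner (diag w e) e + inner (diag w (S g)) e + (inner (diag w e) (S g) + inner (diag w (S g)) (S g))"
    using e g w by (simp add: ell2_inner_add_left ell2_inner_add_right diag_in ell2_add)
  also have "inner (diag w (S g)) e = 0"
    using e g w' by (simp add: diag_S inner_S_KE diag_in)
  also have "inner (diag w e) (S g) = 0"
    using e g w' by (simp add: inner_diag diag_S inner_S_KE diag_in)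
  also have "inner (diag w (S g)) (S g) = inner (diag (\<lambda>m. w (Suc m) * tau m) g) g"
    using g w' by (simp add: diag_S inner_S_S diag_in diag_diag mult.commute)
  finally show ?thesis by (simp add: e_def g_def)
qed

text \<open>The diagonal entry on level \<open>m\<close> of the adjoint of \<open>S ^^ n\<close>
  composed with \<open>S ^^ n\<close>; compare \<open>norm_S_pow\<close>.\<close>

definition wt :: "nat \<Rightarrow> nat \<Rightarrow> real" where
  "wt n m = (\<Prod>i<n. tau (m + i))"

lemma wt_0 [simp]: "wt 0 = (\<lambda>_. 1)"
  by (simp add: wt_def fun_eq_iff)

lemma wt_Suc: "wt (Suc n) = (\<lambda>m. wt n (Suc m) * tau m)"
  by (simp add: wt_def fun_eq_iff prod.lessThan_Suc_shift mult.commute del: prod.lessThan_Suc)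

lemma wt_pos: "0 < wt n m"
  by (simp add: wt_def prod_pos tau_pos)

lemma bounded_seq_wt: "bounded_seq (wt n)"
  by (induction n) (auto simp: wt_Suc bounded_seq_const bounded_seq_tau intro!: bounded_seq_mult bounded_seq_Suc)

text \<open>For bounded nonnegative \<open>w\<close> this is the quadratic form
  \<open>inner (diag w f) f\<close> (\<open>energy_inner\<close>). The square root makes it a real,
  visibly nonnegative number.\<close>

definition energy :: "(nat \<Rightarrow> real) \<Rightarrow> ('v \<Rightarrow> complex) \<Rightarrow> real" where
  "energy w f = (ell2_norm V (diag (\<lambda>m. sqrt (w m)) f))\<^sup>2"

lemma bounded_seq_sqrt:
  assumes "bounded_seq w"
  shows "bounded_seq (\<lambda>m. sqrt (w m))"
proof -
  obtain C where C: "\<And>m. \<bar>w m\<bar> \<le> C" using assms by (auto simp: bounded_seq_def)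
  have "\<bar>sqrt (w m)\<bar> \<le> sqrt C" for m using C[of m]
    by (smt (verit) real_sqrt_le_mono real_sqrt_minus real_sqrt_ge_zero)
  then show ?thesis by (auto simp: bounded_seq_def)
qed

lemma energy_inner:
  assumes "bounded_seq w" "\<And>m. 0 \<le> w m" "f \<in> ell2 V"
  shows "of_real (energy w f) = inner (diag w f) f"
proof -
  have "of_real (energy w f) = inner (diag (\<lambda>m. sqrt (w m)) f) (diag (\<lambda>m. sqrt (w m)) f)"
    unfolding energy_def using assms by (intro ell2_inner_self[symmetric] diag_in bounded_seq_sqrt)
  also have "\<dots> = inner (diag w f) f"
    using assms(2) by (simp add: inner_diag[symmetric] diag_diag)
  finally show ?thesis .
qed

lemma energy_nonneg: "0 \<le> energy w f"
  by (simp add: energy_def)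

text \<open>The Taylor coefficients of \<open>model_U V S f\<close> (see
  \<open>taylor_coeff_U\<close>), formed inside \<open>ell2 V\<close> without any power
  series.\<close>

definition coef :: "('v \<Rightarrow> complex) \<Rightarrow> nat \<Rightarrow> ('v \<Rightarrow> complex)" where
  "coef f n = P ((L ^^ n) f)"

lemma coef_KE: "f \<in> ell2 V \<Longrightarrow> coef f n \<in> KE"
  by (simp add: coef_def P_in_KE L_pow_in)

text \<open>Each use of \<open>inner_diag_split\<close> turns the weight \<open>wt n\<close> into
  \<open>wt (Suc n)\<close>. The remainder is kept: \<open>coef_bound\<close> drops it as
  nonnegative, and for finite sums of terms \<open>S ^^ k\<close> on the kernel it vanishes.\<close>

lemma energy_identity:
  assumes f: "f \<in> ell2 V"
  shows "(ell2_norm V f)\<^sup>2 = (\<Sum>k<n. energy (wt k) (coef f k)) + energy (wt n) ((L ^^ n) f)"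
proof (induction n)
  case 0
  show ?case by (simp add: energy_def)
next
  case (Suc n)
  define g where "g = (L ^^ n) f"
  have g: "g \<in> ell2 V" by (simp add: g_def L_pow_in f)
  note en = energy_inner[OF bounded_seq_wt less_imp_le[OF wt_pos]]
  have "complex_of_real (energy (wt n) g) = of_real (energy (wt n) (P g) + energy (wt (Suc n)) (L g))"
    using inner_diag_split[OF bounded_seq_wt[of n] g] g
    by (simp add: en P_in_KE KE_in L_in wt_Suc[symmetric])
  then have "energy (wt n) g = energy (wt n) (P g) + energy (wt (Suc n)) (L g)"
    by (simp only: of_real_eq_iff)
  then show ?case using Suc by (simp add: coef_def g_def)
qed

lemma L_pow_S_pow: "f \<in> ell2 V \<Longrightarrow> (L ^^ n) ((S ^^ n) f) = f"
proof (induction n arbitrary: f)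
  case (Suc n)
  have "(L ^^ Suc n) ((S ^^ Suc n) f) = (L ^^ n) (L (S ((S ^^ n) f)))" by (simp add: funpow_swap1)
  then show ?case using Suc by (simp only: L_S S_pow_in)
qed simp

lemma L_pow_S_pow_le:
  assumes "f \<in> ell2 V" "n \<le> k"
  shows "(L ^^ n) ((S ^^ k) f) = (S ^^ (k - n)) f"
proof -
  have "(S ^^ k) f = (S ^^ n) ((S ^^ (k - n)) f)"
    using assms(2) by (metis funpow_add le_add_diff_inverse o_apply)
  then show ?thesis using assms by (simp add: L_pow_S_pow S_pow_in)
qed

lemma L_pow_S_pow_ge:
  assumes "f \<in> ell2 V" "k \<le> n"
  shows "(L ^^ n) ((S ^^ k) f) = (L ^^ (n - k)) f"
proof -
  have "(L ^^ n) ((S ^^ k) f) = (L ^^ (n - k)) ((L ^^ k) ((S ^^ k) f))"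
    using assms(2) by (metis funpow_add le_add_diff_inverse2 o_apply)
  then show ?thesis using assms by (simp add: L_pow_S_pow)
qed

lemma coef_S_pow_less:
  assumes "f \<in> ell2 V" "n < k"
  shows "coef ((S ^^ k) f) n = (\<lambda>_. 0)"
proof -
  obtain m where "k - n = Suc m" using assms(2) by (metis Suc_diff_Suc)
  then show ?thesis using assms by (simp add: coef_def L_pow_S_pow_le P_S S_pow_in)
qed

lemma L_pow_KE:
  assumes "e \<in> KE"
  shows "(L ^^ Suc n) e = (\<lambda>_. 0)"
  by (induction n) (use assms in \<open>auto simp: L_KE bounded_ops_zero[OF L_bounded_ops]\<close>)

lemma coef_S_pow_ge:
  "f \<in> ell2 V \<Longrightarrow> k \<le> n \<Longrightarrow> coef ((S ^^ k) f) n = coef f (n - k)"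
  by (simp add: coef_def L_pow_S_pow_ge)

lemma coef_S_pow_KE:
  assumes e: "e \<in> KE"
  shows "coef ((S ^^ k) e) n = (if n = k then e else (\<lambda>_. 0))"
proof (cases "n < k")
  case True
  then show ?thesis using coef_S_pow_less[OF KE_in[OF e] True] by simp
next
  case False
  show ?thesis
  proof (cases "n = k")
    case True
    then show ?thesis using e by (simp add: coef_S_pow_ge KE_in) (simp add: coef_def P_KE)
  next
    case F: False
    then obtain m where "n - k = Suc m" using False by (metis Suc_diff_Suc linorder_neqE_nat)
    moreover have "coef ((S ^^ k) e) n = coef e (n - k)"
      using False e by (simp add: coef_S_pow_ge KE_in)
    ultimately show ?thesis using F L_pow_KE[OF e, of m]
      by (simp add: coef_def bounded_ops_zero[OF P_bounded_ops] del: funpow.simps)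
  qed
qed

lemma coef_bounded_ops: "(\<lambda>f. coef f n) \<in> bounded_ops V (ell2 V)"
  unfolding coef_def by (rule bounded_ops_comp[OF P_bounded_ops bounded_ops_funpow[OF L_bounded_ops]])

text \<open>In the energy identity for \<open>(S ^^ n) f\<close> the first \<open>n\<close>
  coefficients vanish and the remainder is built from \<open>f\<close> itself.\<close>

lemma norm_S_pow: "f \<in> ell2 V \<Longrightarrow> (ell2_norm V ((S ^^ n) f))\<^sup>2 = energy (wt n) f"
  using energy_identity[OF S_pow_in, of f n n]
  by (simp add: coef_S_pow_less L_pow_S_pow energy_def diag_def)

definition beta :: "nat \<Rightarrow> real" where
  "beta n = wt n 0"

lemma beta_pos: "0 < beta n"
  by (simp add: beta_def wt_pos)

lemma norm_S_pow_root: "(ell2_norm V ((S ^^ n) (unit_vec rt)))\<^sup>2 = beta n"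
proof -
  have "diag (\<lambda>m. sqrt (wt n m)) (unit_vec rt) = (\<lambda>v. of_real (sqrt (wt n 0)) * unit_vec rt v)"
    by (auto simp: diag_def indicator_def)
  then show ?thesis
    using rt_in(1) wt_pos[of n 0]
    by (simp add: norm_S_pow ell2_indicator energy_def ell2_norm_scale ell2_norm_indicator beta_def)
qed

lemma expansion:
  assumes f: "f \<in> ell2 V"
  shows "f = (\<lambda>v. (\<Sum>k<n. (S ^^ k) (coef f k) v) + (S ^^ n) ((L ^^ n) f) v)"
proof (induction n)
  case (Suc n)
  define g where "g = (L ^^ n) f"
  have g: "g \<in> ell2 V" by (simp add: g_def L_pow_in f)
  have geq: "g = (\<lambda>v. P g v + S (L g) v)" by (simp add: P_def)
  have Pg: "P g \<in> ell2 V" "S (L g) \<in> ell2 V" using g by (auto simp: P_in_KE KE_in S_in L_in)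
  have "(S ^^ n) g = (\<lambda>v. (S ^^ n) (P g) v + (S ^^ n) (S (L g)) v)"
    by (subst geq) (rule bounded_opsD(2)[OF bounded_ops_funpow[OF S_bounded] Pg])
  moreover have "coef f n = P g" "(S ^^ Suc n) ((L ^^ Suc n) f) = (S ^^ n) (S (L g))"
    by (simp_all add: coef_def g_def funpow_swap1)
  ultimately have "(\<Sum>k<Suc n. (S ^^ k) (coef f k) v) + (S ^^ Suc n) ((L ^^ Suc n) f) v
      = (\<Sum>k<n. (S ^^ k) (coef f k) v) + (S ^^ n) g v" for v
    by (simp add: add.assoc del: funpow.simps)
  then show ?case unfolding g_def by (intro trans[OF Suc] ext) (simp only:)
qed simp

text \<open>The order of vanishing at the root. \<open>S\<close> raises it by one, \<open>L\<close>
  lowers it by at most one, and \<open>P\<close> preserves it, so values near the root depend on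
  finitely many terms.\<close>

definition vanish :: "nat \<Rightarrow> ('v \<Rightarrow> complex) \<Rightarrow> bool" where
  "vanish n f \<longleftrightarrow> (\<forall>v\<in>V. lvl v < n \<longrightarrow> f v = 0)"

lemma vanish_S: "vanish n f \<Longrightarrow> vanish (Suc n) (S f)"
  using parent_edge(2) by (auto simp: vanish_def weighted_shift_def lvl_parent)

text \<open>\<open>L f u\<close> depends only on the values of \<open>f\<close> at the children of
  \<open>u\<close>, one level further down the tree.\<close>

lemma vanish_L:
  assumes "vanish (Suc n) f"
  shows "vanish n (L f)"
  unfolding vanish_def
proof (intro ballI impI)
  fix u assume u: "u \<in> V" "lvl u < n"
  have "f v * cnj (S (unit_vec u) v) = 0" if "v \<in> V" for v
    using assms that u by (auto simp: vanish_def weighted_shift_def lvl_parent indicator_def)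
  then have "inner f (S (unit_vec u)) = 0" unfolding ell2_inner_def by (simp add: infsum_0)
  then show "L f u = 0" using u by (simp add: L_def diag_def adj_def)
qed

lemma vanish_P: "vanish n f \<Longrightarrow> vanish n (P f)"
proof (cases n)
  case (Suc m)
  assume "vanish n f"
  then show ?thesis using vanish_S[OF vanish_L, of m f] Suc by (simp add: vanish_def P_def)
qed (simp add: vanish_def)

lemma vanish_L_pow: "vanish (m + n) f \<Longrightarrow> vanish m ((L ^^ n) f)"
  by (induction n arbitrary: m) (auto intro!: vanish_L)

lemma vanish_coef: "vanish (m + n) f \<Longrightarrow> vanish m (coef f n)"
  unfolding coef_def by (intro vanish_P vanish_L_pow)

lemma vanish_S_pow: "vanish n ((S ^^ n) f)"
  by (induction n) (auto intro: vanish_S simp: vanish_def[of 0])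

lemma expansion_pointwise:
  assumes f: "f \<in> ell2 V" and v: "v \<in> V" "lvl v < n"
  shows "f v = (\<Sum>k<n. (S ^^ k) (coef f k) v)"
  using fun_cong[OF expansion[OF f, of n], of v] vanish_S_pow[of n "(L ^^ n) f"] v
  by (simp add: vanish_def)

text \<open>This is analyticity vertex by vertex: at \<open>v\<close> the remainder after
  \<open>Suc (lvl v)\<close> terms vanishes, so the coefficients determine
  \<open>f v\<close>.\<close>

lemma coef_inj:
  assumes "f \<in> ell2 V" "g \<in> ell2 V" "\<And>n. coef f n = coef g n"
  shows "f = g"
proof
  fix v
  show "f v = g v"
    using expansion_pointwise[OF assms(1), of v "Suc (lvl v)"] expansion_pointwise[OF assms(2), of v "Suc (lvl v)"]
      ell2_off[of f V v] ell2_off[of g V v] assms by (cases "v \<in> V") auto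
qed

end

section \<open>Taylor coefficients\<close>

locale balanced_shift_basis = balanced_shift V E lam
  for V :: "'v set" and E :: "('v \<times> 'v) set" and lam :: "'v \<Rightarrow> real" +
  fixes J :: "'j set" and e' :: "'j \<Rightarrow> 'v \<Rightarrow> complex"
  assumes fin_dim: "finite_dimensional (ker_adjoint V (weighted_shift V E lam))"
    and basis: "separated_basis V E (ker_adjoint V (weighted_shift V E lam)) J e'"
begin

lemma onb: "orthonormal_basis V KE J e'"
  using basis by (simp add: separated_basis_def)

lemma KE_sub: "KE \<subseteq> ell2 V"
  by (auto intro: KE_in)

lemma finite_J: "finite J"
  by (rule finite_orthonormal_basis[OF KE_sub fin_dim onb])

lemma basis_KE: "j \<in> J \<Longrightarrow> e' j \<in> KE"
  using onb by (simp add: orthonormal_basis_def)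

lemma basis_in: "j \<in> J \<Longrightarrow> e' j \<in> ell2 V"
  by (rule KE_in[OF basis_KE])

lemma basis_orthonormal: "i \<in> J \<Longrightarrow> j \<in> J \<Longrightarrow> inner (e' i) (e' j) = (if i = j then 1 else 0)"
  using onb by (simp add: orthonormal_basis_def)

lemma norm_basis: "j \<in> J \<Longrightarrow> ell2_norm V (e' j) = 1"
  using ell2_inner_self[OF basis_in, of j] basis_orthonormal[of j j]
  by (metis abs_1 abs_of_nonneg ell2_norm_nonneg of_real_eq_1_iff power2_eq_1_iff abs_minus_cancel)

lemma KE_lincomb: "(\<lambda>v. \<Sum>j\<in>J. c j * e' j v) \<in> KE"
  by (intro KE_sum KE_scale basis_KE)

lemma KE_expansion: "e \<in> KE \<Longrightarrow> e = (\<lambda>v. \<Sum>j\<in>J. inner e (e' j) * e' j v)"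
  by (rule orthonormal_expansion[OF KE_sub finite_J onb KE_lincomb KE_diff])

lemma inner_lincomb: "i \<in> J \<Longrightarrow> inner (\<lambda>v. \<Sum>j\<in>J. c j * e' j v) (e' i) = c i"
  by (rule orthonormal_inner_sum[OF finite_J basis_in basis_orthonormal])

lemma norm_lincomb: "(ell2_norm V (\<lambda>v. \<Sum>j\<in>J. c j * e' j v))\<^sup>2 = (\<Sum>j\<in>J. (cmod (c j))\<^sup>2)"
  by (rule orthonormal_norm_sum[OF finite_J basis_in basis_orthonormal])

lemma KE_eqI:
  assumes "e \<in> KE" "f \<in> KE" "\<And>i. i \<in> J \<Longrightarrow> inner e (e' i) = inner f (e' i)"
  shows "e = f"
  by (subst KE_expansion[OF assms(1)], subst KE_expansion[OF assms(2)]) (simp add: assms(3))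

lemma parseval: "e \<in> KE \<Longrightarrow> (ell2_norm V e)\<^sup>2 = (\<Sum>j\<in>J. (cmod (inner e (e' j)))\<^sup>2)"
  using norm_lincomb[of "\<lambda>j. inner e (e' j)"] KE_expansion[of e] by metis

lemma KE_coordinate_le: "e \<in> KE \<Longrightarrow> j \<in> J \<Longrightarrow> cmod (inner e (e' j)) \<le> ell2_norm V e"
  using ell2_cauchy_schwarz[OF KE_in basis_in, of e j] by (simp add: norm_basis)

section \<open>Comparison of the weights with those at the root\<close>

lemma KE_bounded_level:
  obtains K where "\<And>e v. e \<in> KE \<Longrightarrow> v \<in> V \<Longrightarrow> K < lvl v \<Longrightarrow> e v = 0"
proof -
  have "\<forall>j\<in>J. \<exists>k. e' j \<in> ell2_level V E k" using basis by (simp add: separated_basis_def)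
  then obtain k where k: "\<And>j. j \<in> J \<Longrightarrow> e' j \<in> ell2_level V E (k j)" by metis
  \<comment> \<open>The sum of the levels is a convenient upper bound for each of them, also for
    empty \<open>J\<close>.\<close>
  have "e v = 0" if e: "e \<in> KE" and v: "v \<in> V" "(\<Sum>j\<in>J. k j) < lvl v" for e v
  proof -
    have "e' j v = 0" if j: "j \<in> J" for j
      using k[OF j] member_le_sum[OF j, of k] finite_J v by (auto simp: ell2_level_def)
    then show ?thesis using fun_cong[OF KE_expansion[OF e], of v] by simp
  qed
  then show ?thesis using that by blast
qed

lemma wt_add: "wt (n + m) k = wt n k * wt m (k + n)"
  by (induction m) (simp_all add: wt_def add.assoc mult.assoc)

lemma energy_le:
  assumes e: "e \<in> KE" and w: "bounded_seq w" "\<And>m. 0 \<le> w m"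
    and K: "\<And>v. v \<in> V \<Longrightarrow> K < lvl v \<Longrightarrow> e v = 0"
  shows "(\<And>m. m \<le> K \<Longrightarrow> w m \<le> c) \<Longrightarrow> 0 \<le> c \<Longrightarrow> energy w e \<le> c * (ell2_norm V e)\<^sup>2"
    and "(\<And>m. m \<le> K \<Longrightarrow> c \<le> w m) \<Longrightarrow> 0 \<le> c \<Longrightarrow> c * (ell2_norm V e)\<^sup>2 \<le> energy w e"
proof -
  have in1: "diag (\<lambda>m. sqrt (w m)) e \<in> ell2 V" by (intro diag_in bounded_seq_sqrt w KE_in e)
  have in2: "(\<lambda>v. of_real (sqrt c) * e v) \<in> ell2 V" by (intro ell2_scale KE_in e)
  have n: "c * (ell2_norm V e)\<^sup>2 = (ell2_norm V (\<lambda>v. of_real (sqrt c) * e v))\<^sup>2" if "0 \<le> c"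
    using that by (simp add: ell2_norm_scale power_mult_distrib)
  show "energy w e \<le> c * (ell2_norm V e)\<^sup>2" if c: "\<And>m. m \<le> K \<Longrightarrow> w m \<le> c" "0 \<le> c"
    unfolding n[OF c(2)] energy_def
  proof (intro power_mono ell2_norm_mono in1 in2)
    fix v assume v: "v \<in> V"
    show "cmod (diag (\<lambda>m. sqrt (w m)) e v) \<le> cmod (of_real (sqrt c) * e v)"
      using K[OF v] c(1)[of "lvl v"] w(2)[of "lvl v"] c(2)
      by (cases "lvl v \<le> K") (auto simp: diag_def norm_mult intro!: mult_right_mono)
  qed simp
  show "c * (ell2_norm V e)\<^sup>2 \<le> energy w e" if c: "\<And>m. m \<le> K \<Longrightarrow> c \<le> w m" "0 \<le> c"
    unfolding n[OF c(2)] energy_def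
  proof (intro power_mono ell2_norm_mono in1 in2)
    fix v assume v: "v \<in> V"
    show "cmod (of_real (sqrt c) * e v) \<le> cmod (diag (\<lambda>m. sqrt (w m)) e v)"
      using K[OF v] c(1)[of "lvl v"] w(2)[of "lvl v"] c(2)
      by (cases "lvl v \<le> K") (auto simp: diag_def norm_mult intro!: mult_right_mono)
  qed simp
qed

text \<open>Passing from \<open>wt n m\<close> to \<open>beta n\<close> exchanges at most
  \<open>K\<close> factors \<open>tau\<close>, each between \<open>a\<close> and \<open>b\<close>.
  Hence the constant does not depend on \<open>n\<close>.\<close>

lemma ex_kappa:
  "\<exists>c>0. \<forall>e\<in>KE. \<forall>n. beta n * (ell2_norm V e)\<^sup>2 \<le> c * energy (wt n) e \<and>
     energy (wt n) e \<le> c * beta n * (ell2_norm V e)\<^sup>2"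
proof -
  obtain K where K: "\<And>e v. e \<in> KE \<Longrightarrow> v \<in> V \<Longrightarrow> K < lvl v \<Longrightarrow> e v = 0"
    using KE_bounded_level by blast
  obtain a b where ab: "0 < a" "a \<le> 1" "1 \<le> b" "\<And>m. a \<le> tau m" "\<And>m. tau m \<le> b"
    using tau_bounds by blast
  have wt_ge: "a ^ K \<le> wt m k" if "m \<le> K" for m k
  proof -
    have "a ^ K \<le> a ^ m" using ab that by (intro power_decreasing) auto
    also have "\<dots> = (\<Prod>i<m. a)" by simp
    also have "\<dots> \<le> wt m k" unfolding wt_def using ab by (intro prod_mono) auto
    finally show ?thesis .
  qed
  have wt_le: "wt m k \<le> b ^ K" if "m \<le> K" for m k
  proof -
    have "wt m k \<le> (\<Prod>i<m. b)" unfolding wt_def using ab tau_pos by (intro prod_mono) (auto intro: less_imp_le)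
    also have "\<dots> = b ^ m" by simp
    also have "\<dots> \<le> b ^ K" using ab that by (intro power_increasing) auto
    finally show ?thesis .
  qed
  define c where "c = b ^ K / a ^ K"
  have c: "c > 0" using ab by (simp add: c_def)
  \<comment> \<open>Both sides are the full product \<open>wt (n + m) 0\<close>, cut after
    \<open>m\<close> factors or after \<open>n\<close> factors.\<close>
  have shift: "wt n m * wt m 0 = beta n * wt m n" for n m
    using wt_add[of n m 0] wt_add[of m n 0] by (simp add: beta_def add.commute mult.commute)
  have up: "wt n m \<le> c * beta n" if m: "m \<le> K" for n m
  proof -
    have "wt n m * a ^ K \<le> wt n m * wt m 0"
      using wt_ge[OF m] by (intro mult_left_mono less_imp_le[OF wt_pos]) auto
    also have "\<dots> = beta n * wt m n" by (rule shift)
    also have "\<dots> \<le> beta n * b ^ K"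
      using wt_le[OF m] by (intro mult_left_mono less_imp_le[OF beta_pos]) auto
    finally show ?thesis using ab by (simp add: c_def field_simps)
  qed
  have lo: "beta n / c \<le> wt n m" if m: "m \<le> K" for n m
  proof -
    have "beta n * a ^ K \<le> beta n * wt m n"
      using wt_ge[OF m] by (intro mult_left_mono less_imp_le[OF beta_pos]) auto
    also have "\<dots> = wt n m * wt m 0" by (rule shift[symmetric])
    also have "\<dots> \<le> wt n m * b ^ K"
      using wt_le[OF m] by (intro mult_left_mono less_imp_le[OF wt_pos]) auto
    finally show ?thesis using ab by (simp add: c_def field_simps)
  qed
  have "beta n * (ell2_norm V e)\<^sup>2 \<le> c * energy (wt n) e \<and> energy (wt n) e \<le> c * beta n * (ell2_norm V e)\<^sup>2"
    if e: "e \<in> KE" for e n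
  proof
    note en = energy_le[OF e bounded_seq_wt less_imp_le[OF wt_pos] K[OF e]]
    have c0: "0 \<le> c" "0 \<le> beta n" using c beta_pos[of n] by auto
    show "energy (wt n) e \<le> c * beta n * (ell2_norm V e)\<^sup>2"
      using c0 by (intro en(1) up) auto
    have "beta n / c * (ell2_norm V e)\<^sup>2 \<le> energy (wt n) e"
      using c0 by (intro en(2) lo) auto
    then show "beta n * (ell2_norm V e)\<^sup>2 \<le> c * energy (wt n) e"
      using c by (simp add: field_simps)
  qed
  then show ?thesis using c by blast
qed

definition kappa :: real where
  "kappa = (SOME c. 0 < c \<and> (\<forall>e\<in>KE. \<forall>n. beta n * (ell2_norm V e)\<^sup>2 \<le> c * energy (wt n) e \<and>
     energy (wt n) e \<le> c * beta n * (ell2_norm V e)\<^sup>2))"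

lemma kappa: "0 < kappa"
  "e \<in> KE \<Longrightarrow> beta n * (ell2_norm V e)\<^sup>2 \<le> kappa * energy (wt n) e"
  "e \<in> KE \<Longrightarrow> energy (wt n) e \<le> kappa * (beta n * (ell2_norm V e)\<^sup>2)"
  using someI_ex[OF ex_kappa] by (auto simp: kappa_def mult.assoc)

lemma coef_bound:
  assumes f: "f \<in> ell2 V"
  shows "(\<Sum>k<n. beta k * (ell2_norm V (coef f k))\<^sup>2) \<le> kappa * (ell2_norm V f)\<^sup>2"
proof -
  have "(\<Sum>k<n. beta k * (ell2_norm V (coef f k))\<^sup>2) \<le> (\<Sum>k<n. kappa * energy (wt k) (coef f k))"
    by (intro sum_mono kappa coef_KE f)
  also have "\<dots> = kappa * (\<Sum>k<n. energy (wt k) (coef f k))" by (simp add: sum_distrib_left)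
  also have "\<dots> \<le> kappa * (ell2_norm V f)\<^sup>2"
    using energy_identity[OF f, of n] energy_nonneg[of "wt n" "(L ^^ n) f"] kappa(1)
    by (intro mult_left_mono) auto
  finally show ?thesis .
qed

text \<open>\<open>L ^^ N\<close> annihilates the finite sum, so the energy identity holds without
  remainder and the norm is governed by the prescribed coefficients alone.\<close>

lemma partial_synthesis:
  assumes g: "\<And>k. g k \<in> KE"
  defines "F \<equiv> \<lambda>N v. \<Sum>k<N. (S ^^ k) (g k) v"
  shows "F N \<in> ell2 V" "n < N \<Longrightarrow> coef (F N) n = g n"
    "(ell2_norm V (F N))\<^sup>2 \<le> kappa * (\<Sum>k<N. beta k * (ell2_norm V (g k))\<^sup>2)"
proof -
  have Sg: "(S ^^ k) (g k) \<in> ell2 V" for k by (intro S_pow_in KE_in g)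
  show F: "F N \<in> ell2 V" unfolding F_def by (intro ell2_sum Sg)
  have coefF: "coef (F N) n = (\<lambda>v. if n < N then g n v else 0)" for n
  proof -
    have "coef (F N) n = (\<lambda>v. \<Sum>k<N. coef ((S ^^ k) (g k)) n v)"
      unfolding F_def by (rule bounded_ops_sum[OF coef_bounded_ops Sg])
    also have "\<dots> = (\<lambda>v. \<Sum>k<N. if k = n then g n v else 0)"
      by (intro ext sum.cong) (auto simp: coef_S_pow_KE[OF g])
    finally show ?thesis by simp
  qed
  then show "coef (F N) n = g n" if "n < N" for n using that by simp
  have LF: "(L ^^ N) (F N) = (\<lambda>_. 0)"
  proof -
    have "(L ^^ N) (F N) = (\<lambda>v. \<Sum>k<N. (L ^^ N) ((S ^^ k) (g k)) v)"
      unfolding F_def by (rule bounded_ops_sum[OF bounded_ops_funpow[OF L_bounded_ops] Sg])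
    also have "\<dots> = (\<lambda>v. \<Sum>k<N. 0)"
    proof (intro ext sum.cong refl)
      fix v k assume "k \<in> {..<N}"
      then have "k < N" by simp
      then obtain m where m: "N - k = Suc m" by (metis Suc_diff_Suc)
      show "(L ^^ N) ((S ^^ k) (g k)) v = 0"
        using L_pow_S_pow_ge[OF KE_in[OF g[of k]] less_imp_le[OF \<open>k < N\<close>]] L_pow_KE[OF g, of m k]
        by (simp only: m)
    qed
    finally show ?thesis by simp
  qed
  have "(ell2_norm V (F N))\<^sup>2 = (\<Sum>k<N. energy (wt k) (g k))"
    using energy_identity[OF F, of N] by (simp add: LF coefF energy_def diag_def)
  also have "\<dots> \<le> (\<Sum>k<N. kappa * (beta k * (ell2_norm V (g k))\<^sup>2))"
    by (intro sum_mono kappa g)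
  finally show "(ell2_norm V (F N))\<^sup>2 \<le> kappa * (\<Sum>k<N. beta k * (ell2_norm V (g k))\<^sup>2)"
    by (simp add: sum_distrib_left)
qed

text \<open>Converse to \<open>coef_bound\<close>: the infinite sum is finite at every vertex, and
  the uniform norm bound of the partial sums passes to it.\<close>

lemma synthesis:
  assumes g: "\<And>k. g k \<in> KE"
    and C: "\<And>N. (\<Sum>k<N. beta k * (ell2_norm V (g k))\<^sup>2) \<le> C"
  obtains f where "f \<in> ell2 V" "\<And>n. coef f n = g n" "(ell2_norm V f)\<^sup>2 \<le> kappa * C"
proof -
  define F where "F N v = (\<Sum>k<N. (S ^^ k) (g k) v)" for N v
  note F = partial_synthesis[where g = g, OF g, folded F_def]
  \<comment> \<open>At \<open>v\<close> the terms with \<open>k > lvl v\<close> are zero, so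
    \<open>Suc (lvl v)\<close> terms give the whole sum.\<close>
  define f where "f v = (if v \<in> V then F (Suc (lvl v)) v else 0)" for v
  have C0: "0 \<le> C" using C[of 0] by simp
  have Sg0: "(S ^^ k) (g k) v = 0" if "v \<in> V" "lvl v < k" for v k
    using vanish_S_pow[of k "g k"] that by (simp add: vanish_def)
  have agree: "f v = F N v" if v: "v \<in> V" "lvl v < N" for v N
  proof -
    have "(\<Sum>k<Suc (lvl v). (S ^^ k) (g k) v) = (\<Sum>k<N. (S ^^ k) (g k) v)"
      using v by (intro sum.mono_neutral_left) (auto intro!: Sg0)
    then show ?thesis using v by (simp only: f_def F_def if_True)
  qed
  have bd: "L2_set (\<lambda>v. cmod (f v)) A \<le> sqrt (kappa * C)" if A: "finite A" "A \<subseteq> V" for A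
  proof -
    \<comment> \<open>One partial sum beyond the levels of all vertices in \<open>A\<close> agrees
      with \<open>f\<close> on \<open>A\<close>.\<close>
    define N where "N = Suc (\<Sum>v\<in>A. lvl v)"
    have "lvl v < N" if "v \<in> A" for v
      using member_le_sum[OF that, of lvl] A by (simp add: N_def less_Suc_eq_le)
    then have "L2_set (\<lambda>v. cmod (f v)) A = L2_set (\<lambda>v. cmod (F N v)) A"
      using A by (intro L2_set_cong) (auto simp: agree[of _ N])
    also have "\<dots> \<le> ell2_norm V (F N)"
      by (rule L2_set_le_ell2_norm[OF F(1) A])
    also have "\<dots> \<le> sqrt (kappa * C)"
      using F(3)[of N] mult_left_mono[OF C[of N] less_imp_le[OF kappa(1)]] by (intro real_le_rsqrt) linarith
    finally show ?thesis .
  qed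
  have f: "f \<in> ell2 V" "ell2_norm V f \<le> sqrt (kappa * C)"
    using ell2_if_L2_set_le[of V f, OF _ bd] by (simp_all add: f_def)
  have "coef f n v = g n v" for n v
  proof (cases "v \<in> V")
    case True
    \<comment> \<open>The value of the coefficient \<open>n\<close> at \<open>v\<close> only depends
      on levels up to \<open>lvl v + n\<close>, where \<open>f\<close> and \<open>F N\<close>
      coincide.\<close>
    define N where "N = Suc (lvl v) + n"
    define h where "h = (\<lambda>v. f v - F N v)"
    have h: "h \<in> ell2 V" unfolding h_def by (intro ell2_diff f F)
    have "vanish N h" by (simp add: vanish_def h_def agree)
    then have "vanish (Suc (lvl v)) (coef h n)" unfolding N_def by (rule vanish_coef)
    then have "coef h n v = 0" using True by (simp add: vanish_def)
    moreover have "coef h n = (\<lambda>v. coef f n v - coef (F N) n v)"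
      unfolding h_def by (rule bounded_ops_diff[OF coef_bounded_ops f(1) F(1)])
    moreover have "coef (F N) n = g n" by (rule F(2)) (simp add: N_def)
    ultimately show ?thesis by simp
  next
    case False
    then show ?thesis using ell2_off[OF KE_in[OF coef_KE[OF f(1)]]] ell2_off[OF KE_in[OF g]] by simp
  qed
  then have "coef f n = g n" for n by auto
  moreover have "(ell2_norm V f)\<^sup>2 \<le> kappa * C"
    using power_mono[OF f(2), of 2] kappa(1) C0 by simp
  ultimately show ?thesis using that f by blast
qed

section \<open>The functional model\<close>

abbreviation "coord f j \<equiv> \<lambda>n. inner (coef f n) (e' j)"

text \<open>The rate \<open>R\<close> is the same for all \<open>f\<close>, which gives all
  coefficient series a common disc of convergence.\<close>

lemma coef_growth:
  obtains R where "R > 0" "\<And>f. f \<in> ell2 V \<Longrightarrow> \<exists>C. \<forall>n. ell2_norm V (coef f n) \<le> C * R ^ n"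
proof -
  obtain C where C: "C \<ge> 0" "\<And>f. f \<in> ell2 V \<Longrightarrow> ell2_norm V (L f) \<le> C * ell2_norm V f"
    using bounded_opsD(4)[OF L_bounded_ops] by blast
  obtain D where D: "D \<ge> 0" "\<And>f. f \<in> ell2 V \<Longrightarrow> ell2_norm V (P f) \<le> D * ell2_norm V f"
    using bounded_opsD(4)[OF P_bounded_ops] by blast
  have "ell2_norm V (coef f n) \<le> (D * ell2_norm V f) * (C + 1) ^ n" if f: "f \<in> ell2 V" for f n
  proof -
    have "ell2_norm V (coef f n) \<le> D * ell2_norm V ((L ^^ n) f)"
      unfolding coef_def by (rule D(2)[OF L_pow_in[OF f]])
    also have "\<dots> \<le> D * (C ^ n * ell2_norm V f)"
      by (intro mult_left_mono D bounded_ops_funpow_norm[OF L_bounded_ops C f])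
    also have "\<dots> \<le> D * ((C + 1) ^ n * ell2_norm V f)"
      using C D by (intro mult_left_mono mult_right_mono power_mono) auto
    finally show ?thesis by (simp add: mult_ac)
  qed
  then show ?thesis using that[of "C + 1"] C by (metis add_nonneg_pos zero_less_one)
qed

text \<open>A zero spectral radius would make the quotient \<open>1 / 0 = 0\<close> and the disc
  empty, so a nonzero point of the spectrum is exhibited: the sum of \<open>z ^ n\<close> times
  \<open>(S ^^ n) e0\<close> is an eigenvector of \<open>L\<close> for \<open>z\<close>, because
  \<open>L\<close> kills \<open>e0\<close> and undoes \<open>S\<close>.\<close>

lemma model_disc_nhd:
  obtains \<rho> where "\<rho> > 0" "\<And>z. cmod z < \<rho> \<Longrightarrow> z \<in> model_disc V S"
proof -
  have mL: "model_L V S \<in> bounded_ops V (ell2 V)"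
    using L_bounded_ops by (auto simp: bounded_ops_def model_L_eq ell2_add ell2_scale)
  have bdd: "bdd_above (cmod ` op_spectrum V (model_L V S))"
    by (rule bounded_above_op_spectrum[OF mL])
  obtain D where D: "D \<ge> 0" "\<And>f. f \<in> ell2 V \<Longrightarrow> ell2_norm V (S f) \<le> D * ell2_norm V f"
    using bounded_opsD(4)[OF S_bounded] by blast
  \<comment> \<open>Small enough that \<open>x * D < 1\<close>, which makes the eigenvector series
    converge absolutely.\<close>
  define x where "x = 1 / (D + 1)"
  define z where "z = complex_of_real x"
  have x: "0 < x" "x * D < 1" using D by (simp_all add: x_def field_simps)
  define e0 where "e0 = unit_vec rt"
  have e0: "e0 \<in> ell2 V" "ell2_norm V e0 = 1" "e0 rt = 1"
    using rt_in(1) by (simp_all add: e0_def ell2_indicator ell2_norm_indicator)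
  have "inner e0 (S (unit_vec u)) = cnj (S (unit_vec u) rt)" for u
    unfolding e0_def by (subst ell2_inner_commute) (simp add: ell2_inner_indicator_right rt_in(1))
  then have "S_adj e0 = (\<lambda>_. 0)" by (simp add: adj_def weighted_shift_def fun_eq_iff)
  then have Le0: "L e0 = (\<lambda>_. 0)" by (simp add: L_def diag_def)
  define f where "f n = (\<lambda>v. z ^ n * (S ^^ n) e0 v)" for n
  have f: "f n \<in> ell2 V" for n unfolding f_def by (intro ell2_scale S_pow_in e0)
  have s: "summable (\<lambda>n. ell2_norm V (f n))"
  proof (rule summable_comparison_test')
    show "summable (\<lambda>n. (x * D) ^ n)" using x D by (intro summable_geometric) auto
    show "norm (ell2_norm V (f n)) \<le> (x * D) ^ n" for n
      using mult_left_mono[OF bounded_ops_funpow_norm[OF S_bounded D e0(1), of n], of "x ^ n"] x e0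
      by (simp add: f_def ell2_norm_scale z_def norm_power power_mult_distrib)
  qed
  note h' = ell2_abs_convergent_series[OF f s]
  define h where "h = (\<lambda>v. \<Sum>n. f n v)"
  have h: "h \<in> ell2 V" using h'(1) by (simp add: h_def)
  have Lf: "L (f n) = (\<lambda>v. case n of 0 \<Rightarrow> 0 | Suc m \<Rightarrow> z * f m v)" for n
    unfolding f_def bounded_opsD(3)[OF L_bounded_ops S_pow_in[OF e0(1)]]
    by (cases n) (auto simp: Le0 S_pow_in e0 mult_ac)
  have "L h v = z * h v" for v
  proof -
    have sm: "summable (\<lambda>n. L (f n) v)"
      using summable_mult[OF h'(3)[of v], of z] summable_Suc_iff[of "\<lambda>n. L (f n) v"] by (simp add: Lf)
    have "L h v = (\<Sum>n. L (f n) v)" unfolding h_def by (rule bounded_ops_suminf[OF L_bounded_ops f s])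
    also have "\<dots> = (\<Sum>n. L (f (Suc n)) v)" using suminf_split_head[OF sm] by (simp add: Lf[of 0])
    also have "\<dots> = z * h v" by (simp add: Lf h_def suminf_mult[OF h'(3)])
    finally show ?thesis .
  qed
  then have eig: "(\<lambda>v. model_L V S h v - z * h v) = (\<lambda>_. 0)" by (simp add: model_L_eq h)
  \<comment> \<open>Only the term \<open>n = 0\<close> is seen at the root, so the eigenvector is
    nonzero.\<close>
  have "f n rt = (if n = 0 then 1 else 0)" for n
    by (cases n) (auto simp: f_def e0 weighted_shift_def)
  then have "h rt = 1" using sums_unique[OF sums_single[of 0 "\<lambda>_. 1::complex"]] by (simp add: h_def)
  have "z \<in> op_spectrum V (model_L V S)"
  proof (rule ccontr)
    assume "z \<notin> op_spectrum V (model_L V S)"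
    then obtain B where B: "B \<in> bounded_ops V (ell2 V)" "B (\<lambda>v. model_L V S h v - z * h v) = h"
      using h unfolding op_spectrum_def by blast
    then have "h = (\<lambda>_. 0)" using bounded_ops_zero[OF B(1)] by (simp add: eig)
    then show False using \<open>h rt = 1\<close> by simp
  qed
  then have "cmod z \<le> op_spectral_radius V (model_L V S)"
    unfolding op_spectral_radius_def using bdd by (intro cSUP_upper) auto
  then have "0 < op_spectral_radius V (model_L V S)" using x by (simp add: z_def)
  then show ?thesis
    using that[of "1 / op_spectral_radius V (model_L V S)"] by (simp add: model_disc_def)
qed

end

text \<open>Once the earlier coefficients are zero, dividing by \<open>z ^ n\<close> and letting
  \<open>z\<close> tend to 0 isolates the next one.\<close>

lemma powser_zero_coefficients:
  fixes c :: "nat \<Rightarrow> complex"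
  assumes s: "s > 0" and c: "\<And>z. cmod z < s \<Longrightarrow> (\<lambda>n. c n * z ^ n) sums 0"
  shows "c n = 0"
proof (induction n rule: less_induct)
  case (less n)
  have "(\<lambda>k. c (k + n) * z ^ k) sums 0" if z: "z \<noteq> 0" "norm z < s" for z
  proof -
    have "(\<lambda>k. c (k + n) * z ^ (k + n)) sums 0"
      using c[OF z(2)] less by (subst sums_iff_shift) simp
    then have "(\<lambda>k. c (k + n) * z ^ (k + n) / z ^ n) sums (0 / z ^ n)" by (rule sums_divide)
    then show ?thesis using z by (simp add: power_add)
  qed
  then have "((\<lambda>z. 0) \<longlongrightarrow> c (0 + n)) (at (0::complex))"
    by (rule powser_limit_0_strong[OF s])
  then show "c n = 0" using tendsto_unique[OF _ tendsto_const, of "at (0::complex)" 0 "c n"] by simp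
qed

context balanced_shift_basis
begin

text \<open>Norm convergence in the finite-dimensional kernel is convergence of coordinates, so near
  0 the model consists of finitely many scalar power series. The radius is common to all
  \<open>f\<close>, which lets \<open>inj_model_U\<close> compare two of them.\<close>

lemma model_U_coordinate:
  obtains \<rho> where "\<rho> > 0"
    "\<And>f z j. f \<in> ell2 V \<Longrightarrow> cmod z < \<rho> \<Longrightarrow> j \<in> J \<Longrightarrow> (\<lambda>n. coord f j n * z ^ n) sums inner (model_U V S f z) (e' j)"
proof -
  obtain \<rho> where \<rho>: "\<rho> > 0" "\<And>z. cmod z < \<rho> \<Longrightarrow> z \<in> model_disc V S" using model_disc_nhd by blast
  obtain R where R: "R > 0" "\<And>f. f \<in> ell2 V \<Longrightarrow> \<exists>C. \<forall>n. ell2_norm V (coef f n) \<le> C * R ^ n"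
    using coef_growth by blast
  show ?thesis
  proof (rule that[of "min \<rho> (1 / R)"])
    fix f z j assume f: "f \<in> ell2 V" and z: "cmod z < min \<rho> (1 / R)" and j: "j \<in> J"
    obtain C where C: "\<And>n. ell2_norm V (coef f n) \<le> C * R ^ n" using R(2)[OF f] by blast
    have sm: "summable (\<lambda>n. coord f i n * z ^ n)" if i: "i \<in> J" for i
    proof (rule summable_comparison_test')
      show "summable (\<lambda>n. C * (R * cmod z) ^ n)"
        using z R(1) by (intro summable_mult summable_geometric) (simp add: field_simps)
      show "norm (coord f i n * z ^ n) \<le> C * (R * cmod z) ^ n" for n
        using mult_right_mono[OF order_trans[OF KE_coordinate_le[OF coef_KE[OF f, of n] i] C[of n]], of "cmod z ^ n"]
        by (simp add: norm_mult norm_power power_mult_distrib mult.assoc)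
    qed
    define c where "c i = (\<Sum>n. coord f i n * z ^ n)" for i
    define h where "h = (\<lambda>v. \<Sum>i\<in>J. c i * e' i v)"
    define F where "F N = (\<lambda>v. \<Sum>n<N. coef f n v * z ^ n)" for N
    have h: "h \<in> KE" unfolding h_def by (rule KE_lincomb)
    have Feq: "F N = (\<lambda>v. \<Sum>i\<in>J. (\<Sum>n<N. coord f i n * z ^ n) * e' i v)" for N
    proof
      fix v
      have "F N v = (\<Sum>n<N. \<Sum>i\<in>J. coord f i n * z ^ n * e' i v)"
        unfolding F_def
      proof (intro sum.cong refl)
        fix n
        have "coef f n v = (\<Sum>i\<in>J. coord f i n * e' i v)"
          by (rule fun_cong[OF KE_expansion[OF coef_KE[OF f]]])
        then show "coef f n v * z ^ n = (\<Sum>i\<in>J. coord f i n * z ^ n * e' i v)"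
          by (simp only: sum_distrib_right sum_distrib_left mult_ac)
      qed
      also have "\<dots> = (\<Sum>i\<in>J. \<Sum>n<N. coord f i n * z ^ n * e' i v)" by (rule sum.swap)
      finally show "F N v = (\<Sum>i\<in>J. (\<Sum>n<N. coord f i n * z ^ n) * e' i v)"
        by (simp add: sum_distrib_right)
    qed
    have F: "F N \<in> KE" for N unfolding Feq by (rule KE_lincomb)
    have "(\<lambda>N. ell2_norm V (\<lambda>v. h v - F N v)) \<longlonglongrightarrow> 0"
    proof -
      have "(\<lambda>v. h v - F N v) = (\<lambda>v. \<Sum>i\<in>J. (c i - (\<Sum>n<N. coord f i n * z ^ n)) * e' i v)" for N
        by (simp add: h_def Feq left_diff_distrib sum_subtractf)
      then have "ell2_norm V (\<lambda>v. h v - F N v) = sqrt (\<Sum>i\<in>J. (cmod (c i - (\<Sum>n<N. coord f i n * z ^ n)))\<^sup>2)" for N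
        by (simp only: norm_lincomb[symmetric] real_sqrt_pow2_iff real_sqrt_abs abs_of_nonneg[OF ell2_norm_nonneg])
      moreover have "(\<lambda>N. c i - (\<Sum>n<N. coord f i n * z ^ n)) \<longlonglongrightarrow> 0" if "i \<in> J" for i
        using tendsto_diff[OF tendsto_const summable_LIMSEQ[OF sm[OF that]], of "c i"] by (simp add: c_def)
      then have "(\<lambda>N. sqrt (\<Sum>i\<in>J. (cmod (c i - (\<Sum>n<N. coord f i n * z ^ n)))\<^sup>2)) \<longlonglongrightarrow> sqrt (\<Sum>i\<in>J. (cmod 0)\<^sup>2)"
        by (intro tendsto_intros)
      ultimately show ?thesis by simp
    qed
    note lim = this
    have "model_U V S f z = h"
    proof -
      have po: "orth_proj V KE ((model_L V S ^^ n) f) = coef f n" for n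
        using f by (simp add: model_L_pow_eq orth_proj_eq L_pow_in coef_def)
      have "(THE h. h \<in> KE \<and> (\<lambda>N. ell2_norm V (\<lambda>v. h v - F N v)) \<longlonglongrightarrow> 0) = h"
      proof (rule the_equality)
        \<comment> \<open>Norm limits are unique, so the description in \<open>model_U\<close>
          denotes the coordinatewise limit \<open>h\<close>.\<close>
        fix k assume k: "k \<in> KE \<and> (\<lambda>N. ell2_norm V (\<lambda>v. k v - F N v)) \<longlonglongrightarrow> 0"
        have "ell2_norm V (\<lambda>v. k v - h v) \<le> ell2_norm V (\<lambda>v. k v - F N v) + ell2_norm V (\<lambda>v. h v - F N v)" for N
        proof -
          have "ell2_norm V (\<lambda>v. (k v - F N v) + (-1) * (h v - F N v)) \<le>
              ell2_norm V (\<lambda>v. k v - F N v) + ell2_norm V (\<lambda>v. (-1) * (h v - F N v))"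
            using k h F[of N] by (intro ell2_norm_triangle ell2_scale ell2_diff KE_in) auto
          then show ?thesis unfolding ell2_norm_scale by simp
        qed
        moreover have "(\<lambda>N. ell2_norm V (\<lambda>v. k v - F N v) + ell2_norm V (\<lambda>v. h v - F N v)) \<longlonglongrightarrow> 0"
          using tendsto_add[OF conjunct2[OF k] lim] by simp
        ultimately have "ell2_norm V (\<lambda>v. k v - h v) \<le> 0"
          by (intro LIMSEQ_le_const[where X = "\<lambda>N. ell2_norm V (\<lambda>v. k v - F N v) + ell2_norm V (\<lambda>v. h v - F N v)"]) auto
        then have "ell2_norm V (\<lambda>v. k v - h v) = 0" by (simp add: order_antisym)
        then have "(\<lambda>v. k v - h v) = (\<lambda>_. 0)"
          using k h by (intro ell2_eq_zero_if_norm[of _ V] ell2_diff KE_in) auto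
        then show "k = h" by (auto simp: fun_eq_iff)
      qed (use h lim in auto)
      then show ?thesis using z \<rho>(2)[of z] by (simp add: model_U_def po F_def)
    qed
    then have "inner (model_U V S f z) (e' j) = c j" by (simp add: h_def inner_lincomb j)
    then show "(\<lambda>n. coord f j n * z ^ n) sums inner (model_U V S f z) (e' j)"
      unfolding c_def using summable_sums[OF sm[OF j]] by simp
  qed (use \<rho> R in auto)
qed

lemma inj_model_U: "inj_on (model_U V S) (ell2 V)"
proof (rule inj_onI)
  fix f g assume fg: "f \<in> ell2 V" "g \<in> ell2 V" "model_U V S f = model_U V S g"
  obtain \<rho> where \<rho>: "\<rho> > 0"
    "\<And>f z j. f \<in> ell2 V \<Longrightarrow> cmod z < \<rho> \<Longrightarrow> j \<in> J \<Longrightarrow> (\<lambda>n. coord f j n * z ^ n) sums inner (model_U V S f z) (e' j)"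
    using model_U_coordinate by blast
  have "coord f j n - coord g j n = 0" if j: "j \<in> J" for j n
  proof (rule powser_zero_coefficients[OF \<rho>(1)])
    fix z assume z: "cmod z < \<rho>"
    show "(\<lambda>n. (coord f j n - coord g j n) * z ^ n) sums 0"
      using sums_diff[OF \<rho>(2)[OF fg(1) z j] \<rho>(2)[OF fg(2) z j]] by (simp add: fg(3) left_diff_distrib)
  qed
  then have "coef f n = coef g n" for n
    using fg by (intro KE_eqI coef_KE) auto
  then show "f = g" by (rule coef_inj[OF fg(1,2)])
qed

section \<open>Operators in the model as graphs over \<open>ell2 V\<close>\<close>

lemma model_U_adj_U: "f \<in> ell2 V \<Longrightarrow> model_U_adj V S (model_U V S f) = f"
  unfolding model_U_adj_def by (rule inv_into_f_f[OF inj_model_U])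

lemma taylor_coeff_U: "f \<in> ell2 V \<Longrightarrow> taylor_coeff V S (model_U V S f) n = coef f n"
  by (simp add: taylor_coeff_def model_U_adj_U model_L_pow_eq orth_proj_eq L_pow_in coef_def)

lemma transport_eq: "transport V S A = (\<lambda>f. (model_U V S f, model_U V S (A f))) ` ell2 V"
  unfolding transport_def model_space_def by (auto simp: model_U_adj_U image_iff)

lemma mult_op_eq:
  "mult_op V S \<phi> = (\<lambda>(f, g). (model_U V S f, model_U V S g)) `
    {(f, g). f \<in> ell2 V \<and> g \<in> ell2 V \<and> (\<forall>n. coef g n = (\<lambda>v. \<Sum>k\<le>n. \<phi> k (coef f (n - k)) v))}"
  (is "?L = ?R")
proof (intro set_eqI iffI)
  fix x assume "x \<in> ?L"
  then obtain f g where "x = (model_U V S f, model_U V S g)" "f \<in> ell2 V" "g \<in> ell2 V"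
    "\<forall>n. taylor_coeff V S (model_U V S g) n =
      (\<lambda>v. \<Sum>k\<le>n. \<phi> k (taylor_coeff V S (model_U V S f) (n - k)) v)"
    unfolding mult_op_def model_space_def by blast
  then show "x \<in> ?R" by (auto simp: taylor_coeff_U image_iff)
next
  fix x assume "x \<in> ?R"
  then show "x \<in> ?L" unfolding mult_op_def model_space_def by (auto simp: taylor_coeff_U)
qed

text \<open>Coefficients determine elements, so \<open>A f\<close> is the only partner of
  \<open>f\<close> in the convolution relation. In particular the maximal domain of
  \<open>mult_op\<close> is then the whole model space.\<close>

lemma transport_eq_mult_op:
  assumes "\<And>f. f \<in> ell2 V \<Longrightarrow> A f \<in> ell2 V"
    and A: "\<And>f n. f \<in> ell2 V \<Longrightarrow> coef (A f) n = (\<lambda>v. \<Sum>k\<le>n. \<phi> k (coef f (n - k)) v)"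
  shows "transport V S A = mult_op V S \<phi>"
proof -
  have "{(f, g). f \<in> ell2 V \<and> g \<in> ell2 V \<and> (\<forall>n. coef g n = (\<lambda>v. \<Sum>k\<le>n. \<phi> k (coef f (n - k)) v))}
    = (\<lambda>f. (f, A f)) ` ell2 V" (is "?L = ?R")
  proof (intro set_eqI iffI)
    fix x assume "x \<in> ?L"
    then obtain f g where x: "x = (f, g)" "f \<in> ell2 V" "g \<in> ell2 V"
      "\<And>n. coef g n = (\<lambda>v. \<Sum>k\<le>n. \<phi> k (coef f (n - k)) v)" by blast
    then have "g = A f" using coef_inj[OF x(3) assms(1)[OF x(2)]] by (simp add: x(4) A[OF x(2)])
    then show "x \<in> ?R" using x by blast
  qed (use assms in auto)
  then show ?thesis by (simp add: transport_eq mult_op_eq image_image)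
qed

section \<open>The commutant\<close>

lemma coord_bound:
  assumes f: "f \<in> ell2 V" and j: "j \<in> J"
  shows "wnorm beta (coord f j) N \<le> sqrt kappa * ell2_norm V f"
proof -
  have "(wnorm beta (coord f j) N)\<^sup>2 = (\<Sum>n<N. (cmod (coord f j n))\<^sup>2 * beta n)"
    by (intro wnorm_sq less_imp_le beta_pos)
  also have "\<dots> \<le> (\<Sum>n<N. beta n * (ell2_norm V (coef f n))\<^sup>2)"
    by (subst mult.commute) (intro sum_mono mult_left_mono power_mono KE_coordinate_le coef_KE f j less_imp_le[OF beta_pos] norm_ge_zero)
  also have "\<dots> \<le> kappa * (ell2_norm V f)\<^sup>2" by (rule coef_bound[OF f])
  also have "\<dots> = (sqrt kappa * ell2_norm V f)\<^sup>2" using kappa(1) by (simp add: power_mult_distrib)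
  finally show ?thesis
    using kappa(1) by (elim power2_le_imp_le) auto
qed

text \<open>Beyond the first \<open>Suc n\<close> terms of its expansion, \<open>f\<close> lies in
  the range of \<open>S ^^ Suc n\<close>. \<open>A\<close> preserves this range, and coefficient
  \<open>n\<close> vanishes on it; the remaining terms are shifted copies of \<open>A\<close> on the
  kernel.\<close>

lemma commutant_coef:
  assumes A: "A \<in> commutant V S" and f: "f \<in> ell2 V"
  shows "coef (A f) n = (\<lambda>v. \<Sum>k\<le>n. coef (A (coef f (n - k))) k v)"
proof -
  have Ab: "A \<in> bounded_ops V (ell2 V)" and AS: "\<And>f. f \<in> ell2 V \<Longrightarrow> A (S f) = S (A f)"
    using A by (auto simp: commutant_def)
  have ASn: "A ((S ^^ k) g) = (S ^^ k) (A g)" if "g \<in> ell2 V" for k g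
    by (induction k) (use that in \<open>auto simp: AS S_pow_in\<close>)
  note Ain = bounded_opsD(1)[OF Ab] and cin = KE_in[OF coef_KE[OF f]]
  define R where "R = (S ^^ Suc n) ((L ^^ Suc n) f)"
  have R: "R \<in> ell2 V" unfolding R_def by (intro S_pow_in L_pow_in f)
  have sin: "(\<lambda>v. \<Sum>k\<le>n. (S ^^ k) (coef f k) v) \<in> ell2 V" by (intro ell2_sum S_pow_in cin)
  have Abn: "(\<lambda>f. coef (A f) n) \<in> bounded_ops V (ell2 V)"
    by (rule bounded_ops_comp[OF coef_bounded_ops Ab])
  have fe: "f = (\<lambda>v. (\<Sum>k\<le>n. (S ^^ k) (coef f k) v) + R v)"
    using expansion[OF f, of "Suc n"] unfolding R_def lessThan_Suc_atMost .
  have "coef (A f) n = (\<lambda>v. coef (A (\<lambda>v. \<Sum>k\<le>n. (S ^^ k) (coef f k) v)) n v + coef (A R) n v)"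
    by (subst fe) (rule bounded_opsD(2)[OF Abn sin R])
  also have "coef (A R) n = (\<lambda>_. 0)"
    unfolding R_def ASn[OF L_pow_in[OF f]] by (intro coef_S_pow_less Ain L_pow_in f) simp
  also have "coef (A (\<lambda>v. \<Sum>k\<le>n. (S ^^ k) (coef f k) v)) n = (\<lambda>v. \<Sum>k\<le>n. coef (A ((S ^^ k) (coef f k))) n v)"
    by (rule bounded_ops_sum[OF Abn]) (intro S_pow_in cin)
  also have "(\<lambda>v. \<Sum>k\<le>n. coef (A ((S ^^ k) (coef f k))) n v) = (\<lambda>v. \<Sum>k\<le>n. coef (A (coef f k)) (n - k) v)"
    by (intro ext sum.cong) (auto simp: ASn cin coef_S_pow_ge Ain)
  also have "\<dots> = (\<lambda>v. \<Sum>k\<le>n. coef (A (coef f (n - k))) k v)"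
    by (intro ext sum.reindex_bij_witness[of _ "\<lambda>k. n - k" "\<lambda>k. n - k"]) auto
  finally show ?thesis by simp
qed

text \<open>A sequence \<open>b\<close> from the weighted space becomes an element \<open>f\<close>
  with coefficients \<open>b n\<close> times \<open>e' j\<close>. Its convolution with the symbol
  entry is then a coordinate sequence of \<open>A f\<close>, hence again in the weighted
  space.\<close>

lemma commutant_symbol:
  assumes A: "A \<in> commutant V S" and i: "i \<in> J" and j: "j \<in> J"
  shows "(\<lambda>n. inner (coef (A (e' j)) n) (e' i)) \<in> H_infinity beta"
  unfolding H_infinity_def
proof (intro CollectI ballI)
  fix b assume b: "b \<in> ell2_weighted beta"
  have Ab: "A \<in> bounded_ops V (ell2 V)" using A by (auto simp: commutant_def)
  obtain C where C: "\<And>N. wnorm beta b N \<le> C"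
    using b ell2_weighted_iff[of beta b] less_imp_le[OF beta_pos] by blast
  have g: "(\<lambda>v. b n * e' j v) \<in> KE" for n by (intro KE_scale basis_KE j)
  have "(\<Sum>k<N. beta k * (ell2_norm V (\<lambda>v. b k * e' j v))\<^sup>2) \<le> C\<^sup>2" for N
    using power_mono[OF C wnorm_nonneg, of N 2] wnorm_sq[of beta b N] less_imp_le[OF beta_pos]
    by (simp add: ell2_norm_scale norm_basis j mult.commute)
  then obtain f where f: "f \<in> ell2 V" "\<And>n. coef f n = (\<lambda>v. b n * e' j v)"
    using synthesis[of "\<lambda>n v. b n * e' j v", OF g] by blast
  have ck: "coef (A (\<lambda>v. c * e' j v)) k = (\<lambda>v. c * coef (A (e' j)) k v)" for c k
    by (rule bounded_opsD(3)[OF bounded_ops_comp[OF coef_bounded_ops Ab] basis_in[OF j]])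
  have "seq_conv (\<lambda>n. inner (coef (A (e' j)) n) (e' i)) b n = coord (A f) i n" for n
  proof -
    have "coord (A f) i n = inner (\<lambda>v. \<Sum>k\<le>n. b (n - k) * coef (A (e' j)) k v) (e' i)"
      by (simp add: commutant_coef[OF A f(1)] f(2) ck)
    also have "\<dots> = (\<Sum>k\<le>n. b (n - k) * inner (coef (A (e' j)) k) (e' i))"
      using i j by (subst ell2_inner_sum_left)
        (auto simp: ell2_inner_scale_left intro!: KE_in KE_scale coef_KE bounded_opsD(1)[OF Ab] basis_KE)
    finally show ?thesis by (simp add: seq_conv_def mult.commute)
  qed
  then have "seq_conv (\<lambda>n. inner (coef (A (e' j)) n) (e' i)) b = coord (A f) i" by auto
  moreover have "coord (A f) i \<in> ell2_weighted beta"
    using ell2_weighted_iff[of beta "coord (A f) i"] less_imp_le[OF beta_pos]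
      coord_bound[OF bounded_opsD(1)[OF Ab f(1)] i] by blast
  ultimately show "seq_conv (\<lambda>n. inner (coef (A (e' j)) n) (e' i)) b \<in> ell2_weighted beta" by simp
qed

lemma wnorm_sum_le:
  "(\<And>j. j \<in> I \<Longrightarrow> wnorm beta (b j) N \<le> c j) \<Longrightarrow> wnorm beta (\<lambda>n. \<Sum>j\<in>I. b j n) N \<le> (\<Sum>j\<in>I. c j)"
proof (induction I rule: infinite_finite_induct)
  case (insert j I)
  have "wnorm beta (\<lambda>n. b j n + (\<Sum>j\<in>I. b j n)) N \<le> wnorm beta (b j) N + wnorm beta (\<lambda>n. \<Sum>j\<in>I. b j n) N"
    by (intro wnorm_triangle less_imp_le beta_pos)
  also have "\<dots> \<le> c j + (\<Sum>j\<in>I. c j)" using insert by (intro add_mono) auto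
  finally show ?case using insert by simp
qed (auto simp: wnorm_def L2_set_def)

text \<open>The convolution prescribes the coefficients of \<open>A f\<close>. The uniform
  multiplier bounds make \<open>synthesis\<close> applicable, and uniqueness of coefficients yields
  the algebraic properties of \<open>A\<close>.\<close>

lemma multiplier_operator:
  assumes \<phi>: "\<And>n. \<phi> n \<in> bounded_ops V KE"
    and H: "\<And>i j. i \<in> J \<Longrightarrow> j \<in> J \<Longrightarrow> (\<lambda>n. inner (\<phi> n (e' j)) (e' i)) \<in> H_infinity beta"
  obtains A where "A \<in> commutant V S"
    "\<And>f n. f \<in> ell2 V \<Longrightarrow> coef (A f) n = (\<lambda>v. \<Sum>k\<le>n. \<phi> k (coef f (n - k)) v)"
proof -
  define G where "G f n = (\<lambda>v. \<Sum>k\<le>n. \<phi> k (coef f (n - k)) v)" for f n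
  note \<phi>in = bounded_opsD(1)[OF \<phi>]
  have G: "G f n \<in> KE" if "f \<in> ell2 V" for f n
    unfolding G_def using that by (intro KE_sum \<phi>in coef_KE)
  have "\<forall>i\<in>J. \<forall>j\<in>J. \<exists>C\<ge>0. \<forall>b N. wnorm beta (seq_conv (\<lambda>n. inner (\<phi> n (e' j)) (e' i)) b) N \<le> C * wnorm beta b N"
    using H_infinity_bounded[OF beta_pos H] by blast
  then obtain C where C: "\<And>i j. i \<in> J \<Longrightarrow> j \<in> J \<Longrightarrow> 0 \<le> C i j"
    "\<And>i j b N. i \<in> J \<Longrightarrow> j \<in> J \<Longrightarrow> wnorm beta (seq_conv (\<lambda>n. inner (\<phi> n (e' j)) (e' i)) b) N \<le> C i j * wnorm beta b N"
    by metis
  have Gcoord: "inner (G f n) (e' i) = (\<Sum>j\<in>J. seq_conv (\<lambda>n. inner (\<phi> n (e' j)) (e' i)) (coord f j) n)"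
    if f: "f \<in> ell2 V" and i: "i \<in> J" for f n i
  proof -
    have \<phi>c: "\<phi> k (coef f m) = (\<lambda>v. \<Sum>j\<in>J. coord f j m * \<phi> k (e' j) v)" for k m
    proof -
      have "\<phi> k (coef f m) = \<phi> k (\<lambda>v. \<Sum>j\<in>J. coord f j m * e' j v)"
        by (rule arg_cong[OF KE_expansion[OF coef_KE[OF f]]])
      also have "\<dots> = (\<lambda>v. \<Sum>j\<in>J. \<phi> k (\<lambda>v. coord f j m * e' j v) v)"
        by (rule bounded_ops_sum_on[OF \<phi> KE_zero]) (auto intro: KE_add KE_scale basis_KE)
      also have "\<dots> = (\<lambda>v. \<Sum>j\<in>J. coord f j m * \<phi> k (e' j) v)"
        by (intro ext sum.cong refl) (simp add: bounded_opsD(3)[OF \<phi>] basis_KE)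
      finally show ?thesis .
    qed
    have \<phi>e: "inner (\<phi> k (coef f m)) (e' i) = (\<Sum>j\<in>J. coord f j m * inner (\<phi> k (e' j)) (e' i))" for k m
      unfolding \<phi>c using i by (subst ell2_inner_sum_left)
        (auto simp: ell2_inner_scale_left intro!: KE_in KE_scale \<phi>in basis_KE)
    have "inner (G f n) (e' i) = (\<Sum>k\<le>n. inner (\<phi> k (coef f (n - k))) (e' i))"
      unfolding G_def using i by (intro ell2_inner_sum_left basis_in KE_in[OF \<phi>in[OF coef_KE[OF f]]])
    also have "\<dots> = (\<Sum>j\<in>J. \<Sum>k\<le>n. coord f j (n - k) * inner (\<phi> k (e' j)) (e' i))"
      unfolding \<phi>e by (rule sum.swap)
    finally show ?thesis by (simp add: seq_conv_def mult.commute)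
  qed
  \<comment> \<open>\<open>C i j\<close> bounds the multiplier and \<open>sqrt kappa\<close> the
    coordinate sequence of \<open>f\<close>; summing over \<open>j\<close> gives coordinate
    \<open>i\<close>, and summing the squares over \<open>i\<close> is Parseval.\<close>
  define D where "D = (\<Sum>i\<in>J. (\<Sum>j\<in>J. C i j * sqrt kappa)\<^sup>2)"
  have D0: "0 \<le> D" unfolding D_def by (intro sum_nonneg) auto
  have Gbound: "(\<Sum>k<N. beta k * (ell2_norm V (G f k))\<^sup>2) \<le> D * (ell2_norm V f)\<^sup>2" if f: "f \<in> ell2 V" for f N
  proof -
    have w: "wnorm beta (\<lambda>n. inner (G f n) (e' i)) N \<le> (\<Sum>j\<in>J. C i j * sqrt kappa) * ell2_norm V f"
      if i: "i \<in> J" for i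
      unfolding Gcoord[OF f i] sum_distrib_right
    proof (rule wnorm_sum_le)
      fix j assume j: "j \<in> J"
      show "wnorm beta (seq_conv (\<lambda>n. inner (\<phi> n (e' j)) (e' i)) (coord f j)) N \<le> C i j * sqrt kappa * ell2_norm V f"
        using order_trans[OF C(2)[OF i j] mult_left_mono[OF coord_bound[OF f j] C(1)[OF i j]]]
        by (simp add: mult.assoc)
    qed
    have "(\<Sum>k<N. beta k * (ell2_norm V (G f k))\<^sup>2) = (\<Sum>k<N. \<Sum>i\<in>J. (cmod (inner (G f k) (e' i)))\<^sup>2 * beta k)"
      by (simp add: parseval[OF G[OF f]] sum_distrib_left mult.commute)
    also have "\<dots> = (\<Sum>i\<in>J. (wnorm beta (\<lambda>n. inner (G f n) (e' i)) N)\<^sup>2)"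
      by (subst sum.swap) (simp add: wnorm_sq less_imp_le[OF beta_pos])
    also have "\<dots> \<le> (\<Sum>i\<in>J. ((\<Sum>j\<in>J. C i j * sqrt kappa) * ell2_norm V f)\<^sup>2)"
      by (intro sum_mono power_mono w wnorm_nonneg)
    also have "\<dots> = D * (ell2_norm V f)\<^sup>2" unfolding D_def power_mult_distrib by (rule sum_distrib_right[symmetric])
    finally show ?thesis .
  qed
  have "\<exists>g. g \<in> ell2 V \<and> (\<forall>n. coef g n = G f n) \<and> (ell2_norm V g)\<^sup>2 \<le> kappa * (D * (ell2_norm V f)\<^sup>2)"
    if f: "f \<in> ell2 V" for f
    using synthesis[of "G f", OF G[OF f] Gbound[OF f]] by blast
  \<comment> \<open>\<open>A f\<close> is chosen separately for each \<open>f\<close>; linearity and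
    commutation with \<open>S\<close> are recovered below from \<open>coef_inj\<close>.\<close>
  then obtain A where A: "\<And>f. f \<in> ell2 V \<Longrightarrow> A f \<in> ell2 V" "\<And>f n. f \<in> ell2 V \<Longrightarrow> coef (A f) n = G f n"
    "\<And>f. f \<in> ell2 V \<Longrightarrow> (ell2_norm V (A f))\<^sup>2 \<le> kappa * (D * (ell2_norm V f)\<^sup>2)"
    by metis
  note cadd = bounded_opsD(2)[OF coef_bounded_ops] and cscale = bounded_opsD(3)[OF coef_bounded_ops]
  have Gadd: "G (\<lambda>v. f v + g v) n = (\<lambda>v. G f n v + G g n v)" if "f \<in> ell2 V" "g \<in> ell2 V" for f g n
    using that by (simp add: G_def cadd bounded_opsD(2)[OF \<phi>] coef_KE sum.distrib)
  have Gscale: "G (\<lambda>v. c * f v) n = (\<lambda>v. c * G f n v)" if "f \<in> ell2 V" for f c n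
    using that by (simp add: G_def cscale bounded_opsD(3)[OF \<phi>] coef_KE sum_distrib_left)
  have \<phi>0: "\<phi> k (\<lambda>_. 0) = (\<lambda>_. 0)" for k using bounded_opsD(3)[OF \<phi> KE_zero, of k 0] by simp
  have cS: "coef (S g) n = (case n of 0 \<Rightarrow> (\<lambda>_. 0) | Suc m \<Rightarrow> coef g m)" if "g \<in> ell2 V" for g n
    using that coef_S_pow_less[of g n 1] coef_S_pow_ge[of g 1 n] by (cases n) auto
  \<comment> \<open>\<open>S\<close> shifts the coefficient sequence by one place, and convolution
    commutes with this shift. The extra term \<open>k = n\<close> meets the coefficient 0 of
    \<open>S f\<close>, which is zero.\<close>
  have GS: "G (S f) n = (case n of 0 \<Rightarrow> (\<lambda>_. 0) | Suc m \<Rightarrow> G f m)" if "f \<in> ell2 V" for f n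
  proof (cases n)
    case 0
    then show ?thesis using that by (simp add: G_def cS \<phi>0)
  next
    case (Suc m)
    have "G (S f) n v = G f m v" for v
    proof -
      have "G (S f) n v = (\<Sum>k\<le>m. \<phi> k (coef (S f) (Suc m - k)) v)"
        using that Suc by (simp add: G_def cS \<phi>0)
      also have "\<dots> = G f m v"
        unfolding G_def using that by (intro sum.cong) (auto simp: cS Suc_diff_le)
      finally show ?thesis .
    qed
    then show ?thesis using Suc by auto
  qed
  have "A \<in> bounded_ops V (ell2 V)"
    unfolding bounded_ops_def
  proof (intro CollectI conjI ballI allI exI)
    fix f g assume fg: "f \<in> ell2 V" "g \<in> ell2 V"
    show "A (\<lambda>v. f v + g v) = (\<lambda>v. A f v + A g v)"
      by (rule coef_inj) (use fg in \<open>auto simp: A ell2_add cadd Gadd\<close>)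
  next
    fix c f assume f: "f \<in> ell2 V"
    show "A (\<lambda>v. c * f v) = (\<lambda>v. c * A f v)"
      by (rule coef_inj) (use f in \<open>auto simp: A ell2_scale cscale Gscale\<close>)
  next
    fix f assume f: "f \<in> ell2 V"
    show "ell2_norm V (A f) \<le> sqrt (kappa * D) * ell2_norm V f"
    proof (rule power2_le_imp_le)
      show "(ell2_norm V (A f))\<^sup>2 \<le> (sqrt (kappa * D) * ell2_norm V f)\<^sup>2"
        using A(3)[OF f] kappa(1) D0 by (simp add: power_mult_distrib mult.assoc)
    qed (use kappa(1) D0 in simp)
  qed (rule A)
  moreover have "A (S f) = S (A f)" if "f \<in> ell2 V" for f
    by (rule coef_inj) (use that in \<open>auto simp: A S_in cS GS split: nat.split\<close>)
  ultimately have "A \<in> commutant V S" by (simp add: commutant_def)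
  then show ?thesis using that A(2) by (simp add: G_def)
qed

lemma symbol_bounded_ops:
  assumes "A \<in> commutant V S"
  shows "(\<lambda>e. coef (A e) n) \<in> bounded_ops V KE"
proof -
  have A: "A \<in> bounded_ops V (ell2 V)" using assms by (simp add: commutant_def)
  have B: "(\<lambda>f. coef (A f) n) \<in> bounded_ops V (ell2 V)"
    by (rule bounded_ops_comp[OF coef_bounded_ops A])
  have "coef (A e) n \<in> KE" if "e \<in> KE" for e
    by (rule coef_KE[OF bounded_opsD(1)[OF A KE_in[OF that]]])
  then show ?thesis
    using bounded_opsD(2,3,4)[OF B] KE_in unfolding bounded_ops_def by blast
qed

lemma commutant_model:
  "transport V S ` commutant V S =
    {mult_op V S \<phi> | \<phi>. (\<forall>n. \<phi> n \<in> bounded_ops V KE) \<and>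
       (\<forall>i\<in>J. \<forall>j\<in>J. (\<lambda>n. inner (\<phi> n (e' j)) (e' i)) \<in> H_infinity beta)}"
  (is "?L = ?R")
proof (intro set_eqI iffI)
  fix X assume "X \<in> ?L"
  then obtain A where A: "A \<in> commutant V S" "X = transport V S A" by blast
  \<comment> \<open>The symbol is forced: a kernel element \<open>e\<close> has \<open>e\<close> as
    its only nonzero coefficient, at index 0, so the convolution formula at \<open>e\<close> reads
    \<open>coef (A e) n = \<phi> n e\<close>.\<close>
  define \<phi> where "\<phi> n = (\<lambda>e. coef (A e) n)" for n
  have "A f \<in> ell2 V" if "f \<in> ell2 V" for f
    using A that bounded_opsD(1) by (auto simp: commutant_def)
  then have "X = mult_op V S \<phi>"
    unfolding A(2) by (rule transport_eq_mult_op) (simp_all add: \<phi>_def commutant_coef[OF A(1)])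
  moreover have "\<phi> n \<in> bounded_ops V KE" for n
    unfolding \<phi>_def by (rule symbol_bounded_ops[OF A(1)])
  moreover have "(\<lambda>n. inner (\<phi> n (e' j)) (e' i)) \<in> H_infinity beta" if "i \<in> J" "j \<in> J" for i j
    unfolding \<phi>_def by (rule commutant_symbol[OF A(1) that])
  ultimately show "X \<in> ?R" by blast
next
  fix X assume "X \<in> ?R"
  then obtain \<phi> where \<phi>: "X = mult_op V S \<phi>" "\<And>n. \<phi> n \<in> bounded_ops V KE"
    "\<And>i j. i \<in> J \<Longrightarrow> j \<in> J \<Longrightarrow> (\<lambda>n. inner (\<phi> n (e' j)) (e' i)) \<in> H_infinity beta" by blast
  obtain A where A: "A \<in> commutant V S"
    "\<And>f n. f \<in> ell2 V \<Longrightarrow> coef (A f) n = (\<lambda>v. \<Sum>k\<le>n. \<phi> k (coef f (n - k)) v)"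
    using multiplier_operator[of \<phi>, OF \<phi>(2,3)] by blast
  have "A f \<in> ell2 V" if "f \<in> ell2 V" for f
    using A(1) that bounded_opsD(1) by (auto simp: commutant_def)
  then have "transport V S A = X" unfolding \<phi>(1) by (rule transport_eq_mult_op[OF _ A(2)])
  then show "X \<in> ?L" using A(1) by blast
qed

end

theorem corollary25:
  fixes V :: "'v set" and E :: "('v \<times> 'v) set" and lam :: "'v \<Rightarrow> real"
    and J :: "'j set" and e' :: "'j \<Rightarrow> 'v \<Rightarrow> complex"
  defines "S \<equiv> weighted_shift V E lam"
  assumes tree: "rooted_directed_tree V E"
    and countably_infinite: "countable V" "infinite V"
    and leafless: "leafless V E"
    and weights: "\<forall>v\<in>V - {tree_root V E}. lam v > 0"
    and bounded: "S \<in> bounded_ops V (ell2 V)"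
    and balanced: "balanced V E S"
    and left_invertible: "left_invertible V S"
    and fin_dim: "finite_dimensional (ker_adjoint V S)"
    and basis: "separated_basis V E (ker_adjoint V S) J e'"
  shows "transport V S ` commutant V S =
    {mult_op V S \<phi> | \<phi>. (\<forall>n. \<phi> n \<in> bounded_ops V (ker_adjoint V S)) \<and>
       (\<forall>i\<in>J. \<forall>j\<in>J. (\<lambda>n. ell2_inner V (\<phi> n (e' j)) (e' i)) \<in>
          H_infinity (\<lambda>n. (ell2_norm V ((S ^^ n) (indicator {tree_root V E})))\<^sup>2))}"
proof -
  interpret balanced_shift_basis V E lam J e'
    by unfold_locales (use tree bounded balanced left_invertible fin_dim basis in \<open>simp_all add: S_def\<close>)
  show ?thesis
    using commutant_model unfolding S_def norm_S_pow_root .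
qed

end
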